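(* Let $k$ be a field of characteristic zero, let $G$ be a reductive algebraic group over $k$, and let $V$ and $W$ be two finite-dimensional $k$-vector spaces, each equipped with an almost free linear $G$-action. Then the fields $k(V)^G$ and $k(W)^G$ are stably equivalent over $k$. If one of them is pure over $k$, then the other one is stably pure over $k$.
   Context: Reductive groups are not assumed connected. For a geometrically integral $k$-variety $X$, $k(X)$ is its function field; $\bar k$ is an algebraic closure of $k$, $\bar X=X\times_k\bar k$, and $\bar k(X)$ is the function field of $\bar X$. If a linear algebraic $k$-group $G$ acts on $X$, then $k(X)^G$ denotes the subfield of $\bar k(X)^{G(\bar k)}$ fixed by $\mathrm{Gal}(\bar k/k)$. A vector space is regarded as an affine space. An action of $G$ on $X$ is almost free if there is a non-empty open set $U\subset X$ such that for every $x\in U(\bar k)$ the stabilizer $G_x\subset G(\bar k)$ is trivial. A field extension is pure if it is purely transcendental; a field $K/k$ is stably pure over $k$ if $K(x_1,\dots,x_r)$ is purely transcendental over $k$ for some independent variables $x_1,\dots,x_r$. Fields $K,L$ over $k$ are stably equivalent if there are independent variables with $K(x_1,\dots,x_r)\cong L(y_1,\dots,y_s)$ over $k$. *)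

theory Defs
  imports
    "HOL-Library.Poly_Mapping"
    "HOL-Computational_Algebra.Fraction_Field"
    "HOL-Algebra.Algebraic_Closure_Type"
    "HOL-Algebra.Generated_Fields"
    "HOL-Algebra.Group_Action"
    "HOL-Analysis.Abstract_Topology"
    "Jordan_Normal_Form.Matrix"
    "Jordan_Normal_Form.Determinant"
begin

section \<open>Polynomials and rational functions\<close>

text \<open>A polynomial in commuting variables indexed by \<open>'i\<close> is a finitely supported map from
  exponent vectors to coefficients.\<close>

type_synonym ('i, 'a) mpoly = "('i \<Rightarrow>\<^sub>0 nat) \<Rightarrow>\<^sub>0 'a"

definition polys :: "'a::zero set \<Rightarrow> 'i set \<Rightarrow> ('i, 'a) mpoly set" where
  "polys K I = {p. \<forall>m \<in> Poly_Mapping.keys p.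
      Poly_Mapping.lookup p m \<in> K \<and> Poly_Mapping.keys m \<subseteq> I}"

text \<open>The value at \<open>x\<close> of the polynomial obtained from \<open>p\<close> by applying \<open>\<phi>\<close> to its coefficients.\<close>

definition poly_eval ::
  "('a::zero \<Rightarrow> 'b::comm_ring_1) \<Rightarrow> ('i \<Rightarrow> 'b) \<Rightarrow> ('i, 'a) mpoly \<Rightarrow> 'b" where
  "poly_eval \<phi> x p = (\<Sum>m \<in> Poly_Mapping.keys p. \<phi> (Poly_Mapping.lookup p m) *
      (\<Prod>i \<in> Poly_Mapping.keys m. x i ^ Poly_Mapping.lookup m i))"

definition poly_const :: "'a::zero \<Rightarrow> ('i, 'a) mpoly" where
  "poly_const c = Poly_Mapping.single 0 c"

definition poly_var :: "'i \<Rightarrow> ('i, 'a::zero_neq_one) mpoly" where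
  "poly_var i = Poly_Mapping.single (Poly_Mapping.single i 1) 1"

text \<open>Rational functions over \<open>'a\<close> in countably many variables; all rational function fields
  in finitely many variables are realised as subfields.\<close>

type_synonym 'a ratfun = "(nat, 'a) mpoly fract"

definition ratfun_const :: "'a::idom \<Rightarrow> 'a ratfun" where
  "ratfun_const c = Fract (poly_const c) 1"

text \<open>For a subfield \<open>K\<close>, this is the field \<open>K(x\<^sub>0, \<dots>, x\<^bsub>r-1\<^esub>)\<close>.\<close>

definition ratfuns :: "'a::idom set \<Rightarrow> nat \<Rightarrow> 'a ratfun set" where
  "ratfuns K r = {Fract p q | p q. p \<in> polys K {..<r} \<and> q \<in> polys K {..<r} \<and> q \<noteq> 0}"

text \<open>The extension to the fraction field of an injective ring endomorphism \<open>\<phi>\<close>. The choice of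
  the representing fraction is then immaterial, as the subsequent lemma shows.\<close>

definition fract_map :: "('a::idom \<Rightarrow> 'a) \<Rightarrow> 'a fract \<Rightarrow> 'a fract" where
  "fract_map \<phi> f =
     (let (p, q) = (SOME (p, q). q \<noteq> 0 \<and> f = Fract p q) in Fract (\<phi> p) (\<phi> q))"

lemma fract_map_Fract:
  assumes mult: "\<And>x y. \<phi> (x * y) = \<phi> x * \<phi> y"
    and zero: "\<phi> 0 = 0" and inj: "inj \<phi>" and b: "b \<noteq> 0"
  shows "fract_map \<phi> (Fract a b) = Fract (\<phi> a) (\<phi> b)"
proof -
  define P where "P = (\<lambda>(p, q). q \<noteq> 0 \<and> Fract a b = Fract p q)"
  obtain p q where pq: "(SOME x. P x) = (p, q)" by fastforce
  have "P (a, b)" using b by (simp add: P_def)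
  then have "P (SOME x. P x)" by (rule someI)
  then have "P (p, q)" unfolding pq .
  then have q: "q \<noteq> 0" and eq: "Fract a b = Fract p q" by (simp_all add: P_def)
  have "a * q = p * b" using eq b q by (simp add: eq_fract)
  then have "\<phi> a * \<phi> q = \<phi> p * \<phi> b" by (metis mult)
  moreover have "\<phi> b \<noteq> 0" "\<phi> q \<noteq> 0" using b q zero inj by (metis injD)+
  ultimately have "Fract (\<phi> p) (\<phi> q) = Fract (\<phi> a) (\<phi> b)" by (simp add: eq_fract)
  then show ?thesis
    using pq unfolding fract_map_def P_def by simp
qed

section \<open>Field extensions\<close>

text \<open>Subfields are carriers inside a field type; \<open>k\<close> is a subfield of \<open>K\<close> throughout.\<close>

definition subring_of :: "'a::comm_ring_1 set \<Rightarrow> 'a ring" where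
  "subring_of K = ring_of_type_algebra\<lparr>carrier := K\<rparr>"

definition algebraically_independent :: "'a::field set \<Rightarrow> 'a set \<Rightarrow> bool" where
  "algebraically_independent k S \<longleftrightarrow>
     (\<forall>p \<in> polys k S. poly_eval (\<lambda>c. c) (\<lambda>s. s) p = 0 \<longrightarrow> p = 0)"

definition pure_over :: "'a::field set \<Rightarrow> 'a set \<Rightarrow> bool" where
  "pure_over k K \<longleftrightarrow> (\<exists>S \<subseteq> K. algebraically_independent k S \<and>
     K = generate_field ring_of_type_algebra (k \<union> S))"

definition stably_pure_over :: "'a::field set \<Rightarrow> 'a set \<Rightarrow> bool" where
  "stably_pure_over k K \<longleftrightarrow> (\<exists>r. pure_over (ratfun_const ` k) (ratfuns K r))"

definition stably_equivalent_over :: "'a::field set \<Rightarrow> 'a set \<Rightarrow> 'a set \<Rightarrow> bool" where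
  "stably_equivalent_over k K L \<longleftrightarrow>
     (\<exists>r s. \<exists>h \<in> ring_iso (subring_of (ratfuns K r)) (subring_of (ratfuns L s)).
        \<forall>c \<in> k. h (ratfun_const c) = ratfun_const c)"

section \<open>Linear algebraic groups\<close>

text \<open>The base field is the type \<open>'k\<close>, seen inside its algebraic closure. In characteristic zero,
  algebraic groups are smooth, and so a linear algebraic \<open>'k\<close>-group is given by its group
  of geometric points: a subgroup of some \<open>GL\<^sub>n\<close> over the algebraic closure that is cut out by
  polynomials with coefficients in \<open>'k\<close>.\<close>

definition base_field :: "'k::field alg_closure set" where
  "base_field = range to_ac"

definition galois_group :: "('k::field alg_closure \<Rightarrow> 'k alg_closure) set" where
  "galois_group = {\<sigma> \<in> ring_iso ring_of_type_algebra ring_of_type_algebra.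
     \<forall>c. \<sigma> (to_ac c) = to_ac c}"

definition GL :: "nat \<Rightarrow> 'a::field mat monoid" where
  "GL n = units_of (ring_mat TYPE('a) n ())"

abbreviation GL_sub :: "nat \<Rightarrow> 'a::field mat set \<Rightarrow> 'a mat monoid" where
  "GL_sub n G \<equiv> (GL n)\<lparr>carrier := G\<rparr>"

abbreviation entry_poly_eval :: "'a::field mat \<Rightarrow> (nat \<times> nat, 'a) mpoly \<Rightarrow> 'a" where
  "entry_poly_eval g \<equiv> poly_eval (\<lambda>c. c) (\<lambda>ij. g $$ ij)"

text \<open>The Zariski topologies on \<open>GL\<^sub>n\<close> and on affine \<open>m\<close>-space, with basis the non-vanishing sets
  of polynomials with coefficients in the subfield \<open>K\<close>.\<close>

definition zariski_GL :: "'a::field set \<Rightarrow> nat \<Rightarrow> 'a mat topology" where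
  "zariski_GL K n = topology_generated_by
     {{g \<in> carrier (GL n). entry_poly_eval g p \<noteq> 0} | p. p \<in> polys K ({..<n} \<times> {..<n})}"

definition zariski_vec :: "'a::field set \<Rightarrow> nat \<Rightarrow> 'a vec topology" where
  "zariski_vec K m = topology_generated_by
     {{v \<in> carrier_vec m. poly_eval (\<lambda>c. c) (\<lambda>i. v $ i) p \<noteq> 0} | p. p \<in> polys K {..<m}}"

definition linear_algebraic_group :: "nat \<Rightarrow> 'k::field_char_0 alg_closure mat set \<Rightarrow> bool" where
  "linear_algebraic_group n G \<longleftrightarrow> subgroup G (GL n) \<and> closedin (zariski_GL base_field n) G"

definition unipotent :: "nat \<Rightarrow> 'a::field mat set \<Rightarrow> bool" where
  "unipotent n U \<longleftrightarrow> (\<forall>u \<in> U. \<exists>d. (u - 1\<^sub>m n) ^\<^sub>m d = 0\<^sub>m n n)"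

text \<open>Trivial geometric unipotent radical; \<open>G\<close> need not be connected.\<close>

definition reductive_group :: "nat \<Rightarrow> 'k::field_char_0 alg_closure mat set \<Rightarrow> bool" where
  "reductive_group n G \<longleftrightarrow> linear_algebraic_group n G \<and>
     (\<forall>U. U \<lhd> GL_sub n G \<and> closedin (zariski_GL UNIV n) U \<and> connectedin (zariski_GL UNIV n) U \<and>
        unipotent n U \<longrightarrow> U = {1\<^sub>m n})"

section \<open>Linear actions and their invariant fields\<close>

text \<open>The regular functions on \<open>GL\<^sub>n\<close> over \<open>'k\<close> are generated by the matrix entries and the
  inverse of the determinant; those on \<open>G\<close> are their restrictions.\<close>

definition regular_function ::
  "nat \<Rightarrow> 'k::field_char_0 alg_closure mat set \<Rightarrow> ('k alg_closure mat \<Rightarrow> 'k alg_closure) \<Rightarrow> bool" where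
  "regular_function n G f \<longleftrightarrow>
     (\<exists>p \<in> polys base_field ({..<n} \<times> {..<n}). \<exists>d. \<forall>g \<in> G. f g = entry_poly_eval g p / det g ^ d)"

text \<open>A linear action of \<open>G\<close> on the \<open>'k\<close>-vector space \<open>'k\<^sup>m\<close>: a homomorphism of algebraic
  \<open>'k\<close>-groups from \<open>G\<close> to \<open>GL\<^sub>m\<close>.\<close>

definition linear_action ::
  "nat \<Rightarrow> 'k::field_char_0 alg_closure mat set \<Rightarrow> nat \<Rightarrow>
   ('k alg_closure mat \<Rightarrow> 'k alg_closure mat) \<Rightarrow> bool" where
  "linear_action n G m \<rho> \<longleftrightarrow> \<rho> \<in> hom (GL_sub n G) (GL m) \<and>
     (\<forall>i < m. \<forall>j < m. regular_function n G (\<lambda>g. \<rho> g $$ (i, j)))"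

definition almost_free ::
  "nat \<Rightarrow> 'k::field_char_0 alg_closure mat set \<Rightarrow> nat \<Rightarrow>
   ('k alg_closure mat \<Rightarrow> 'k alg_closure mat) \<Rightarrow> bool" where
  "almost_free n G m \<rho> \<longleftrightarrow> (\<exists>U. openin (zariski_vec base_field m) U \<and> U \<noteq> {} \<and>
     (\<forall>x \<in> U. stabilizer (GL_sub n G) (\<lambda>g v. \<rho> g *\<^sub>v v) x = {1\<^sub>m n}))"

text \<open>Composition of a polynomial function on affine \<open>m\<close>-space with the linear map \<open>A\<close>. The
  variables with index at least \<open>m\<close>, which do not occur on this space, are left alone, so
  that the substitution is injective for invertible \<open>A\<close>.\<close>

definition linear_subst :: "nat \<Rightarrow> 'a::field mat \<Rightarrow> (nat, 'a) mpoly \<Rightarrow> (nat, 'a) mpoly" where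
  "linear_subst m A = poly_eval poly_const
     (\<lambda>i. if i < m then \<Sum>j < m. poly_const (A $$ (i, j)) * poly_var j else poly_var i)"

text \<open>\<open>(g f)(v) = f (g\<^sup>-\<^sup>1 v)\<close>\<close>

definition GL_act :: "nat \<Rightarrow> 'a::field mat \<Rightarrow> 'a ratfun \<Rightarrow> 'a ratfun" where
  "GL_act m g = fract_map (linear_subst m (inv\<^bsub>GL m\<^esub> g))"

definition galois_act :: "('a \<Rightarrow> 'a::field) \<Rightarrow> 'a ratfun \<Rightarrow> 'a ratfun" where
  "galois_act \<sigma> = fract_map (Poly_Mapping.map \<sigma>)"

definition invariant_field ::
  "'k::field_char_0 alg_closure mat set \<Rightarrow> nat \<Rightarrow>
   ('k alg_closure mat \<Rightarrow> 'k alg_closure mat) \<Rightarrow> 'k alg_closure ratfun set" where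
  "invariant_field G m \<rho> = {f \<in> ratfuns UNIV m.
     (\<forall>g \<in> G. GL_act m (\<rho> g) f = f) \<and> (\<forall>\<sigma> \<in> galois_group. galois_act \<sigma> f = f)}"

end

theory Submission
  imports Defs "HOL-Library.Function_Algebras"
begin

text \<open>
  The theorem follows from the no-name lemma: \<open>k(V \<oplus> W)\<^sup>G\<close> is purely transcendental over
  \<open>k(V)\<^sup>G\<close>, of degree the dimension of \<open>W\<close>, as soon as \<open>G\<close> acts almost freely on \<open>V\<close>. By symmetry
  the same field is purely transcendental over \<open>k(W)\<^sup>G\<close>, which gives a stable isomorphism
  over \<open>k\<close>. A pure extension stays pure when variables are adjoined, so an isomorphism
  between the two rational function fields carries purity of \<open>k(V)\<^sup>G\<close> to stable purity of
  \<open>k(W)\<^sup>G\<close>.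

  Let \<open>F\<close> be the field of rational functions on \<open>V\<close> over the algebraic closure. Both the
  geometric points of \<open>G\<close> and the Galois group act on \<open>F\<close>, and semilinearly on the
  \<open>F\<close>-vector space with basis the coordinates \<open>y\<close> of \<open>W\<close>. If this space has a basis \<open>z\<close> of
  invariant vectors, then \<open>F(y) = F(z)\<close>, and an invariant of \<open>F(z)\<close> is a rational function
  of \<open>z\<close> over the fixed field of \<open>F\<close> (\<open>no_name_field\<close>). A basis of invariants is
  a matrix \<open>Q\<close> of rational functions on \<open>V\<close> with \<open>det Q \<noteq> 0\<close> and \<open>Q(g x) \<tau>(g) = Q(x)\<close>. For finite
  \<open>G\<close> its existence is Hilbert's Theorem 90.

  For general \<open>G\<close> it comes from almost freeness. A general \<open>x\<close> has trivial stabilizer, so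
  \<open>g\<close> is determined by \<open>x\<close> and \<open>g x\<close>. In characteristic zero a function determined by other
  functions is a rational function of them (\<open>determined_imp_rational\<close>), hence
  \<open>b(x, g x) \<tau>(g) = a(x, g x)\<close> for polynomials \<open>a\<close> and \<open>b\<close>
  (\<open>rational_group_element\<close>). Regard \<open>a\<close> and \<open>b\<close> as polynomials in \<open>g x\<close> with coefficients in
  \<open>F\<close>. Once they are normalised so as to be unique, moving \<open>x\<close> along its orbit multiplies
  the coefficient matrices of \<open>a\<close> by a value of \<open>\<tau>\<close>: they are covariants, and a general
  combination of them with rational weights is invertible (\<open>covariant_frame\<close>).

  For the rationality statement, let \<open>t\<close> be an element of an algebra over a ring \<open>A\<close> of
  functions. At a general point of \<open>A\<close> every root of the polynomial of least degree
  satisfied by \<open>t\<close> is the value of \<open>t\<close> at some point of the algebra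
  (\<open>extend_one\<close>, \<open>chevalley_extension\<close>). If \<open>t\<close> is determined by \<open>A\<close>, there is only one root \<open>s\<close>, the
  polynomial is \<open>l (X - s)\<^sup>d\<close>, and its two leading coefficients give \<open>s\<close> rationally.

  One device recurs. In a vector space of finitely supported families that is stable
  under automorphisms, normalise a member of least support to have a coefficient 1: its
  conjugates differ from it by members of smaller support, hence not at all. This
  yields both the covariants and the invariants of \<open>F(z)\<close>, without unique
  factorisation of polynomials and for an arbitrary group of automorphisms.
\<close>

section \<open>Evaluation of polynomials\<close>

text \<open>Rings of functions and fields of invariants occur as subsets of a type, so homomorphisms are
  required to be additive and multiplicative on a subset only.\<close>

definition hom_on :: "'a::comm_ring_1 set \<Rightarrow> ('a \<Rightarrow> 'b::comm_ring_1) \<Rightarrow> bool" where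
  "hom_on A h \<longleftrightarrow> h 1 = 1 \<and> (\<forall>x\<in>A. \<forall>y\<in>A. h (x + y) = h x + h y \<and> h (x * y) = h x * h y)"

definition subring_set :: "'a::comm_ring_1 set \<Rightarrow> bool" where
  "subring_set A \<longleftrightarrow> 1 \<in> A \<and> (\<forall>x\<in>A. \<forall>y\<in>A. x - y \<in> A \<and> x * y \<in> A)"

lemma subring_set_UNIV [simp]: "subring_set UNIV"
  by (simp add: subring_set_def)

lemma subring_setD:
  assumes "subring_set A"
  shows "0 \<in> A" "1 \<in> A" "x \<in> A \<Longrightarrow> - x \<in> A" "x \<in> A \<Longrightarrow> y \<in> A \<Longrightarrow> x + y \<in> A"
    "x \<in> A \<Longrightarrow> y \<in> A \<Longrightarrow> x - y \<in> A" "x \<in> A \<Longrightarrow> y \<in> A \<Longrightarrow> x * y \<in> A"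
    "x \<in> A \<Longrightarrow> x ^ n \<in> A"
proof -
  show 1: "1 \<in> A" using assms by (simp add: subring_set_def)
  show m: "x - y \<in> A" if "x \<in> A" "y \<in> A" for x y
    using assms that by (auto simp: subring_set_def)
  show 0: "0 \<in> A" using m[OF 1 1] by simp
  show um: "- x \<in> A" if "x \<in> A" for x using m[OF 0 that] by simp
  show "x + y \<in> A" if "x \<in> A" "y \<in> A" using m[OF that(1) um[OF that(2)]] by simp
  show t: "x * y \<in> A" if "x \<in> A" "y \<in> A" for x y using assms that by (auto simp: subring_set_def)
  show "x ^ n \<in> A" if "x \<in> A" by (induction n) (auto simp: 1 t that)
qed

lemma subring_set_sum: "subring_set A \<Longrightarrow> (\<And>i. i \<in> I \<Longrightarrow> f i \<in> A) \<Longrightarrow> sum f I \<in> A"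
  by (induction I rule: infinite_finite_induct) (auto simp: subring_setD)

lemma subring_set_prod: "subring_set A \<Longrightarrow> (\<And>i. i \<in> I \<Longrightarrow> f i \<in> A) \<Longrightarrow> prod f I \<in> A"
  by (induction I rule: infinite_finite_induct) (auto simp: subring_setD)

lemma hom_on_subset: "hom_on B h \<Longrightarrow> A \<subseteq> B \<Longrightarrow> hom_on A h"
  unfolding hom_on_def by blast

context
  fixes A :: "'a::comm_ring_1 set" and h :: "'a \<Rightarrow> 'b::comm_ring_1"
  assumes A: "subring_set A" and h: "hom_on A h"
begin

lemma hom_on_1: "h 1 = 1" and hom_on_add: "x \<in> A \<Longrightarrow> y \<in> A \<Longrightarrow> h (x + y) = h x + h y"
  and hom_on_mult: "x \<in> A \<Longrightarrow> y \<in> A \<Longrightarrow> h (x * y) = h x * h y"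
  using h by (auto simp: hom_on_def)

lemma hom_on_0: "h 0 = 0"
  using hom_on_add[of 0 0] subring_setD(1)[OF A] by simp

lemma hom_on_uminus: "x \<in> A \<Longrightarrow> h (- x) = - h x"
  using hom_on_add[of x "- x"] subring_setD(3)[OF A] hom_on_0
  by (simp add: eq_neg_iff_add_eq_0 add.commute)

lemma hom_on_diff: "x \<in> A \<Longrightarrow> y \<in> A \<Longrightarrow> h (x - y) = h x - h y"
  using hom_on_add[of x "- y"] hom_on_uminus[of y] subring_setD(3)[OF A] by simp

lemma hom_on_sum: "(\<And>i. i \<in> I \<Longrightarrow> f i \<in> A) \<Longrightarrow> h (sum f I) = (\<Sum>i\<in>I. h (f i))"
  by (induction I rule: infinite_finite_induct)
    (auto simp: hom_on_0 hom_on_add subring_set_sum[OF A])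

lemma hom_on_prod: "(\<And>i. i \<in> I \<Longrightarrow> f i \<in> A) \<Longrightarrow> h (prod f I) = (\<Prod>i\<in>I. h (f i))"
  by (induction I rule: infinite_finite_induct)
    (auto simp: hom_on_1 hom_on_mult subring_set_prod[OF A])

lemma hom_on_power: "x \<in> A \<Longrightarrow> h (x ^ n) = h x ^ n"
  by (induction n) (auto simp: hom_on_1 hom_on_mult subring_setD[OF A])

lemma hom_on_of_nat: "h (of_nat n) = of_nat n"
proof (induction n)
  case (Suc n)
  have "of_nat n \<in> A" by (induction n) (auto simp: subring_setD[OF A])
  with Suc show ?case by (simp add: hom_on_add hom_on_1 subring_setD[OF A])
qed (simp add: hom_on_0)

text \<open>Substitutions are themselves evaluations, so this also computes composites of substitutions:
  only constants and variables have to be compared.\<close>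

lemma hom_on_poly_eval:
  assumes "\<And>m. m \<in> Poly_Mapping.keys p \<Longrightarrow> \<phi> (Poly_Mapping.lookup p m) \<in> A"
    and "\<And>m i. m \<in> Poly_Mapping.keys p \<Longrightarrow> i \<in> Poly_Mapping.keys m \<Longrightarrow> x i \<in> A"
  shows "h (poly_eval \<phi> x p) = poly_eval (\<lambda>c. h (\<phi> c)) (\<lambda>i. h (x i)) p"
proof -
  have mono: "(\<Prod>i\<in>Poly_Mapping.keys m. x i ^ Poly_Mapping.lookup m i) \<in> A"
    "h (\<Prod>i\<in>Poly_Mapping.keys m. x i ^ Poly_Mapping.lookup m i)
      = (\<Prod>i\<in>Poly_Mapping.keys m. h (x i) ^ Poly_Mapping.lookup m i)" if "m \<in> Poly_Mapping.keys p" for m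
    using assms(2)[OF that]
    by (auto simp: hom_on_prod hom_on_power subring_setD(7)[OF A] intro!: subring_set_prod[OF A])
  show ?thesis unfolding poly_eval_def
    by (subst hom_on_sum) (auto simp: mono assms(1) hom_on_mult subring_setD(6)[OF A])
qed

end

lemma poly_eval_in_subring:
  assumes "subring_set A"
    and "\<And>m. m \<in> Poly_Mapping.keys p \<Longrightarrow> \<phi> (Poly_Mapping.lookup p m) \<in> A"
    and "\<And>m i. m \<in> Poly_Mapping.keys p \<Longrightarrow> i \<in> Poly_Mapping.keys m \<Longrightarrow> x i \<in> A"
  shows "poly_eval \<phi> x p \<in> A"
  unfolding poly_eval_def
  by (intro subring_set_sum subring_setD subring_set_prod assms; assumption?)

lemma poly_eval_cong:
  assumes "\<And>m. m \<in> Poly_Mapping.keys p \<Longrightarrow> \<phi> (Poly_Mapping.lookup p m) = \<psi> (Poly_Mapping.lookup p m)"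
    and "\<And>m i. m \<in> Poly_Mapping.keys p \<Longrightarrow> i \<in> Poly_Mapping.keys m \<Longrightarrow> x i = y i"
  shows "poly_eval \<phi> x p = poly_eval \<psi> y p"
  unfolding poly_eval_def using assms by (auto intro!: sum.cong prod.cong arg_cong2[of _ _ _ _ "(*)"])

lemma polysD:
  assumes "p \<in> polys K I" "m \<in> Poly_Mapping.keys p"
  shows "Poly_Mapping.lookup p m \<in> K" "i \<in> Poly_Mapping.keys m \<Longrightarrow> i \<in> I"
  using assms by (auto simp: polys_def)

lemma poly_eval_cong_polys:
  assumes "p \<in> polys K I" "\<And>c. c \<in> K \<Longrightarrow> \<phi> c = \<psi> c" "\<And>i. i \<in> I \<Longrightarrow> x i = y i"
  shows "poly_eval \<phi> x p = poly_eval \<psi> y p"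
  by (rule poly_eval_cong) (auto simp: assms(2,3) dest: polysD[OF assms(1)])

lemma poly_eval_polys_in_subring:
  assumes "subring_set A" "p \<in> polys K I" "\<And>c. c \<in> K \<Longrightarrow> \<phi> c \<in> A" "\<And>i. i \<in> I \<Longrightarrow> x i \<in> A"
  shows "poly_eval \<phi> x p \<in> A"
  by (rule poly_eval_in_subring[OF assms(1)]) (auto simp: assms(3,4) dest: polysD[OF assms(2)])

lemma hom_on_poly_eval_polys:
  assumes "subring_set A" "hom_on A h" "p \<in> polys K I" "\<And>c. c \<in> K \<Longrightarrow> \<phi> c \<in> A" "\<And>i. i \<in> I \<Longrightarrow> x i \<in> A"
  shows "h (poly_eval \<phi> x p) = poly_eval (\<lambda>c. h (\<phi> c)) (\<lambda>i. h (x i)) p"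
  by (rule hom_on_poly_eval[OF assms(1,2)]) (auto simp: assms(4,5) dest: polysD[OF assms(3)])

lemma hom_image_subring:
  assumes A: "subring_set A" and h: "hom_on A h" and k: "subring_set k" "k \<subseteq> A"
  shows "subring_set (h ` k)"
  unfolding subring_set_def
proof (intro conjI ballI)
  show "1 \<in> h ` k" using hom_on_1[OF A h] subring_setD(2)[OF k(1)] by (metis image_eqI)
  fix x y assume "x \<in> h ` k" "y \<in> h ` k"
  then obtain a b where ab: "a \<in> k" "b \<in> k" "x = h a" "y = h b" by auto
  then have abA: "a \<in> A" "b \<in> A" using k by auto
  show "x - y \<in> h ` k" unfolding ab hom_on_diff[OF A h abA, symmetric]
    by (intro imageI subring_setD[OF k(1)] ab)
  show "x * y \<in> h ` k" unfolding ab hom_on_mult[OF A h abA, symmetric]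
    by (intro imageI subring_setD[OF k(1)] ab)
qed

lemma hom_on_inv_into:
  assumes A: "subring_set A" and h: "hom_on A h" and bij: "bij_betw h A B"
  shows "hom_on B (inv_into A h)"
proof -
  have inj: "inj_on h A" and B: "B = h ` A" using bij by (auto simp: bij_betw_def)
  note i = inv_into_f_f[OF inj]
  show ?thesis
    unfolding hom_on_def B
  proof (intro conjI ballI)
    show "inv_into A h 1 = 1" using i[of 1] hom_on_1[OF A h] subring_setD(2)[OF A] by simp
    fix x y assume "x \<in> h ` A" "y \<in> h ` A"
    then obtain a b where ab: "a \<in> A" "b \<in> A" "x = h a" "y = h b" by auto
    show "inv_into A h (x + y) = inv_into A h x + inv_into A h y"
      "inv_into A h (x * y) = inv_into A h x * inv_into A h y"
      unfolding ab hom_on_add[OF A h ab(1,2), symmetric] hom_on_mult[OF A h ab(1,2), symmetric]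
      using ab subring_setD(4,6)[OF A] by (simp_all add: i)
  qed
qed

abbreviation ring_hom_total :: "('a::comm_ring_1 \<Rightarrow> 'b::comm_ring_1) \<Rightarrow> bool" where
  "ring_hom_total \<equiv> hom_on UNIV"

lemmas total_hom_0 = hom_on_0[OF subring_set_UNIV]
  and total_hom_1 = hom_on_1[OF subring_set_UNIV]
  and total_hom_add = hom_on_add[OF subring_set_UNIV _ UNIV_I UNIV_I]
  and total_hom_mult = hom_on_mult[OF subring_set_UNIV _ UNIV_I UNIV_I]
  and total_hom_diff = hom_on_diff[OF subring_set_UNIV _ UNIV_I UNIV_I]
  and total_hom_power = hom_on_power[OF subring_set_UNIV _ UNIV_I]
  and total_hom_sum = hom_on_sum[OF subring_set_UNIV _ UNIV_I]
  and total_hom_prod = hom_on_prod[OF subring_set_UNIV _ UNIV_I]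
  and hom_poly_eval = hom_on_poly_eval[OF subring_set_UNIV _ UNIV_I UNIV_I]

lemma hom_on_id [simp]: "hom_on A (\<lambda>x. x)" by (simp add: hom_on_def)

lemma hom_on_comp: "hom_on A g \<Longrightarrow> g ` A \<subseteq> B \<Longrightarrow> hom_on B h \<Longrightarrow> hom_on A (\<lambda>x. h (g x))"
  unfolding hom_on_def by (auto simp: image_subset_iff)

definition mono_eval :: "('i \<Rightarrow> 'b::comm_ring_1) \<Rightarrow> ('i \<Rightarrow>\<^sub>0 nat) \<Rightarrow> 'b" where
  "mono_eval x m = (\<Prod>i \<in> Poly_Mapping.keys m. x i ^ Poly_Mapping.lookup m i)"

lemma mono_eval_superset:
  assumes "finite I" "Poly_Mapping.keys m \<subseteq> I"
  shows "mono_eval x m = (\<Prod>i\<in>I. x i ^ Poly_Mapping.lookup m i)"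
  unfolding mono_eval_def using assms
  by (intro prod.mono_neutral_left) (auto simp: in_keys_iff)

lemma mono_eval_add: "mono_eval x (m + n) = mono_eval x m * mono_eval x n"
proof -
  define I where "I = Poly_Mapping.keys m \<union> Poly_Mapping.keys n"
  have "Poly_Mapping.keys (m + n) \<subseteq> I" unfolding I_def by (rule keys_add)
  moreover have "finite I" by (simp add: I_def)
  ultimately show ?thesis
    by (simp add: mono_eval_superset[of I] I_def lookup_add power_add prod.distrib)
qed

lemma mono_eval_0 [simp]: "mono_eval x 0 = 1" by (simp add: mono_eval_def)

lemma mono_eval_single [simp]: "mono_eval x (Poly_Mapping.single i k) = x i ^ k"
  by (cases "k = 0") (auto simp: mono_eval_def)

lemma poly_eval_mono: "poly_eval \<phi> x p = (\<Sum>m\<in>Poly_Mapping.keys p. \<phi> (Poly_Mapping.lookup p m) * mono_eval x m)"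
  by (simp add: poly_eval_def mono_eval_def)

context
  fixes \<phi> :: "'a::comm_ring_1 \<Rightarrow> 'b::comm_ring_1"
  assumes phi: "ring_hom_total \<phi>"
begin

lemmas phi_simps = total_hom_0[OF phi] total_hom_1[OF phi]
  total_hom_add[OF phi] total_hom_mult[OF phi]

lemma poly_eval_superset:
  assumes "finite T" "Poly_Mapping.keys p \<subseteq> T"
  shows "poly_eval \<phi> x p = (\<Sum>m\<in>T. \<phi> (Poly_Mapping.lookup p m) * mono_eval x m)"
  unfolding poly_eval_mono using assms
  by (intro sum.mono_neutral_left) (auto simp: in_keys_iff phi_simps)

lemma poly_eval_0 [simp]: "poly_eval \<phi> x 0 = 0" by (simp add: poly_eval_def)

lemma poly_eval_single: "poly_eval \<phi> x (Poly_Mapping.single m c) = \<phi> c * mono_eval x m"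
  by (cases "c = 0") (auto simp: poly_eval_mono phi_simps)

lemma poly_eval_const: "poly_eval \<phi> x (poly_const c) = \<phi> c"
  by (simp add: poly_const_def poly_eval_single)

lemma poly_eval_var: "poly_eval \<phi> x (poly_var i) = x i"
  by (simp add: poly_var_def poly_eval_single phi_simps)

lemma poly_eval_add: "poly_eval \<phi> x (p + q) = poly_eval \<phi> x p + poly_eval \<phi> x q"
proof -
  define I where "I = Poly_Mapping.keys p \<union> Poly_Mapping.keys q"
  have "Poly_Mapping.keys (p + q) \<subseteq> I" unfolding I_def by (rule keys_add)
  moreover have "finite I" by (simp add: I_def)
  ultimately show ?thesis
    by (simp add: poly_eval_superset[of I] I_def lookup_add phi_simps sum.distrib distrib_right)
qed

lemma poly_eval_sum: "poly_eval \<phi> x (sum f I) = (\<Sum>i\<in>I. poly_eval \<phi> x (f i))"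
  by (induction I rule: infinite_finite_induct) (auto simp: poly_eval_add)

end

lemma poly_mapping_sum_single:
  "p = (\<Sum>m\<in>Poly_Mapping.keys p. Poly_Mapping.single m (Poly_Mapping.lookup p m))"
proof (rule poly_mapping_eqI)
  fix k
  have "(\<Sum>m\<in>Poly_Mapping.keys p. Poly_Mapping.lookup (Poly_Mapping.single m (Poly_Mapping.lookup p m)) k)
      = (\<Sum>m\<in>Poly_Mapping.keys p. if m = k then Poly_Mapping.lookup p k else 0)"
    by (intro sum.cong refl) (auto simp: lookup_single when_def)
  also have "\<dots> = Poly_Mapping.lookup p k" by (auto simp: in_keys_iff)
  finally show "Poly_Mapping.lookup p k = Poly_Mapping.lookup
      (\<Sum>m\<in>Poly_Mapping.keys p. Poly_Mapping.single m (Poly_Mapping.lookup p m)) k"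
    by (simp add: lookup_sum)
qed

lemma poly_eval_mult:
  assumes phi: "ring_hom_total \<phi>"
  shows "poly_eval \<phi> x (p * q) = poly_eval \<phi> x p * poly_eval \<phi> x q"
proof -
  let ?P = "Poly_Mapping.keys p" and ?Q = "Poly_Mapping.keys q"
  have "p * q = (\<Sum>m\<in>?P. \<Sum>n\<in>?Q. Poly_Mapping.single (m + n)
      (Poly_Mapping.lookup p m * Poly_Mapping.lookup q n))"
    by (subst (1) poly_mapping_sum_single[of p], subst (1) poly_mapping_sum_single[of q])
      (simp add: sum_product mult_single)
  then have "poly_eval \<phi> x (p * q) = (\<Sum>m\<in>?P. \<Sum>n\<in>?Q.
      (\<phi> (Poly_Mapping.lookup p m) * mono_eval x m) * (\<phi> (Poly_Mapping.lookup q n) * mono_eval x n))"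
    by (simp add: poly_eval_sum[OF phi] poly_eval_single[OF phi] mono_eval_add phi_simps[OF phi] mult_ac)
  then show ?thesis by (simp add: poly_eval_mono sum_product)
qed

lemma poly_eval_hom:
  assumes "ring_hom_total \<phi>"
  shows "ring_hom_total (poly_eval \<phi> x)"
proof -
  have "poly_eval \<phi> x 1 = 1"
    using poly_eval_const[OF assms, of x 1] by (simp add: poly_const_def phi_simps[OF assms])
  then show ?thesis by (simp add: hom_on_def poly_eval_add[OF assms] poly_eval_mult[OF assms])
qed

lemma poly_const_hom [simp]: "ring_hom_total poly_const"
  by (simp add: hom_on_def poly_const_def single_add mult_single)

lemma poly_const_simps [simp]: "poly_const 0 = 0" "poly_const 1 = 1"
  "poly_const x = poly_const y \<longleftrightarrow> x = y" "poly_const x = 0 \<longleftrightarrow> x = 0"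
  by (auto simp: poly_const_def) (metis lookup_single_eq lookup_zero)+

lemma mono_eval_var: "poly_const c * mono_eval poly_var m = Poly_Mapping.single m (c::'a::comm_ring_1)"
proof -
  have "(\<Prod>i\<in>I. poly_var i ^ f i :: ('i, 'a) mpoly) = Poly_Mapping.single (\<Sum>i\<in>I. Poly_Mapping.single i (f i)) 1"
    for I and f :: "'i \<Rightarrow> nat"
  proof (induction I rule: infinite_finite_induct)
    case (insert i I)
    have "(poly_var i :: ('i, 'a) mpoly) ^ n = Poly_Mapping.single (Poly_Mapping.single i n) 1" for n
      by (induction n) (auto simp: poly_var_def mult_single single_add[symmetric])
    with insert show ?case by (simp add: mult_single)
  qed auto
  from this[of "Poly_Mapping.lookup m" "Poly_Mapping.keys m"]
  have "mono_eval poly_var m = Poly_Mapping.single m (1::'a)"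
    unfolding mono_eval_def poly_mapping_sum_single[of m, symmetric] .
  then show ?thesis by (simp add: poly_const_def mult_single)
qed

lemma poly_eval_id: "poly_eval poly_const poly_var p = (p :: ('i, 'a::comm_ring_1) mpoly)"
  unfolding poly_eval_mono mono_eval_var by (rule poly_mapping_sum_single[symmetric])

lemma hom_eq_poly_eval:
  assumes "ring_hom_total h"
  shows "h p = poly_eval (\<lambda>c. h (poly_const c)) (\<lambda>i. h (poly_var i)) p"
  using hom_poly_eval[OF assms, of poly_const poly_var p] by (simp add: poly_eval_id)

lemma polys_subring: "subring_set K \<Longrightarrow> subring_set (polys K I :: ('i, 'a::comm_ring_1) mpoly set)"
proof -
  assume K: "subring_set K"
  have mult: "p * q \<in> polys K I" if p: "p \<in> polys K I" and q: "q \<in> polys K I" for p q :: "('i,'a) mpoly"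
  proof -
    have pos: "Poly_Mapping.lookup p m \<in> K" if "p \<in> polys K I" for p :: "('i,'a) mpoly" and m
      using that subring_setD(1)[OF K] by (cases "m \<in> Poly_Mapping.keys p") (auto simp: polys_def in_keys_iff)
    have eq: "p * q = (\<Sum>m\<in>Poly_Mapping.keys p. \<Sum>n\<in>Poly_Mapping.keys q. Poly_Mapping.single (m + n)
        (Poly_Mapping.lookup p m * Poly_Mapping.lookup q n))"
      by (subst (1) poly_mapping_sum_single[of p], subst (1) poly_mapping_sum_single[of q])
        (simp add: sum_product mult_single)
    have "Poly_Mapping.lookup (p * q) k \<in> K" for k
      unfolding eq lookup_sum lookup_single
      by (intro subring_set_sum[OF K]) (auto simp: when_def intro!: subring_setD[OF K] pos p q)
    moreover have "Poly_Mapping.keys k \<subseteq> I" if "k \<in> Poly_Mapping.keys (p * q)" for k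
    proof -
      obtain a b where "k = a + b" "a \<in> Poly_Mapping.keys p" "b \<in> Poly_Mapping.keys q"
        using keys_mult[of p q] \<open>k \<in> _\<close> by auto
      then show ?thesis using keys_add[of a b] polysD(2)[OF p] polysD(2)[OF q] by blast
    qed
    ultimately show ?thesis by (auto simp: polys_def)
  qed
  have diff: "p - q \<in> polys K I" if "p \<in> polys K I" "q \<in> polys K I" for p q :: "('i,'a) mpoly"
  proof -
    have pos: "Poly_Mapping.lookup p m \<in> K" if "p \<in> polys K I" for p :: "('i,'a) mpoly" and m
      using that subring_setD(1)[OF K] by (cases "m \<in> Poly_Mapping.keys p") (auto simp: polys_def in_keys_iff)
    have "Poly_Mapping.keys (p - q) \<subseteq> Poly_Mapping.keys p \<union> Poly_Mapping.keys q"
      by (auto simp: in_keys_iff lookup_minus)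
    with that show ?thesis
      by (auto simp: polys_def[of K I] lookup_minus intro!: subring_setD[OF K] pos)
  qed
  have "1 \<in> polys K I"
    using subring_setD(2)[OF K] by (auto simp: polys_def lookup_one)
  with mult diff show ?thesis by (simp add: subring_set_def)
qed

lemma polys_const: "c \<in> K \<Longrightarrow> poly_const c \<in> polys K I"
  by (auto simp: polys_def poly_const_def)

lemma polys_var: "i \<in> I \<Longrightarrow> 1 \<in> K \<Longrightarrow> poly_var i \<in> polys K I"
  by (auto simp: polys_def poly_var_def)

lemma polys_mono: "K \<subseteq> K' \<Longrightarrow> I \<subseteq> I' \<Longrightarrow> polys K I \<subseteq> polys K' I'"
  unfolding polys_def by blast

lemma polys_0 [simp]: "0 \<in> polys K I" by (simp add: polys_def)

section \<open>Extension of points of commutative rings\<close>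

definition polys_over :: "'a::comm_ring_1 set \<Rightarrow> 'a poly set" where
  "polys_over A = {p. \<forall>i. Polynomial.coeff p i \<in> A}"

definition adjoin :: "'a::comm_ring_1 set \<Rightarrow> 'a \<Rightarrow> 'a set" where
  "adjoin A t = (\<lambda>p. poly p t) ` polys_over A"

text \<open>Relative to \<open>C\<close>, and without requiring \<open>Q \<subseteq> C\<close>, so that a
  prime of \<open>C\<close> is a prime of every subring of \<open>C\<close>.\<close>

definition prime_on :: "'a::comm_ring_1 set \<Rightarrow> 'a set \<Rightarrow> bool" where
  "prime_on C Q \<longleftrightarrow> 1 \<notin> Q \<and> 0 \<in> Q \<and> (\<forall>x\<in>C. \<forall>y\<in>C. x \<in> Q \<longrightarrow> y \<in> Q \<longrightarrow> x - y \<in> Q) \<and>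
     (\<forall>x\<in>C. \<forall>y\<in>C. x * y \<in> Q \<longleftrightarrow> x \<in> Q \<or> y \<in> Q)"

text \<open>A point of the closed subscheme defined by \<open>Q\<close>.\<close>

definition point_on :: "'a::comm_ring_1 set \<Rightarrow> 'a set \<Rightarrow> ('a \<Rightarrow> 'b::comm_ring_1) \<Rightarrow> bool" where
  "point_on A Q \<phi> \<longleftrightarrow> hom_on A \<phi> \<and> (\<forall>x\<in>A. x \<in> Q \<longrightarrow> \<phi> x = 0)"

definition extends_to ::
  "'a::comm_ring_1 set \<Rightarrow> 'a \<Rightarrow> 'a set \<Rightarrow> ('a \<Rightarrow> 'b::comm_ring_1) \<Rightarrow> 'b \<Rightarrow> ('a \<Rightarrow> 'b) \<Rightarrow> bool" where
  "extends_to A t Q \<phi> s \<psi> \<longleftrightarrow> point_on (adjoin A t) Q \<psi> \<and> (\<forall>x\<in>A. \<psi> x = \<phi> x) \<and> \<psi> t = s"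

lemma prime_on_subset: "prime_on C Q \<Longrightarrow> A \<subseteq> C \<Longrightarrow> prime_on A Q"
  unfolding prime_on_def by (meson subsetD)

lemma point_on_subset: "point_on C Q \<phi> \<Longrightarrow> A \<subseteq> C \<Longrightarrow> point_on A Q \<phi>"
  unfolding point_on_def by (auto intro: hom_on_subset)

context
  fixes A :: "'a::comm_ring_1 set"
  assumes A: "subring_set A"
begin

lemma polys_over_diff: "p \<in> polys_over A \<Longrightarrow> q \<in> polys_over A \<Longrightarrow> p - q \<in> polys_over A"
  and polys_over_add: "p \<in> polys_over A \<Longrightarrow> q \<in> polys_over A \<Longrightarrow> p + q \<in> polys_over A"
  and polys_over_smult: "c \<in> A \<Longrightarrow> q \<in> polys_over A \<Longrightarrow> smult c q \<in> polys_over A"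
  and polys_over_monom: "c \<in> A \<Longrightarrow> Polynomial.monom c n \<in> polys_over A"
  and polys_over_pCons: "c \<in> A \<Longrightarrow> q \<in> polys_over A \<Longrightarrow> pCons c q \<in> polys_over A"
  and polys_over_0: "0 \<in> polys_over A"
  and polys_over_const: "c \<in> A \<Longrightarrow> [:c:] \<in> polys_over A"
  by (auto simp: polys_over_def coeff_pCons subring_setD[OF A] split: nat.splits)

lemma polys_over_mult: "p \<in> polys_over A \<Longrightarrow> q \<in> polys_over A \<Longrightarrow> p * q \<in> polys_over A"
  by (auto simp: polys_over_def coeff_mult intro!: subring_set_sum[OF A] subring_setD(6)[OF A])

lemma adjoin_incl: "A \<subseteq> adjoin A t"
  unfolding adjoin_def using polys_over_const by (force intro: image_eqI[of _ _ "[:c:]" for c])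

lemma adjoin_elem: "t \<in> adjoin A t"
  unfolding adjoin_def
  by (rule image_eqI[of _ _ "[:0, 1:]"]) (auto intro!: polys_over_pCons polys_over_0 subring_setD[OF A])

lemma adjoin_subring: "subring_set (adjoin A t)"
  unfolding subring_set_def
proof (intro conjI ballI)
  show "1 \<in> adjoin A t" using adjoin_incl subring_setD(2)[OF A] by auto
  fix x y assume "x \<in> adjoin A t" "y \<in> adjoin A t"
  then obtain p q where "p \<in> polys_over A" "q \<in> polys_over A" "x = poly p t" "y = poly q t"
    by (auto simp: adjoin_def)
  then show "x - y \<in> adjoin A t" "x * y \<in> adjoin A t"
    using polys_over_diff[of p q] polys_over_mult[of p q] unfolding adjoin_def
    by (metis image_eqI poly_diff, metis image_eqI poly_mult)
qed

lemma poly_in_subring: "subring_set B \<Longrightarrow> A \<subseteq> B \<Longrightarrow> t \<in> B \<Longrightarrow> p \<in> polys_over A \<Longrightarrow> poly p t \<in> B"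
  unfolding poly_altdef polys_over_def by (auto intro!: subring_set_sum subring_setD)

lemma adjoin_least: "subring_set B \<Longrightarrow> A \<subseteq> B \<Longrightarrow> t \<in> B \<Longrightarrow> adjoin A t \<subseteq> B"
  unfolding adjoin_def using poly_in_subring by blast

lemma poly_in_adjoin: "p \<in> polys_over A \<Longrightarrow> poly p t \<in> adjoin A t"
  by (auto simp: adjoin_def)

text \<open>Fractions with denominators in \<open>A\<close> are not at hand, so a power of the leading coefficient
  is multiplied in before dividing.\<close>

lemma pseudo_division:
  assumes q: "q \<in> polys_over A" and d: "Polynomial.degree q > 0" and f: "f \<in> polys_over A"
  shows "\<exists>n s r. s \<in> polys_over A \<and> r \<in> polys_over A \<and> smult (lead_coeff q ^ n) f = s * q + r \<and>
     Polynomial.degree r < Polynomial.degree q \<and> Polynomial.degree s \<le> Polynomial.degree f - Polynomial.degree q"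
  using f
proof (induction "Polynomial.degree f" arbitrary: f rule: less_induct)
  case less
  let ?d = "Polynomial.degree q" and ?l = "lead_coeff q" and ?n = "Polynomial.degree f"
  show ?case
  proof (cases "?n < ?d")
    case True
    then show ?thesis using less.prems polys_over_0
      by (intro exI[of _ 0] exI[of _ "0::'a poly"] exI[of _ f]) auto
  next
    case False
    define g where "g = Polynomial.monom (lead_coeff f) (?n - ?d)"
    define f' where "f' = smult ?l f - g * q"
    have lA: "?l \<in> A" "lead_coeff f \<in> A" using q less.prems by (auto simp: polys_over_def)
    have g: "g \<in> polys_over A" unfolding g_def using lA by (intro polys_over_monom)
    have f': "f' \<in> polys_over A" unfolding f'_def
      by (intro polys_over_diff polys_over_smult polys_over_mult g q less.prems lA)
    have dg: "Polynomial.degree g \<le> ?n - ?d" unfolding g_def by (rule degree_monom_le)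
    have "Polynomial.degree (g * q) \<le> ?n"
      using degree_mult_le[of g q] dg False by linarith
    moreover have "Polynomial.coeff (g * q) ?n = ?l * lead_coeff f"
      using False by (simp add: g_def coeff_monom_mult)
    ultimately have "Polynomial.coeff f' k = 0" if "k \<ge> ?n" for k
      using that by (cases "k = ?n") (auto simp: f'_def coeff_eq_0)
    then have lt: "Polynomial.degree f' < ?n"
      using d False by (intro degree_lessI) auto
    from less.hyps[OF lt f'] obtain n s r where h: "s \<in> polys_over A" "r \<in> polys_over A"
      "smult (?l ^ n) f' = s * q + r" "Polynomial.degree r < ?d" "Polynomial.degree s \<le> Polynomial.degree f' - ?d"
      by blast
    have "smult (?l ^ Suc n) f = smult (?l ^ n) f' + smult (?l ^ n) g * q"
      by (simp add: f'_def smult_diff_right mult.commute)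
    also have "\<dots> = (s + smult (?l ^ n) g) * q + r" using h(3) by (simp add: algebra_simps)
    finally have "smult (?l ^ Suc n) f = (s + smult (?l ^ n) g) * q + r" .
    moreover have "Polynomial.degree (s + smult (?l ^ n) g) \<le> ?n - ?d"
      using h(5) lt dg degree_smult_le[of "?l ^ n" g] by (intro degree_add_le) linarith+
    moreover have "s + smult (?l ^ n) g \<in> polys_over A"
      by (intro polys_over_add h polys_over_smult g subring_setD(7)[OF A] lA)
    ultimately show ?thesis using h by blast
  qed
qed

lemma map_poly_hom_on:
  assumes h: "hom_on A h" and p: "p \<in> polys_over A" and q: "q \<in> polys_over A"
  shows "map_poly h (p + q) = map_poly h p + map_poly h q"
    and "map_poly h (p - q) = map_poly h p - map_poly h q"
    and "map_poly h (p * q) = map_poly h p * map_poly h q"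
proof -
  have 0: "h 0 = 0" by (rule hom_on_0[OF A h])
  show "map_poly h (p + q) = map_poly h p + map_poly h q" "map_poly h (p - q) = map_poly h p - map_poly h q"
    using p q by (auto intro!: poly_eqI simp: coeff_map_poly[of h, OF 0] polys_over_def hom_on_add[OF A h] hom_on_diff[OF A h])
  show "map_poly h (p * q) = map_poly h p * map_poly h q"
  proof (rule poly_eqI)
    fix n
    have "h (\<Sum>i\<le>n. Polynomial.coeff p i * Polynomial.coeff q (n - i))
        = (\<Sum>i\<le>n. h (Polynomial.coeff p i * Polynomial.coeff q (n - i)))"
      using p q by (intro hom_on_sum[OF A h]) (auto simp: polys_over_def subring_setD[OF A])
    also have "\<dots> = (\<Sum>i\<le>n. h (Polynomial.coeff p i) * h (Polynomial.coeff q (n - i)))"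
      using p q by (intro sum.cong refl hom_on_mult[OF A h]) (auto simp: polys_over_def)
    finally show "Polynomial.coeff (map_poly h (p * q)) n = Polynomial.coeff (map_poly h p * map_poly h q) n"
      by (simp add: coeff_map_poly[of h, OF 0] coeff_mult)
  qed
qed

lemma poly_map_poly_hom_on:
  assumes h: "hom_on B h" and B: "subring_set B" and AB: "A \<subseteq> B" and t: "t \<in> B" and p: "p \<in> polys_over A"
  shows "h (poly p t) = poly (map_poly h p) (h t)"
proof -
  have pc: "Polynomial.coeff p i \<in> B" for i using p AB by (auto simp: polys_over_def)
  have 0: "h 0 = 0" by (rule hom_on_0[OF B h])
  have "h (poly p t) = (\<Sum>i\<le>Polynomial.degree p. h (Polynomial.coeff p i * t ^ i))"
    unfolding poly_altdef using pc t by (intro hom_on_sum[OF B h]) (auto simp: subring_setD[OF B])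
  also have "\<dots> = (\<Sum>i\<le>Polynomial.degree p. Polynomial.coeff (map_poly h p) i * h t ^ i)"
    using pc t by (intro sum.cong refl)
      (auto simp: subring_setD[OF B] hom_on_mult[OF B h] hom_on_power[OF B h] coeff_map_poly[of h, OF 0])
  also have "\<dots> = poly (map_poly h p) (h t)"
    by (rule poly_as_sum_of_monoms'[THEN arg_cong[of _ _ "\<lambda>q. poly q (h t)"], simplified poly_sum poly_monom])
      (rule map_poly_degree_leq)
  finally show ?thesis .
qed

text \<open>The value \<open>s\<close> for \<open>t\<close> is admissible as soon as it satisfies the
  relations that hold for \<open>t\<close> modulo \<open>Q\<close>. Different polynomial expressions of one
  element of \<open>A[t]\<close> then have the same value.\<close>

lemma extend_point:
  assumes phi: "point_on A Q \<phi>" and Q: "prime_on (adjoin A t) Q"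
    and s: "\<And>f. f \<in> polys_over A \<Longrightarrow> poly f t \<in> Q \<Longrightarrow> poly (map_poly \<phi> f) s = 0"
  shows "\<exists>\<psi>. extends_to A t Q \<phi> s \<psi>"
proof -
  have hom: "hom_on A \<phi>" using phi by (simp add: point_on_def)
  note phi0 = hom_on_0[OF A hom]
  define rep where "rep x = (SOME f. f \<in> polys_over A \<and> poly f t = x)" for x
  define \<psi> where "\<psi> x = poly (map_poly \<phi> (rep x)) s" for x
  have psi: "\<psi> (poly f t) = poly (map_poly \<phi> f) s" if f: "f \<in> polys_over A" for f
  proof -
    have r: "rep (poly f t) \<in> polys_over A \<and> poly (rep (poly f t)) t = poly f t"
      unfolding rep_def by (rule someI[of _ f]) (use f in auto)
    have "poly (rep (poly f t) - f) t \<in> Q" using r Q by (simp add: prime_on_def)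
    then have "poly (map_poly \<phi> (rep (poly f t) - f)) s = 0"
      using r f by (intro s polys_over_diff) auto
    then show ?thesis using r f by (simp add: \<psi>_def map_poly_hom_on(2)[OF hom])
  qed
  have on_A: "\<psi> x = \<phi> x" if "x \<in> A" for x
    using psi[OF polys_over_const[OF that]] phi0 by (simp add: map_poly_pCons)
  have psit: "\<psi> t = s"
    using psi[of "[:0,1:]"] hom_on_1[OF A hom] phi0
    by (auto simp: map_poly_pCons polys_over_pCons polys_over_0 subring_setD[OF A])
  have "hom_on (adjoin A t) \<psi>"
    unfolding hom_on_def
  proof (intro conjI ballI)
    show "\<psi> 1 = 1" using on_A[of 1] hom_on_1[OF A hom] subring_setD(2)[OF A] by simp
    fix x y assume "x \<in> adjoin A t" "y \<in> adjoin A t"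
    then obtain p q where pq: "p \<in> polys_over A" "q \<in> polys_over A" "x = poly p t" "y = poly q t"
      by (auto simp: adjoin_def)
    show "\<psi> (x + y) = \<psi> x + \<psi> y"
      using psi[OF polys_over_add[OF pq(1,2)]] by (simp add: pq psi map_poly_hom_on[OF hom])
    show "\<psi> (x * y) = \<psi> x * \<psi> y"
      using psi[OF polys_over_mult[OF pq(1,2)]] by (simp add: pq psi map_poly_hom_on[OF hom])
  qed
  moreover have "\<psi> x = 0" if "x \<in> adjoin A t" "x \<in> Q" for x
    using that s by (auto simp: adjoin_def psi)
  ultimately have "extends_to A t Q \<phi> s \<psi>"
    by (auto simp: extends_to_def point_on_def on_A psit)
  then show ?thesis by blast
qed

end

text \<open>Used with \<open>d\<close> the least degree of a member of \<open>W\<close> whose leading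
  coefficient is not in \<open>Q\<close>. The leading terms of a member of smaller degree can be dropped one
  after the other, so it vanishes modulo \<open>Q\<close>.\<close>

lemma low_degree_coeffs:
  fixes W :: "'a::comm_ring_1 poly set"
  assumes drop: "\<And>f. f \<in> W \<Longrightarrow> lead_coeff f \<in> Q \<Longrightarrow> f - Polynomial.monom (lead_coeff f) (Polynomial.degree f) \<in> W"
    and lead: "\<And>f. f \<in> W \<Longrightarrow> Polynomial.degree f < d \<Longrightarrow> lead_coeff f \<in> Q" and "0 \<in> Q"
    and "f \<in> W" "Polynomial.degree f < d"
  shows "Polynomial.coeff f i \<in> Q"
  using assms(4,5)
proof (induction "Polynomial.degree f" arbitrary: f rule: less_induct)
  case less
  let ?n = "Polynomial.degree f"
  show ?case
  proof (cases "i \<ge> ?n")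
    case True
    then show ?thesis using lead[OF less.prems] \<open>0 \<in> Q\<close>
      by (cases "i = ?n") (auto simp: coeff_eq_0)
  next
    case False
    let ?g = "f - Polynomial.monom (lead_coeff f) ?n"
    have "Polynomial.degree ?g < ?n"
      using False by (intro degree_lessI) (auto simp: coeff_eq_0)
    moreover have "?g \<in> W" using drop[OF less.prems(1) lead[OF less.prems]] .
    ultimately have "Polynomial.coeff ?g i \<in> Q" using less.hyps less.prems by force
    then show ?thesis using False by simp
  qed
qed

text \<open>If \<open>t\<close> is transcendental over the residue ring of \<open>A\<close>, all but
  finitely many values of \<open>t\<close> are possible. Otherwise \<open>p\<close> is the minimal
  polynomial of \<open>t\<close> up to denominators, and every root of its specialisation is possible. In
  that case \<open>b\<close> is the product of the leading coefficient of \<open>p\<close> with a nonzero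
  element of \<open>A\<close> in the ideal generated by \<open>c\<close>, which exists because
  \<open>p\<close> is irreducible; such an element keeps the value of \<open>c\<close> away from
  zero.\<close>

lemma extend_one:
  assumes A: "subring_set A" and Q: "prime_on (adjoin A t) Q" and c: "c \<in> adjoin A t" "c \<notin> Q"
  shows
    "(\<exists>b\<in>A. b \<notin> Q \<and> (\<forall>\<phi>::'a::comm_ring_1 \<Rightarrow> 'k::idom. point_on A Q \<phi> \<longrightarrow> \<phi> b \<noteq> 0 \<longrightarrow>
        finite {s. \<not> (\<exists>\<psi>. extends_to A t Q \<phi> s \<psi> \<and> \<psi> c \<noteq> 0)})) \<or>
     (\<exists>p\<in>polys_over A. \<exists>b\<in>A. Polynomial.degree p > 0 \<and> lead_coeff p \<notin> Q \<and> poly p t \<in> Q \<and> b \<notin> Q \<and>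
        (\<forall>\<phi>::'a \<Rightarrow> 'k. point_on A Q \<phi> \<longrightarrow> \<phi> b \<noteq> 0 \<longrightarrow> \<phi> (lead_coeff p) \<noteq> 0 \<and>
          (\<forall>s. poly (map_poly \<phi> p) s = 0 \<longrightarrow> (\<exists>\<psi>. extends_to A t Q \<phi> s \<psi> \<and> \<psi> c \<noteq> 0))))"
proof -
  let ?B = "adjoin A t"
  note incl = adjoin_incl[OF A, of t]
  note B = adjoin_subring[OF A, of t]
  have QB: "0 \<in> Q" "1 \<notin> Q" using Q by (auto simp: prime_on_def)
  have Qd: "x - y \<in> Q" if "x \<in> ?B" "y \<in> ?B" "x \<in> Q" "y \<in> Q" for x y
    using Q that by (auto simp: prime_on_def)
  have Qadd: "x + y \<in> Q" if "x \<in> ?B" "y \<in> ?B" "x \<in> Q" "y \<in> Q" for x y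
  proof -
    have n: "0 - y \<in> Q" by (rule Qd[OF subring_setD(1)[OF B] that(2) QB(1) that(4)])
    have "x - (0 - y) \<in> Q"
      by (rule Qd[OF that(1) subring_setD(5)[OF B subring_setD(1)[OF B] that(2)] that(3) n])
    then show ?thesis by simp
  qed
  have Qm: "x * y \<in> Q \<longleftrightarrow> x \<in> Q \<or> y \<in> Q" if "x \<in> ?B" "y \<in> ?B" for x y
    using Q that by (auto simp: prime_on_def)
  have Qs: "sum f I \<in> Q" if "\<And>i. i \<in> I \<Longrightarrow> f i \<in> Q" "\<And>i. i \<in> I \<Longrightarrow> f i \<in> ?B" for f and I :: "nat set"
    using that
  proof (induction I rule: infinite_finite_induct)
    case (insert i I)
    have sB: "sum f I \<in> ?B" "f i \<in> ?B" using insert by (auto intro!: subring_set_sum[OF B])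
    have "f i + sum f I \<in> Q" using insert by (intro Qadd sB) auto
    then show ?case using insert by simp
  qed (use QB in auto)
  have Qpow: "x ^ n \<notin> Q" if "x \<in> ?B" "x \<notin> Q" for x n
    by (induction n) (use that QB Qm subring_setD(7)[OF B] in auto)
  have evB: "poly f t \<in> ?B" if "f \<in> polys_over A" for f using poly_in_adjoin[OF A that] .
  have coB: "Polynomial.coeff f i \<in> ?B" if "f \<in> polys_over A" for f i
    using that incl by (auto simp: polys_over_def)
  have evQ: "poly f t \<in> Q" if "f \<in> polys_over A" "\<And>i. Polynomial.coeff f i \<in> Q" for f
    unfolding poly_altdef using that coB[OF that(1)] adjoin_elem[OF A, of t]
    by (intro Qs) (auto simp: Qm subring_setD[OF B])
  \<comment> \<open>\<open>W e\<close> consists of the polynomials whose value at \<open>t\<close> is a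
    multiple of \<open>e\<close> modulo \<open>Q\<close>; in particular \<open>W 0\<close> is the ideal of
    relations of \<open>t\<close>.\<close>
  define W where "W e = {f \<in> polys_over A. \<exists>u\<in>?B. poly f t - u * e \<in> Q}" for e
  have W0: "W 0 = {f \<in> polys_over A. poly f t \<in> Q}"
    using subring_setD(1)[OF B] by (auto simp: W_def)
  have Wdiff: "f - g \<in> W e" if "f \<in> W e" "g \<in> W e" "e \<in> ?B" for f g e
  proof -
    from that obtain u v where u: "u \<in> ?B" "v \<in> ?B" "poly f t - u * e \<in> Q" "poly g t - v * e \<in> Q"
      and fg: "f \<in> polys_over A" "g \<in> polys_over A" by (auto simp: W_def)
    have "(poly f t - u * e) - (poly g t - v * e) \<in> Q"
      by (intro Qd u) (auto intro!: subring_setD[OF B] u evB fg that)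
    then have "poly (f - g) t - (u - v) * e \<in> Q" by (simp add: algebra_simps)
    then show ?thesis using u fg by (auto simp: W_def intro!: polys_over_diff[OF A] subring_setD[OF B])
  qed
  have Wmult: "g * f \<in> W e" if "f \<in> W e" "g \<in> polys_over A" "e \<in> ?B" for f g e
  proof -
    from that obtain u where u: "u \<in> ?B" "poly f t - u * e \<in> Q" and f: "f \<in> polys_over A"
      by (auto simp: W_def)
    have "poly g t * (poly f t - u * e) \<in> Q"
      using u by (subst Qm) (auto intro!: subring_setD[OF B] evB f that)
    then have "poly (g * f) t - (poly g t * u) * e \<in> Q" by (simp add: algebra_simps)
    then show ?thesis using u f that evB by (auto simp: W_def intro!: polys_over_mult[OF A] subring_setD[OF B])
  qed
  have Wmon: "Polynomial.monom a n \<in> W e" if "a \<in> A" "a \<in> Q" for a n e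
  proof -
    have "poly (Polynomial.monom a n) t \<in> Q"
      using that QB by (intro evQ polys_over_monom[OF A]) auto
    then show ?thesis using that subring_setD(1)[OF B]
      by (auto simp: W_def intro!: polys_over_monom[OF A] bexI[of _ 0])
  qed
  have W_sub: "f \<in> polys_over A" if "f \<in> W e" for f e using that by (simp add: W_def)
  have low: "Polynomial.coeff f i \<in> Q"
    if "f \<in> W e" "Polynomial.degree f < d" "e \<in> ?B"
      "\<And>f. f \<in> W e \<Longrightarrow> Polynomial.degree f < d \<Longrightarrow> lead_coeff f \<in> Q" for f e d i
    by (rule low_degree_coeffs[where W = "W e" and d = d])
      (use that QB W_sub in \<open>auto intro!: Wdiff Wmon simp: polys_over_def\<close>)
  obtain \<gamma> where \<gamma>: "\<gamma> \<in> polys_over A" "c = poly \<gamma> t" using c by (auto simp: adjoin_def)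
  \<comment> \<open>the transcendental case is the one where no relation has a leading coefficient outside
    \<open>Q\<close>\<close>
  show ?thesis
  proof (cases "\<exists>f\<in>W 0. lead_coeff f \<notin> Q")
    case False
    have co: "Polynomial.coeff f i \<in> Q" if "f \<in> W 0" for f i
      by (rule low[OF that lessI]) (use False subring_setD[OF B] in auto)
    obtain i where i: "Polynomial.coeff \<gamma> i \<notin> Q" using evQ[OF \<gamma>(1)] c(2) \<gamma>(2) by blast
    have "finite {s. \<not> (\<exists>\<psi>. extends_to A t Q \<phi> s \<psi> \<and> \<psi> c \<noteq> 0)}"
      if phi: "point_on A Q \<phi>" and nz: "\<phi> (Polynomial.coeff \<gamma> i) \<noteq> 0" for \<phi> :: "'a \<Rightarrow> 'k"
    proof (rule finite_subset)
      have hom: "hom_on A \<phi>" using phi by (simp add: point_on_def)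
      note phi0 = hom_on_0[OF A hom]
      have "Polynomial.coeff (map_poly \<phi> \<gamma>) i \<noteq> 0" using nz phi0 by (simp add: coeff_map_poly)
      then have "map_poly \<phi> \<gamma> \<noteq> 0" by auto
      then show "finite {s. poly (map_poly \<phi> \<gamma>) s = 0}" by (rule poly_roots_finite)
      show "{s. \<not> (\<exists>\<psi>. extends_to A t Q \<phi> s \<psi> \<and> \<psi> c \<noteq> 0)} \<subseteq> {s. poly (map_poly \<phi> \<gamma>) s = 0}"
      proof (clarify, rule ccontr)
        fix s assume no: "\<nexists>\<psi>. extends_to A t Q \<phi> s \<psi> \<and> \<psi> c \<noteq> 0" and s: "poly (map_poly \<phi> \<gamma>) s \<noteq> 0"
        have "map_poly \<phi> f = 0" if "f \<in> polys_over A" "poly f t \<in> Q" for f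
          using co[of f] that phi phi0 by (intro poly_eqI) (auto simp: W0 coeff_map_poly point_on_def polys_over_def)
        then obtain \<psi> where psi: "extends_to A t Q \<phi> s \<psi>" using extend_point[OF A phi Q, of s] by auto
        then have "\<psi> c = poly (map_poly \<psi> \<gamma>) s"
          unfolding \<gamma>(2) using poly_map_poly_hom_on[OF A _ B incl adjoin_elem[OF A] \<gamma>(1)]
          by (auto simp: extends_to_def point_on_def)
        also have "map_poly \<psi> \<gamma> = map_poly \<phi> \<gamma>"
          using psi phi0 \<gamma>(1) subring_setD(1)[OF A] by (intro poly_eqI) (auto simp: coeff_map_poly extends_to_def polys_over_def)
        finally show False using no psi s by auto
      qed
    qed
    then show ?thesis using i \<gamma>(1) by (intro disjI1 bexI[of _ "Polynomial.coeff \<gamma> i"]) (auto simp: polys_over_def)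
  next
    case True
    define P where "P e n \<longleftrightarrow> (\<exists>f\<in>W e. lead_coeff f \<notin> Q \<and> Polynomial.degree f = n)" for e n
    define d where "d = (LEAST n. P 0 n)"
    have "P 0 d" unfolding d_def by (rule LeastI_ex) (use True in \<open>auto simp: P_def\<close>)
    then obtain p where p: "p \<in> W 0" "lead_coeff p \<notin> Q" "Polynomial.degree p = d" by (auto simp: P_def)
    have lowp: "Polynomial.coeff f i \<in> Q" if "f \<in> W 0" "Polynomial.degree f < d" for f i
    proof (rule low[OF that])
      show "lead_coeff f \<in> Q" if "f \<in> W 0" "Polynomial.degree f < d" for f
        using that not_less_Least[of "Polynomial.degree f" "P 0"] by (auto simp: d_def P_def)
    qed (use subring_setD[OF B] in auto)
    have pA: "p \<in> polys_over A" and pQ: "poly p t \<in> Q" using p(1) by (auto simp: W0)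
    have dpos: "d > 0"
    proof (rule ccontr)
      assume "\<not> d > 0"
      then obtain a where "p = [:a:]" using p(3) degree_eq_zeroE by blast
      then show False using pQ p(2) by simp
    qed
    have cB: "c \<in> ?B" by fact
    have p_in_c: "p \<in> W c"
      using pA pQ subring_setD(1)[OF B] by (auto simp: W_def intro!: bexI[of _ 0])
    have g_in_c: "\<gamma> \<in> W c"
      using \<gamma> QB subring_setD(2)[OF B] by (auto simp: W_def intro!: bexI[of _ 1])
    define e where "e = (LEAST n. P c n)"
    have "P c d" using p p_in_c by (auto simp: P_def)
    then have Pe: "P c e" and ed: "e \<le> d" unfolding e_def by (auto intro: LeastI Least_le)
    obtain q where q: "q \<in> W c" "lead_coeff q \<notin> Q" "Polynomial.degree q = e" using Pe by (auto simp: P_def)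
    have qA: "q \<in> polys_over A" using q(1) W_sub by blast
    have lowq: "Polynomial.coeff f i \<in> Q" if "f \<in> W c" "Polynomial.degree f < e" for f i
    proof (rule low[OF that cB])
      show "lead_coeff f \<in> Q" if "f \<in> W c" "Polynomial.degree f < e" for f
        using that not_less_Least[of "Polynomial.degree f" "P c"] by (auto simp: e_def P_def)
    qed
    have smW: "smult a f \<in> W c" if "f \<in> W c" "a \<in> A" for a f
      using Wmult[OF that(1) polys_over_const[OF A that(2)] cB] by simp
    \<comment> \<open>A polynomial \<open>q\<close> of least degree in \<open>W c\<close> divides
      \<open>p\<close> and the polynomial of \<open>c\<close>. If it had positive degree, then either its
      cofactor in \<open>p\<close> would be a shorter relation for \<open>t\<close>, or \<open>q\<close>
      itself would be a relation and \<open>c\<close> would lie in \<open>Q\<close>.\<close>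
    have e0: "e = 0"
    proof (rule ccontr)
      assume "e \<noteq> 0"
      then have epos: "Polynomial.degree q > 0" using q by simp
      let ?l = "lead_coeff q"
      have lA: "?l \<in> A" using qA by (auto simp: polys_over_def)
      have lnQ: "?l ^ n \<notin> Q" for n using Qpow[of ?l n] q(2) lA incl by blast
      have divide: "\<exists>n s. s \<in> polys_over A \<and> ?l ^ n * poly f t - poly s t * poly q t \<in> Q \<and>
          (\<forall>i. Polynomial.coeff (smult (?l ^ n) f - s * q) i \<in> Q) \<and> Polynomial.degree s \<le> Polynomial.degree f - e"
        if f: "f \<in> W c" for f
      proof -
        obtain n s r where r: "s \<in> polys_over A" "r \<in> polys_over A" "smult (?l ^ n) f = s * q + r"
          "Polynomial.degree r < e" "Polynomial.degree s \<le> Polynomial.degree f - e"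
          using pseudo_division[OF A qA epos W_sub[OF f]] q(3) by auto
        have req: "r = smult (?l ^ n) f - s * q" using r(3) by simp
        have "r \<in> W c" unfolding req
          by (intro Wdiff smW Wmult f q r cB subring_setD(7)[OF A] lA)
        then have rQ: "Polynomial.coeff r i \<in> Q" for i using lowq r(4) by blast
        moreover have "poly r t \<in> Q" using evQ[OF r(2)] rQ by blast
        ultimately show ?thesis using r unfolding req by (intro exI[of _ n] exI[of _ s]) simp
      qed
      obtain n s where s: "s \<in> polys_over A" "?l ^ n * poly p t - poly s t * poly q t \<in> Q"
          "\<And>i. Polynomial.coeff (smult (?l ^ n) p - s * q) i \<in> Q" "Polynomial.degree s \<le> d - e"
        using divide[OF p_in_c] p(3) by blast
      have lB: "?l ^ n \<in> ?B" for n using incl subring_setD(7)[OF A lA] by blast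
      have lpB: "?l ^ n * poly p t \<in> ?B" by (intro subring_setD(6)[OF B] lB evB pA)
      have lpQ: "?l ^ n * poly p t \<in> Q" using pQ Qm[OF lB evB[OF pA]] by simp
      have "?l ^ n * poly p t - (?l ^ n * poly p t - poly s t * poly q t) \<in> Q"
        by (intro Qd lpQ s(2) lpB subring_setD(5)[OF B] subring_setD(6)[OF B] evB s(1) qA)
      then have "poly s t \<in> Q \<or> poly q t \<in> Q" using Qm evB s(1) qA by simp
      then show False
      proof
        assume "poly s t \<in> Q"
        then have "s \<in> W 0" using s by (simp add: W0)
        moreover have "Polynomial.degree s < d" using s(4) ed \<open>e \<noteq> 0\<close> by linarith
        ultimately have sQ: "Polynomial.coeff s i \<in> Q" for i using lowp by blast
        have "Polynomial.coeff (s * q) d \<in> Q"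
          unfolding coeff_mult using sQ coB[OF s(1)] coB[OF qA]
          by (intro Qs) (auto simp: Qm subring_setD[OF B])
        then have "Polynomial.coeff (s * q) d + Polynomial.coeff (smult (?l ^ n) p - s * q) d \<in> Q"
          by (intro Qadd coB s(3) polys_over_mult[OF A] polys_over_diff[OF A] polys_over_smult[OF A]
              s(1) qA pA subring_setD(7)[OF A] lA)
        then have "?l ^ n * lead_coeff p \<in> Q" using p(3) by simp
        then show False using Qm[OF lB coB[OF pA]] lnQ p(2) by blast
      next
        assume qQ: "poly q t \<in> Q"
        obtain n s where s: "s \<in> polys_over A" "?l ^ n * c - poly s t * poly q t \<in> Q"
          using divide[OF g_in_c] \<gamma>(2) by blast
        have "(?l ^ n * c - poly s t * poly q t) + poly s t * poly q t \<in> Q"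
          using qQ by (intro Qadd s(2) subring_setD(5,6)[OF B] evB s(1) qA lB cB) (simp add: Qm evB s(1) qA)
        then show False using Qm[OF lB cB] lnQ c(2) by auto
      qed
    qed
    then obtain b2 where b2: "q = [:b2:]" using q(3) degree_eq_zeroE by blast
    then have b2A: "b2 \<in> A" and b2Q: "b2 \<notin> Q" using qA q(2) by (auto simp: polys_over_def split: nat.splits) (metis coeff_pCons_0)
    obtain u where u: "u \<in> ?B" "b2 - u * c \<in> Q" using q(1) b2 by (auto simp: W_def)
    let ?l = "lead_coeff p"
    have lA: "?l \<in> A" using pA by (auto simp: polys_over_def)
    have bQ: "?l * b2 \<notin> Q" using Qm[of ?l b2] lA b2A incl p(2) b2Q by blast
    have bA: "?l * b2 \<in> A" by (intro subring_setD[OF A] lA b2A)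
    have "\<phi> ?l \<noteq> 0 \<and> (\<exists>\<psi>. extends_to A t Q \<phi> s \<psi> \<and> \<psi> c \<noteq> 0)"
      if phi: "point_on A Q \<phi>" and nz: "\<phi> (?l * b2) \<noteq> 0" and s: "poly (map_poly \<phi> p) s = 0"
      for \<phi> :: "'a \<Rightarrow> 'k" and s
    proof
      have hom: "hom_on A \<phi>" using phi by (simp add: point_on_def)
      note phi0 = hom_on_0[OF A hom]
      have nz2: "\<phi> ?l \<noteq> 0" "\<phi> b2 \<noteq> 0" using nz hom_on_mult[OF A hom lA b2A] by auto
      then show "\<phi> ?l \<noteq> 0" by simp
      have "poly (map_poly \<phi> f) s = 0" if f: "f \<in> polys_over A" "poly f t \<in> Q" for f
      proof -
        obtain n r g where r: "g \<in> polys_over A" "r \<in> polys_over A" "smult (?l ^ n) f = g * p + r"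
          "Polynomial.degree r < d"
          using pseudo_division[OF A pA _ f(1)] p(3) dpos by auto
        have req: "r = smult (?l ^ n) f - g * p" using r(3) by simp
        have z: "0 \<in> ?B" using subring_setD(1)[OF B] .
        have "[:?l ^ n:] * f - g * p \<in> W 0"
          using f by (intro Wdiff Wmult p r z polys_over_const[OF A] subring_setD(7)[OF A] lA) (auto simp: W0)
        then have "r \<in> W 0" by (simp add: req)
        then have "map_poly \<phi> r = 0"
          using lowp[OF _ r(4)] phi r(2) phi0 by (intro poly_eqI) (auto simp: coeff_map_poly point_on_def polys_over_def)
        have lnA: "?l ^ n \<in> A" by (intro subring_setD(7)[OF A] lA)
        have "map_poly \<phi> ([:?l ^ n:] * f) = map_poly \<phi> (g * p + r)" using r(3) by simp
        then have "[:\<phi> ?l ^ n:] * map_poly \<phi> f = map_poly \<phi> g * map_poly \<phi> p"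
          using \<open>map_poly \<phi> r = 0\<close>
          by (simp only: map_poly_hom_on[OF A hom] polys_over_const[OF A lnA] polys_over_mult[OF A] r(1,2) pA f(1))
            (simp add: map_poly_pCons phi0 hom_on_power[OF A hom lA])
        then have "poly ([:\<phi> ?l ^ n:] * map_poly \<phi> f) s = 0" using s by (metis mult_zero_right poly_mult)
        then show ?thesis using nz2 by simp
      qed
      then obtain \<psi> where psi: "extends_to A t Q \<phi> s \<psi>" using extend_point[OF A phi Q, of s] by auto
      then have ph: "hom_on ?B \<psi>" and pz: "\<psi> (b2 - u * c) = 0"
        using u subring_setD[OF B] b2A incl cB by (auto simp: extends_to_def point_on_def)
      have "\<psi> b2 = \<psi> u * \<psi> c"
        using pz hom_on_diff[OF B ph, of b2 "u * c"] hom_on_mult[OF B ph u(1) cB] b2A incl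
          subring_setD(6)[OF B u(1) cB] by auto
      then have "\<psi> c \<noteq> 0" using nz2 psi b2A by (auto simp: extends_to_def)
      then show "\<exists>\<psi>. extends_to A t Q \<phi> s \<psi> \<and> \<psi> c \<noteq> 0" using psi by blast
    qed note key = this
    have key0: "\<phi> ?l \<noteq> 0" if "point_on A Q \<phi>" "\<phi> (?l * b2) \<noteq> 0" for \<phi> :: "'a \<Rightarrow> 'k"
    proof -
      have hom: "hom_on A \<phi>" using that by (simp add: point_on_def)
      then show ?thesis using that hom_on_mult[OF A hom lA b2A] by auto
    qed
    show ?thesis
      using pA p dpos pQ bQ bA key0 key by (intro disjI2 bexI[of _ p] bexI[of _ "?l * b2"]) auto
  qed
qed

definition adjoins :: "'a::comm_ring_1 set \<Rightarrow> 'a list \<Rightarrow> 'a set" where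
  "adjoins = foldl adjoin"

lemma adjoins_simps [simp]: "adjoins A [] = A" "adjoins A (t # ts) = adjoins (adjoin A t) ts"
  "adjoins A (ts @ us) = adjoins (adjoins A ts) us"
  by (simp_all add: adjoins_def)

lemma adjoins_subring: "subring_set A \<Longrightarrow> subring_set (adjoins A ts)"
  by (induction ts arbitrary: A) (auto simp: adjoin_subring)

lemma adjoins_incl: "subring_set A \<Longrightarrow> A \<subseteq> adjoins A ts"
proof (induction ts arbitrary: A)
  case (Cons t ts)
  then show ?case using adjoin_incl[OF Cons.prems, of t] Cons.IH[OF adjoin_subring[OF Cons.prems]] by fastforce
qed simp

lemma adjoins_elem: "subring_set A \<Longrightarrow> t \<in> set ts \<Longrightarrow> t \<in> adjoins A ts"
proof (induction ts arbitrary: A)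
  case (Cons u ts)
  then show ?case
    using adjoin_elem[OF Cons.prems(1), of u] adjoins_incl[OF adjoin_subring[OF Cons.prems(1)], of u ts]
      Cons.IH[OF adjoin_subring[OF Cons.prems(1)]] by auto
qed simp

lemma adjoins_least:
  "subring_set A \<Longrightarrow> subring_set B \<Longrightarrow> A \<subseteq> B \<Longrightarrow> set ts \<subseteq> B \<Longrightarrow> adjoins A ts \<subseteq> B"
proof (induction ts arbitrary: A)
  case (Cons t ts)
  have "adjoin A t \<subseteq> B" using Cons.prems by (intro adjoin_least) auto
  then show ?case using Cons.IH[OF adjoin_subring[OF Cons.prems(1)]] Cons.prems by simp
qed simp

text \<open>The condition of being extendable is open: adjoin one generator at a time, each step replacing
  the condition \<open>c \<noteq> 0\<close> by a condition on the ring below.\<close>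

theorem chevalley_extension:
  assumes "subring_set A" and "prime_on (adjoins A ts) Q" and "c \<in> adjoins A ts" "c \<notin> Q"
  shows "\<exists>b\<in>A. b \<notin> Q \<and> (\<forall>\<phi>::'a::comm_ring_1 \<Rightarrow> 'k::{alg_closed_field,field_char_0}.
    point_on A Q \<phi> \<longrightarrow> \<phi> b \<noteq> 0 \<longrightarrow>
    (\<exists>\<psi>. point_on (adjoins A ts) Q \<psi> \<and> (\<forall>x\<in>A. \<psi> x = \<phi> x) \<and> \<psi> c \<noteq> 0))"
  using assms
proof (induction ts arbitrary: A c)
  case Nil
  then show ?case by auto
next
  case (Cons t ts)
  note A = \<open>subring_set A\<close>
  note B = adjoin_subring[OF A, of t]
  have QB: "prime_on (adjoin A t) Q"
    using prime_on_subset[OF Cons.prems(2)] adjoins_incl[OF B] by simp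
  obtain b1 where b1: "b1 \<in> adjoin A t" "b1 \<notin> Q" and
    ext: "\<And>\<phi>::'a \<Rightarrow> 'k. point_on (adjoin A t) Q \<phi> \<Longrightarrow> \<phi> b1 \<noteq> 0 \<Longrightarrow>
      \<exists>\<psi>. point_on (adjoins A (t # ts)) Q \<psi> \<and> (\<forall>x\<in>adjoin A t. \<psi> x = \<phi> x) \<and> \<psi> c \<noteq> 0"
    using Cons.IH[OF B, of c] Cons.prems by auto
  have one: "\<exists>b\<in>A. b \<notin> Q \<and> (\<forall>\<phi>::'a \<Rightarrow> 'k. point_on A Q \<phi> \<longrightarrow> \<phi> b \<noteq> 0 \<longrightarrow>
      (\<exists>s \<psi>. extends_to A t Q \<phi> s \<psi> \<and> \<psi> b1 \<noteq> 0))"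
    using extend_one[OF A QB b1, where 'k = 'k]
  proof (elim disjE bexE conjE)
    fix b assume b: "b \<in> A" "b \<notin> Q" and
      fin: "\<forall>\<phi>::'a \<Rightarrow> 'k. point_on A Q \<phi> \<longrightarrow> \<phi> b \<noteq> 0 \<longrightarrow>
        finite {s. \<not> (\<exists>\<psi>. extends_to A t Q \<phi> s \<psi> \<and> \<psi> b1 \<noteq> 0)}"
    have "\<exists>s \<psi>. extends_to A t Q \<phi> s \<psi> \<and> \<psi> b1 \<noteq> 0" if "point_on A Q \<phi>" "\<phi> b \<noteq> 0" for \<phi> :: "'a \<Rightarrow> 'k"
      using fin that ex_new_if_finite[OF infinite_UNIV_char_0] by blast
    with b show ?thesis by blast
  next
    fix p b assume b: "b \<in> A" "b \<notin> Q" and d: "0 < Polynomial.degree p" and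
      ex: "\<forall>\<phi>::'a \<Rightarrow> 'k. point_on A Q \<phi> \<longrightarrow> \<phi> b \<noteq> 0 \<longrightarrow> \<phi> (lead_coeff p) \<noteq> 0 \<and>
          (\<forall>s. poly (map_poly \<phi> p) s = 0 \<longrightarrow> (\<exists>\<psi>. extends_to A t Q \<phi> s \<psi> \<and> \<psi> b1 \<noteq> 0))"
    have "\<exists>s \<psi>. extends_to A t Q \<phi> s \<psi> \<and> \<psi> b1 \<noteq> 0" if "point_on A Q \<phi>" "\<phi> b \<noteq> 0" for \<phi> :: "'a \<Rightarrow> 'k"
    proof -
      have "\<phi> (lead_coeff p) \<noteq> 0" using ex that by blast
      then obtain s where "poly (map_poly \<phi> p) s = 0"
        using d alg_closed_imp_poly_has_root[of "map_poly \<phi> p"] map_poly_degree_eq[of \<phi> p] by auto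
      then show ?thesis using ex that by blast
    qed
    with b show ?thesis by blast
  qed
  then obtain b where b: "b \<in> A" "b \<notin> Q" and one: "\<And>\<phi>::'a \<Rightarrow> 'k. point_on A Q \<phi> \<Longrightarrow> \<phi> b \<noteq> 0 \<Longrightarrow>
      \<exists>s \<psi>. extends_to A t Q \<phi> s \<psi> \<and> \<psi> b1 \<noteq> 0" by blast
  have "\<exists>\<psi>. point_on (adjoins A (t # ts)) Q \<psi> \<and> (\<forall>x\<in>A. \<psi> x = \<phi> x) \<and> \<psi> c \<noteq> 0"
    if phi: "point_on A Q \<phi>" "\<phi> b \<noteq> 0" for \<phi> :: "'a \<Rightarrow> 'k"
  proof -
    obtain s \<psi>1 where 1: "extends_to A t Q \<phi> s \<psi>1" "\<psi>1 b1 \<noteq> 0" using one[OF phi] by blast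
    then obtain \<psi> where 2: "point_on (adjoins A (t # ts)) Q \<psi>" "\<forall>x\<in>adjoin A t. \<psi> x = \<psi>1 x" "\<psi> c \<noteq> 0"
      using ext[of \<psi>1] by (auto simp: extends_to_def)
    then have "\<psi> x = \<phi> x" if "x \<in> A" for x
      using 1 that adjoin_incl[OF A, of t] by (auto simp: extends_to_def)
    then show ?thesis using 2 by blast
  qed
  then show ?case using b by blast
qed

context
  fixes \<kappa> :: "'k::{alg_closed_field,field_char_0} \<Rightarrow> 'a::comm_ring_1"
  assumes kappa: "ring_hom_total \<kappa>"
begin

abbreviation "consts \<equiv> Set.range \<kappa>"

definition kpoint :: "'a set \<Rightarrow> 'a set \<Rightarrow> ('a \<Rightarrow> 'k) \<Rightarrow> bool" where
  "kpoint C Q \<psi> \<longleftrightarrow> point_on C Q \<psi> \<and> (\<forall>c. \<psi> (\<kappa> c) = c)"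

lemmas kappa_simps = total_hom_0[OF kappa] total_hom_1[OF kappa]
  total_hom_add[OF kappa] total_hom_mult[OF kappa]
  total_hom_diff[OF kappa]

lemma consts_subring: "subring_set consts"
  by (rule hom_image_subring[OF subring_set_UNIV kappa subring_set_UNIV subset_UNIV])

text \<open>Nonzero constants are units.\<close>

lemma kappa_unit: "prime_on C Q \<Longrightarrow> consts \<subseteq> C \<Longrightarrow> c \<noteq> 0 \<Longrightarrow> \<kappa> c \<notin> Q"
proof -
  assume Q: "prime_on C Q" and KC: "consts \<subseteq> C" and c: "c \<noteq> 0"
  have "\<kappa> c * \<kappa> (inverse c) = 1" using c kappa_simps(4)[of c "inverse c"] kappa_simps(2) by simp
  then have "\<kappa> c * \<kappa> (inverse c) \<notin> Q" using Q by (simp add: prime_on_def)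
  moreover have "\<kappa> c \<in> C" "\<kappa> (inverse c) \<in> C" using KC by auto
  ultimately show ?thesis using Q unfolding prime_on_def by blast
qed

lemma kappa_inj: "inj \<kappa>"
proof (rule injI)
  fix x y assume "\<kappa> x = \<kappa> y"
  then have 0: "\<kappa> (x - y) = 0" by (simp add: kappa_simps)
  show "x = y"
  proof (rule ccontr)
    assume "x \<noteq> y"
    then have "\<kappa> 1 = \<kappa> (x - y) * \<kappa> (inverse (x - y))" unfolding kappa_simps(4)[symmetric] by simp
    then show False using 0 by (simp add: kappa_simps)
  qed
qed

text \<open>This is the Nullstellensatz: a point of the ground field extends to an algebra of finite type.\<close>

lemma kpoint_exists:
  assumes Q: "prime_on (adjoins consts ts) Q" and c: "c \<in> adjoins consts ts" "c \<notin> Q"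
  shows "\<exists>\<psi>. kpoint (adjoins consts ts) Q \<psi> \<and> \<psi> c \<noteq> 0"
proof -
  note K = consts_subring
  have Q0: "prime_on consts Q" using prime_on_subset[OF Q adjoins_incl[OF K]] .
  define \<phi> where "\<phi> = inv_into UNIV \<kappa>"
  have phi: "\<phi> (\<kappa> c) = c" for c using kappa_inj by (simp add: \<phi>_def)
  have pt: "point_on consts Q \<phi>"
    unfolding point_on_def hom_on_def
  proof (intro conjI ballI impI)
    show "\<phi> 1 = 1" using phi[of 1] by (simp add: kappa_simps)
    show "\<phi> x = 0" if "x \<in> consts" "x \<in> Q" for x
      using that kappa_unit[OF Q0 order_refl] phi by (metis rangeE)
    fix x y assume "x \<in> consts" "y \<in> consts"
    then show "\<phi> (x + y) = \<phi> x + \<phi> y" "\<phi> (x * y) = \<phi> x * \<phi> y"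
      by (auto simp: kappa_simps(3,4)[symmetric] phi)
  qed
  obtain b where b: "b \<in> consts" "b \<notin> Q" and ext: "\<And>\<phi>::'a \<Rightarrow> 'k. point_on consts Q \<phi> \<Longrightarrow> \<phi> b \<noteq> 0 \<Longrightarrow>
    \<exists>\<psi>. point_on (adjoins consts ts) Q \<psi> \<and> (\<forall>x\<in>consts. \<psi> x = \<phi> x) \<and> \<psi> c \<noteq> 0"
    using chevalley_extension[OF K Q c, where 'k = 'k] by blast
  have "\<phi> b \<noteq> 0" using b Q0 phi by (auto simp: prime_on_def kappa_simps)
  then show ?thesis using ext[OF pt] phi by (auto simp: kpoint_def)
qed

lemma kpoint_hom: "kpoint C Q \<psi> \<Longrightarrow> hom_on C \<psi>"
  by (simp add: kpoint_def point_on_def)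

text \<open>If the values of \<open>t\<close> are determined by the values of the elements of \<open>A\<close>, then
  the polynomial of least degree satisfied by \<open>t\<close> over \<open>A\<close> has only one root at a general
  point. In characteristic zero its two leading coefficients give that root rationally.\<close>

lemma determined_imp_linear:
  assumes A: "A = adjoins consts us" and C: "C = adjoins A ts" and Q: "prime_on C Q" and t: "t \<in> C"
    and det: "\<And>\<psi> \<psi>'. kpoint C Q \<psi> \<Longrightarrow> kpoint C Q \<psi>' \<Longrightarrow> (\<And>x. x \<in> A \<Longrightarrow> \<psi> x = \<psi>' x) \<Longrightarrow> \<psi> t = \<psi>' t"
  shows "\<exists>b\<in>A. \<exists>a\<in>A. b \<notin> Q \<and> b * t - a \<in> Q"
proof -
  have As: "subring_set A" unfolding A by (intro adjoins_subring consts_subring)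
  have Cs: "subring_set C" unfolding C by (intro adjoins_subring As)
  have AC: "A \<subseteq> C" unfolding C by (intro adjoins_incl As)
  have KA: "consts \<subseteq> A" unfolding A by (intro adjoins_incl consts_subring)
  let ?B = "adjoin A t"
  have Bs: "subring_set ?B" by (rule adjoin_subring[OF As])
  have AB: "A \<subseteq> ?B" by (rule adjoin_incl[OF As])
  have BC: "?B \<subseteq> C" by (rule adjoin_least[OF As Cs AC t])
  have C': "C = adjoins ?B ts"
  proof (rule antisym)
    have "A \<subseteq> adjoins ?B ts" using AB adjoins_incl[OF Bs] by blast
    then show "C \<subseteq> adjoins ?B ts" unfolding C
      by (intro adjoins_least As adjoins_subring Bs) (auto intro: adjoins_elem[OF Bs])
    show "adjoins ?B ts \<subseteq> C"
      using adjoins_elem[OF As] by (intro adjoins_least Bs Cs BC) (simp add: C subset_iff)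
  qed
  have CK: "C = adjoins consts (us @ ts)" by (simp add: A C)
  have Q1: "1 \<notin> Q" using Q by (simp add: prime_on_def)
  have QB: "prime_on ?B Q" and QA: "prime_on A Q" using prime_on_subset[OF Q] BC AC by auto
  \<comment> \<open>\<open>c\<close> is the condition under which a point of \<open>A[t]\<close> extends to
    \<open>C\<close>\<close>
  obtain c where c: "c \<in> ?B" "c \<notin> Q" and ext0: "\<And>\<phi>::'a \<Rightarrow> 'k. point_on ?B Q \<phi> \<Longrightarrow> \<phi> c \<noteq> 0 \<Longrightarrow>
      \<exists>\<psi>. point_on C Q \<psi> \<and> (\<forall>x\<in>?B. \<psi> x = \<phi> x)"
    using chevalley_extension[OF Bs, of ts Q 1, where 'k = 'k] Q Q1 subring_setD(2)[OF Cs]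
    unfolding C'[symmetric] by blast
  have ext: "\<exists>\<psi>'. kpoint C Q \<psi>' \<and> (\<forall>x\<in>A. \<psi>' x = \<phi> x) \<and> \<psi>' t = s"
    if h: "kpoint A Q \<phi>" "extends_to A t Q \<phi> s \<psi>" "\<psi> c \<noteq> 0" for \<phi> s \<psi>
  proof -
    obtain \<psi>' where "point_on C Q \<psi>'" "\<forall>x\<in>?B. \<psi>' x = \<psi> x" using ext0[of \<psi>] h by (auto simp: extends_to_def)
    moreover have "\<phi> (\<kappa> k) = k" "\<kappa> k \<in> A" for k using h(1) KA by (auto simp: kpoint_def)
    ultimately show ?thesis using h(2) AB adjoin_elem[OF As, of t]
      by (intro exI[of _ \<psi>']) (auto simp: kpoint_def extends_to_def subset_iff)
  qed
  have unique: "s = s'"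
    if h: "kpoint A Q \<phi>" "extends_to A t Q \<phi> s \<psi>" "\<psi> c \<noteq> 0" "extends_to A t Q \<phi> s' \<psi>'" "\<psi>' c \<noteq> 0" for \<phi> s s' \<psi> \<psi>'
  proof -
    obtain \<chi> \<chi>' where "kpoint C Q \<chi>" "kpoint C Q \<chi>'" "\<forall>x\<in>A. \<chi> x = \<phi> x" "\<forall>x\<in>A. \<chi>' x = \<phi> x"
      "\<chi> t = s" "\<chi>' t = s'" using ext[OF h(1-3)] ext[OF h(1,4,5)] by blast
    then show ?thesis using det[of \<chi> \<chi>'] by simp
  qed
  show ?thesis
    using extend_one[OF As QB c, where 'k = 'k]
  proof (elim disjE bexE conjE)
    fix b assume b: "b \<in> A" "b \<notin> Q" and
      fin: "\<forall>\<phi>::'a \<Rightarrow> 'k. point_on A Q \<phi> \<longrightarrow> \<phi> b \<noteq> 0 \<longrightarrow>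
        finite {s. \<not> (\<exists>\<psi>. extends_to A t Q \<phi> s \<psi> \<and> \<psi> c \<noteq> 0)}"
    obtain \<phi> where phi: "kpoint A Q \<phi>" "\<phi> b \<noteq> 0" using kpoint_exists[of us Q b] QA b unfolding A[symmetric] by blast
    then have fin: "finite {s. \<not> (\<exists>\<psi>. extends_to A t Q \<phi> s \<psi> \<and> \<psi> c \<noteq> 0)}" (is "finite ?E")
      using fin by (simp add: kpoint_def)
    obtain s where s: "s \<notin> ?E" using ex_new_if_finite[OF infinite_UNIV_char_0 fin] by blast
    obtain s' where s': "s' \<notin> insert s ?E"
      using ex_new_if_finite[OF infinite_UNIV_char_0, of "insert s ?E"] fin by blast
    then have False using s unique[OF phi(1)] by blast
    then show ?thesis ..
  next
    fix p b
    assume p: "p \<in> polys_over A" "poly p t \<in> Q" and d: "0 < Polynomial.degree p"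
      and l: "lead_coeff p \<notin> Q" and b: "b \<in> A" "b \<notin> Q" and
      ex: "\<forall>\<phi>::'a \<Rightarrow> 'k. point_on A Q \<phi> \<longrightarrow> \<phi> b \<noteq> 0 \<longrightarrow> \<phi> (lead_coeff p) \<noteq> 0 \<and>
          (\<forall>s. poly (map_poly \<phi> p) s = 0 \<longrightarrow> (\<exists>\<psi>. extends_to A t Q \<phi> s \<psi> \<and> \<psi> c \<noteq> 0))"
    define d where "d = Polynomial.degree p"
    define l where "l = lead_coeff p"
    define a where "a = Polynomial.coeff p (d - 1)"
    have la: "l \<in> A" "a \<in> A" using p by (auto simp: l_def a_def polys_over_def)
    have dA: "\<kappa> (of_nat d) \<in> A" using KA by blast
    have dQ: "\<kappa> (of_nat d) \<notin> Q" by (rule kappa_unit[OF QA KA]) (use d in \<open>simp add: d_def\<close>)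
    \<comment> \<open>the linear equation of the \<open>d\<close>-fold root of a polynomial with leading
      coefficients \<open>l\<close> and \<open>a\<close>\<close>
    define f where "f = \<kappa> (of_nat d) * l * t - (- a)"
    have fC: "f \<in> C" unfolding f_def using la dA AC t by (intro subring_setD[OF Cs]) auto
    have "f \<in> Q"
    proof (rule ccontr)
      assume fQ: "f \<notin> Q"
      have "b * f \<in> C" "b * f \<notin> Q" using fQ b Q fC AC subring_setD(6)[OF Cs] by (auto simp: prime_on_def)
      then obtain \<psi> where psi: "kpoint C Q \<psi>" and bf: "\<psi> (b * f) \<noteq> 0"
        using kpoint_exists[of "us @ ts" Q "b * f"] Q unfolding CK[symmetric] by blast
      note hom = kpoint_hom[OF psi]
      have nz: "\<psi> b \<noteq> 0" "\<psi> f \<noteq> 0" using bf hom_on_mult[OF Cs hom _ fC, of b] b AC by auto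
      have psiA: "kpoint A Q \<psi>" using psi AC point_on_subset by (auto simp: kpoint_def)
      define P where "P = map_poly \<psi> p"
      have 0: "\<psi> 0 = 0" by (rule hom_on_0[OF Cs hom])
      have exP: "\<psi> l \<noteq> 0" "\<And>s. poly P s = 0 \<Longrightarrow> \<exists>\<psi>'. extends_to A t Q \<psi> s \<psi>' \<and> \<psi>' c \<noteq> 0"
        using ex nz(1) psiA by (auto simp: kpoint_def P_def l_def)
      have root: "poly P (\<psi> t) = 0"
        using poly_map_poly_hom_on[OF As hom Cs AC t p(1)] psi p(2) poly_in_subring[OF As Cs AC t p(1)]
        by (auto simp: P_def kpoint_def point_on_def)
      have deg: "Polynomial.degree P = d" "lead_coeff P = \<psi> l"
        using exP(1) map_poly_degree_eq[of \<psi> p] 0 by (auto simp: P_def d_def l_def coeff_map_poly)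
      then have "P \<noteq> 0" using d by (auto simp: d_def)
      then obtain R where R: "size R = d" "P = smult (lead_coeff P) (\<Prod>x\<in>#R. [:-x, 1:])"
        using alg_closed_imp_factorization[of P] deg by auto
      have "x = \<psi> t" if "x \<in># R" for x
      proof -
        have "poly (\<Prod>x\<in>#R. [:-x, 1:]) x = 0"
          using multi_member_split[OF that] by auto
        then have "poly P x = 0" by (subst R(2)) simp
        then show ?thesis using exP(2)[of x] exP(2)[OF root] unique[OF psiA] by blast
      qed
      then have "R = replicate_mset d (\<psi> t)"
        using R(1) set_mset_subset_singletonD[of R "\<psi> t"] by (simp add: subset_iff)
      then have "P = smult (\<psi> l) ([:- \<psi> t, 1:] ^ d)" using R(2) deg by simp
      then have "Polynomial.coeff P (d - 1) = \<psi> l * (of_nat (d choose (d - 1)) * (- \<psi> t) ^ (d - (d - 1)))"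
        by (simp add: coeff_linear_poly_power)
      moreover have "d - (d - 1) = 1" "d choose (d - 1) = d"
        using d binomial_Suc_n[of "d - 1"] by (auto simp: d_def)
      ultimately have "\<psi> a = - (of_nat d * \<psi> l * \<psi> t)"
        using 0 by (simp add: P_def a_def coeff_map_poly)
      moreover have "\<psi> f = of_nat d * \<psi> l * \<psi> t + \<psi> a"
      proof -
        have *: "l \<in> C" "a \<in> C" "\<kappa> (of_nat d) \<in> C" using la dA AC by auto
        have "\<psi> (\<kappa> (of_nat d)) = of_nat d" using psi by (simp add: kpoint_def)
        then show ?thesis unfolding f_def
          by (simp add: hom_on_diff[OF Cs hom] hom_on_uminus[OF Cs hom] hom_on_mult[OF Cs hom] hom_on_add[OF Cs hom]
              subring_setD[OF Cs] * t)
      qed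
      ultimately show False using nz by simp
    qed
    moreover have "\<kappa> (of_nat d) * l \<notin> Q" using QA dA dQ l la by (auto simp: prime_on_def l_def)
    ultimately show ?thesis using la dA subring_setD[OF As]
      by (intro bexI[of _ "\<kappa> (of_nat d) * l"] bexI[of _ "- a"]) (auto simp: f_def)
  qed
qed

end

text \<open>Minimal primes are handled through their complements: a multiplicative set stays one in every
  larger ring, where it can be enlarged to a maximal one.\<close>

definition mult_set :: "'a::comm_ring_1 set \<Rightarrow> 'a set \<Rightarrow> bool" where
  "mult_set C S \<longleftrightarrow> S \<subseteq> C \<and> 1 \<in> S \<and> 0 \<notin> S \<and> (\<forall>x\<in>S. \<forall>y\<in>S. x * y \<in> S)"

lemma maximal_mult_set:
  assumes C: "subring_set C" and S: "mult_set C S"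
  shows "\<exists>N. S \<subseteq> N \<and> mult_set C N \<and> (\<forall>N'. mult_set C N' \<longrightarrow> N \<subseteq> N' \<longrightarrow> N' = N)"
proof -
  define \<A> where "\<A> = {N. S \<subseteq> N \<and> mult_set C N}"
  have "\<exists>M\<in>\<A>. \<forall>Y\<in>\<A>. M \<subseteq> Y \<longrightarrow> Y = M"
  proof (rule subset_Zorn_nonempty)
    show "\<A> \<noteq> {}" using S by (auto simp: \<A>_def)
    fix \<C> assume ne: "\<C> \<noteq> {}" and ch: "subset.chain \<A> \<C>"
    have sub: "\<And>N. N \<in> \<C> \<Longrightarrow> S \<subseteq> N \<and> mult_set C N" using ch by (auto simp: subset.chain_def \<A>_def)
    have "x * y \<in> \<Union>\<C>" if xy: "x \<in> \<Union>\<C>" "y \<in> \<Union>\<C>" for x y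
    proof -
      obtain N1 N2 where N: "x \<in> N1" "N1 \<in> \<C>" "y \<in> N2" "N2 \<in> \<C>" using xy by blast
      then have "N1 \<subseteq> N2 \<or> N2 \<subseteq> N1" using ch by (auto simp: subset.chain_def)
      then have "\<exists>N\<in>\<C>. x \<in> N \<and> y \<in> N" using N by blast
      then show ?thesis using sub by (auto simp: mult_set_def)
    qed
    then show "\<Union>\<C> \<in> \<A>" using ne sub unfolding \<A>_def mult_set_def by blast
  qed
  then obtain N where N: "N \<in> \<A>" "\<And>Y. Y \<in> \<A> \<Longrightarrow> N \<subseteq> Y \<Longrightarrow> Y = N" by blast
  have "N' = N" if "mult_set C N'" "N \<subseteq> N'" for N'
    using N that by (auto simp: \<A>_def)
  then show ?thesis using N(1) by (auto simp: \<A>_def)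
qed

text \<open>The products \<open>m * x ^ n\<close> form a multiplicative set. In a reduced ring none of them
  is zero unless some \<open>m * x\<close> is.\<close>

lemma mult_set_adjoin:
  fixes C N :: "'a::comm_ring_1 set"
  assumes C: "subring_set C" and N: "mult_set C N" and x: "x \<in> C"
    and reduced: "\<forall>(x::'a) n. x ^ n = 0 \<longrightarrow> x = 0"
    and no: "\<not> (\<exists>m\<in>N. m * x = 0)"
  shows "\<exists>N'. mult_set C N' \<and> N \<subseteq> N' \<and> x \<in> N'"
proof (intro exI conjI)
  define N' where "N' = {m * x ^ n | m n. m \<in> N}"
  have nz: "m * x ^ n \<noteq> 0" if m: "m \<in> N" for m n
  proof
    assume "m * x ^ n = 0"
    then have "(m * x) ^ Suc n = 0" by (simp add: power_mult_distrib mult_ac)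
        (metis mult.assoc mult.commute mult_zero_left)
    then show False using reduced no m by blast
  qed
  show sub: "N \<subseteq> N'"
  proof
    fix m assume "m \<in> N"
    then show "m \<in> N'" unfolding N'_def by (intro CollectI exI[of _ m] exI[of _ 0]) simp
  qed
  have "u * v \<in> N'" if uv: "u \<in> N'" "v \<in> N'" for u v
  proof -
    obtain m n m' n' where "m \<in> N" "m' \<in> N" "u = m * x ^ n" "v = m' * x ^ n'" using uv by (auto simp: N'_def)
    moreover then have "u * v = (m * m') * x ^ (n + n')" by (simp add: power_add mult_ac)
    ultimately show ?thesis using N unfolding N'_def mult_set_def by blast
  qed
  moreover have "N' \<subseteq> C"
    using N x by (auto simp: N'_def mult_set_def intro!: subring_setD(6,7)[OF C])
  moreover have "0 \<notin> N'"
  proof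
    assume "0 \<in> N'"
    then obtain m n where "m \<in> N" "0 = m * x ^ n" unfolding N'_def by blast
    then show False using nz[of m n] by simp
  qed
  moreover have "1 \<in> N'" using sub N by (auto simp: mult_set_def)
  ultimately show "mult_set C N'" by (simp add: mult_set_def)
  have "1 * x ^ 1 \<in> N'" using N unfolding N'_def mult_set_def by blast
  then show "x \<in> N'" by simp
qed

context
  fixes C N :: "'a::comm_ring_1 set"
  assumes C: "subring_set C" and N: "mult_set C N"
    and N_max: "\<And>N'. mult_set C N' \<Longrightarrow> N \<subseteq> N' \<Longrightarrow> N' = N"
    and reduced: "\<forall>(x::'a) n. x ^ n = 0 \<longrightarrow> x = 0"
begin

text \<open>The local ring at a minimal prime of a reduced ring is a field, that is, the prime becomes zero
  there.\<close>

lemma maximal_mult_set_annihilates: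
  assumes x: "x \<in> C" "x \<notin> N"
  shows "\<exists>m\<in>N. m * x = 0"
  using mult_set_adjoin[OF C N x(1) reduced] N_max x(2) by blast

lemma maximal_mult_set_prime: "prime_on C (- N)"
  unfolding prime_on_def
proof (intro conjI ballI impI)
  show "1 \<notin> - N" "0 \<in> - N" using N by (auto simp: mult_set_def)
  have ann: "x * y \<notin> N" if "m \<in> N" "m * x = 0" for m x y
  proof
    assume "x * y \<in> N"
    then have "m * (x * y) \<in> N" using that N by (auto simp: mult_set_def)
    then show False using that N by (simp add: mult_set_def mult.assoc[symmetric])
  qed
  fix x y assume xy: "x \<in> C" "y \<in> C"
  show "x - y \<in> - N" if h: "x \<in> - N" "y \<in> - N"
  proof -
    obtain m m' where m: "m \<in> N" "m * x = 0" "m' \<in> N" "m' * y = 0"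
      using maximal_mult_set_annihilates xy h by blast
    have "(m * m') * (x - y) = m' * (m * x) - m * (m' * y)" by (simp add: algebra_simps)
    also have "\<dots> = 0" using m by simp
    finally show ?thesis using ann[of "m * m'" "x - y" 1] m N by (auto simp: mult_set_def)
  qed
  show "x * y \<in> - N \<longleftrightarrow> x \<in> - N \<or> y \<in> - N"
  proof
    show "x * y \<in> - N \<Longrightarrow> x \<in> - N \<or> y \<in> - N" using N by (auto simp: mult_set_def)
    show "x * y \<in> - N" if "x \<in> - N \<or> y \<in> - N"
      using that ann maximal_mult_set_annihilates xy by (metis ComplD ComplI mult.commute)
  qed
qed

end

text \<open>Let \<open>M\<close> be the complement of a minimal prime of \<open>A\<close>. Modulo each prime of \<open>C\<close> disjoint from
  \<open>M\<close> there is a linear equation for \<open>t\<close>. The equation found for one such prime holds modulo all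
  of them, since otherwise two points over one point of \<open>A\<close> would disagree on \<open>t\<close>; therefore it
  holds in \<open>C\<close> up to a factor in \<open>M\<close>. Denominators can thus be taken from a set closed under
  products, which makes common denominators available.\<close>

theorem determined_imp_rational:
  fixes \<kappa> :: "'k::{alg_closed_field,field_char_0} \<Rightarrow> 'a::comm_ring_1"
  assumes kappa: "ring_hom_total \<kappa>"
    and reduced: "\<forall>(x::'a) n. x ^ n = 0 \<longrightarrow> x = 0"
    and A: "A = adjoins (Set.range \<kappa>) us" and C: "C = adjoins A ts"
    and det: "\<And>\<psi> \<psi>' t. hom_on C \<psi> \<Longrightarrow> hom_on C \<psi>' \<Longrightarrow> (\<And>c. \<psi> (\<kappa> c) = c) \<Longrightarrow> (\<And>c. \<psi>' (\<kappa> c) = c) \<Longrightarrow>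
       (\<And>x. x \<in> A \<Longrightarrow> \<psi> x = \<psi>' x) \<Longrightarrow> t \<in> C \<Longrightarrow> \<psi> t = \<psi>' t"
  shows "\<exists>M. mult_set A M \<and> (\<forall>t\<in>C. \<exists>b\<in>M. b * t \<in> A)"
proof -
  note Ks = consts_subring[OF kappa]
  have As: "subring_set A" unfolding A by (intro adjoins_subring Ks)
  have Cs: "subring_set C" unfolding C by (intro adjoins_subring As)
  have AC: "A \<subseteq> C" unfolding C by (intro adjoins_incl As)
  have KA: "Set.range \<kappa> \<subseteq> A" unfolding A by (intro adjoins_incl Ks)
  have CK: "C = adjoins (Set.range \<kappa>) (us @ ts)" by (simp add: A C)
  have "mult_set A {1}" using subring_setD[OF As] by (simp add: mult_set_def)
  from maximal_mult_set[OF As this] obtain M where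
    M: "mult_set A M" and Mmax: "\<And>N'. mult_set A N' \<Longrightarrow> M \<subseteq> N' \<Longrightarrow> N' = M" by blast
  have above: "N \<inter> A = M" if "mult_set C N" "M \<subseteq> N" for N
    using that M subring_setD[OF As] by (intro Mmax) (auto simp: mult_set_def)
  have MC: "mult_set C M" using M AC by (auto simp: mult_set_def)
  from maximal_mult_set[OF Cs this] obtain N where N: "M \<subseteq> N" "mult_set C N"
    and Nmax: "\<And>N'. mult_set C N' \<Longrightarrow> N \<subseteq> N' \<Longrightarrow> N' = N" by blast
  have P: "prime_on C (- N)" by (rule maximal_mult_set_prime[OF Cs N(2) Nmax reduced])
  have NA: "x \<in> - N \<longleftrightarrow> x \<notin> M" if "x \<in> A" for x using above[OF N(2,1)] that by blast
  have kp: "hom_on C \<psi> \<and> (\<forall>c. \<psi> (\<kappa> c) = c)" if "kpoint \<kappa> C Q \<psi>" for Q \<psi>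
    using that by (simp add: kpoint_def[OF kappa] point_on_def)
  have "\<exists>b\<in>M. b * t \<in> A" if t: "t \<in> C" for t
  proof -
    obtain b a where ba: "b \<in> A" "a \<in> A" "b \<notin> - N" "b * t - a \<in> - N"
      using determined_imp_linear[OF kappa A C P t] det[OF _ _ _ _ _ t] kp by metis
    have bM: "b \<in> M" using ba NA by blast
    define f where "f = b * t - a"
    have fC: "f \<in> C" unfolding f_def using ba AC t by (intro subring_setD[OF Cs]) auto
    have "\<exists>m\<in>M. m * f = 0"
    proof (rule ccontr)
      assume no: "\<not> (\<exists>m\<in>M. m * f = 0)"
      obtain S where S: "mult_set C S" and MS: "M \<subseteq> S" and fS: "f \<in> S"
        using mult_set_adjoin[OF Cs MC fC reduced no] by blast
      from maximal_mult_set[OF Cs S] obtain N1 where N1: "S \<subseteq> N1" "mult_set C N1"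
        and N1max: "\<And>N'. mult_set C N' \<Longrightarrow> N1 \<subseteq> N' \<Longrightarrow> N' = N1" by blast
      have P1: "prime_on C (- N1)" by (rule maximal_mult_set_prime[OF Cs N1(2) N1max reduced])
      have MN1: "M \<subseteq> N1" using MS N1 by blast
      have N1A: "x \<in> - N1 \<longleftrightarrow> x \<notin> M" if "x \<in> A" for x using above[OF N1(2) MN1] that by blast
      have fN1: "f \<notin> - N1" using N1 fS by auto
      obtain b1 where b1: "b1 \<in> A" "b1 \<notin> - N1" and
        ext1: "\<And>\<phi>::'a \<Rightarrow> 'k. point_on A (- N1) \<phi> \<Longrightarrow> \<phi> b1 \<noteq> 0 \<Longrightarrow>
          \<exists>\<psi>. point_on C (- N1) \<psi> \<and> (\<forall>x\<in>A. \<psi> x = \<phi> x) \<and> \<psi> f \<noteq> 0"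
        using chevalley_extension[OF As P1[unfolded C] fC[unfolded C] fN1, where 'k = 'k]
        unfolding C[symmetric] by blast
      have b1C: "b1 \<in> C" "b1 \<notin> - N" using b1 AC NA N1A by auto
      obtain \<psi> where psi: "kpoint \<kappa> C (- N) \<psi>" "\<psi> b1 \<noteq> 0"
        using kpoint_exists[OF kappa P[unfolded CK] b1C[unfolded CK]] unfolding CK[symmetric] by blast
      have hom: "hom_on C \<psi>" using kp[OF psi(1)] by simp
      have "point_on A (- N1) \<psi>"
        using psi(1) NA N1A AC hom_on_subset[OF hom AC]
        by (auto simp: kpoint_def[OF kappa] point_on_def)
      from ext1[OF this psi(2)] obtain \<psi>1 where psi1: "point_on C (- N1) \<psi>1" "\<forall>x\<in>A. \<psi>1 x = \<psi> x" "\<psi>1 f \<noteq> 0"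
        by blast
      have hom1: "hom_on C \<psi>1" using psi1(1) by (simp add: point_on_def)
      have k1: "\<psi>1 (\<kappa> c) = c" for c using psi1(2) subsetD[OF KA rangeI] kp[OF psi(1)] by auto
      have "\<psi> t = \<psi>1 t" using det[OF hom hom1 _ k1 _ t] kp[OF psi(1)] psi1(2) by simp
      moreover have *: "h f = h b * h t - h a" if h: "hom_on C h" for h :: "'a \<Rightarrow> 'k"
        using ba AC t subring_setD(6)[OF Cs, of b t] unfolding f_def
        by (simp add: hom_on_diff[OF Cs h] hom_on_mult[OF Cs h] subset_iff)
      ultimately have "\<psi> f = \<psi>1 f" using psi1(2) ba by (simp add: *[OF hom] *[OF hom1])
      moreover have "\<psi> f = 0"
        using psi(1) fC ba(4) by (simp add: kpoint_def[OF kappa] point_on_def f_def)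
      ultimately show False using psi1(3) by simp
    qed
    then obtain m where m: "m \<in> M" "m * f = 0" by blast
    then have "(m * b) * t = m * a" by (simp add: f_def algebra_simps)
    moreover have "m * a \<in> A" using m M ba by (auto simp: mult_set_def intro!: subring_setD[OF As])
    moreover have "m * b \<in> M" using m bM M by (auto simp: mult_set_def)
    ultimately show ?thesis by (metis)
  qed
  then show ?thesis using M by blast
qed

section \<open>Scaling of variables\<close>

text \<open>Polynomials over rational function fields are compared through scaling of the variables by 2,
  which requires characteristic zero of those fields.\<close>

instance fract :: ("{idom, ring_char_0}") field_char_0
proof
  show "inj (of_nat :: nat \<Rightarrow> 'a fract)"
    by (rule injI) (simp add: of_nat_fract eq_fract)
qed

text \<open>The difference of \<open>2\<^sup>a p\<close> and of \<open>p\<close> with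
  \<open>x\<^sub>i\<close> replaced by \<open>2 x\<^sub>i\<close>. The terms of degree \<open>a\<close> in
  \<open>x\<^sub>i\<close> cancel.\<close>

definition scale_diff :: "'i \<Rightarrow> nat \<Rightarrow> ('i, 'a::comm_ring_1) mpoly \<Rightarrow> ('i, 'a) mpoly" where
  "scale_diff i a = Poly_Mapping.mapp (\<lambda>m c. (2 ^ a - 2 ^ Poly_Mapping.lookup m i) * c)"

lemma lookup_scale_diff:
  "Poly_Mapping.lookup (scale_diff i a p) m = (2 ^ a - 2 ^ Poly_Mapping.lookup m i) * Poly_Mapping.lookup p m"
  by (auto simp: scale_diff_def lookup_mapp when_def in_keys_iff)

lemma keys_scale_diff: "Poly_Mapping.keys (scale_diff i a p) \<subseteq> Poly_Mapping.keys p"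
  by (auto simp: in_keys_iff lookup_scale_diff)

lemma hom_on_numeral: "ring_hom_total h \<Longrightarrow> h (numeral n) = numeral n"
  using hom_on_of_nat[OF subring_set_UNIV, of h "numeral n"] by simp

lemma poly_eval_scale_diff:
  assumes phi: "ring_hom_total \<phi>"
  shows "poly_eval \<phi> x (scale_diff i a p) = 2 ^ a * poly_eval \<phi> x p - poly_eval \<phi> (x(i := 2 * x i)) p"
proof -
  have mono: "mono_eval (x(i := 2 * x i)) m = 2 ^ Poly_Mapping.lookup m i * mono_eval x m" for m
  proof -
    let ?I = "insert i (Poly_Mapping.keys m)"
    have "mono_eval (x(i := 2 * x i)) m = (2 * x i) ^ Poly_Mapping.lookup m i *
        (\<Prod>j\<in>?I - {i}. (x(i := 2 * x i)) j ^ Poly_Mapping.lookup m j)"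
      by (subst mono_eval_superset[of ?I]) (auto simp: prod.remove[of ?I i])
    also have "(\<Prod>j\<in>?I - {i}. (x(i := 2 * x i)) j ^ Poly_Mapping.lookup m j)
        = (\<Prod>j\<in>?I - {i}. x j ^ Poly_Mapping.lookup m j)"
      by (intro prod.cong) auto
    also have "(2 * x i) ^ Poly_Mapping.lookup m i * \<dots> = 2 ^ Poly_Mapping.lookup m i * mono_eval x m"
      by (subst mono_eval_superset[of ?I]) (auto simp: prod.remove[of ?I i] power_mult_distrib mult_ac)
    finally show ?thesis .
  qed
  have pw: "\<phi> (2 ^ n) = 2 ^ n" for n
    by (simp add: total_hom_power[OF phi] hom_on_numeral[OF phi])
  show ?thesis
    unfolding poly_eval_superset[OF phi finite_keys keys_scale_diff] poly_eval_mono[of \<phi> _ p] lookup_scale_diff mono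
    by (simp add: sum_distrib_left sum_subtractf[symmetric] phi_simps[OF phi]
        total_hom_diff[OF phi] pw algebra_simps)
qed

text \<open>Distinct monomials are distinct characters of the torus, so a set of polynomials stable
  under scaling of the variables contains monomials as soon as it is not zero.\<close>

lemma scaling_stable_imp_zero:
  fixes S :: "('i, 'a::field_char_0) mpoly set"
  assumes stable: "\<And>p i a. p \<in> S \<Longrightarrow> scale_diff i a p \<in> S"
    and mono: "\<And>p m. p \<in> S \<Longrightarrow> Poly_Mapping.keys p \<noteq> {m}"
    and "p \<in> S"
  shows "p = 0"
  using \<open>p \<in> S\<close>
proof (induction "card (Poly_Mapping.keys p)" arbitrary: p rule: less_induct)
  case less
  show ?case
  proof (rule ccontr)
    assume "p \<noteq> 0"
    then obtain m where m: "m \<in> Poly_Mapping.keys p" by (metis all_not_in_conv keys_eq_empty)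
    then obtain m' where m': "m' \<in> Poly_Mapping.keys p" "m' \<noteq> m" using mono[OF less.prems] by blast
    then obtain i where i: "Poly_Mapping.lookup m' i \<noteq> Poly_Mapping.lookup m i"
      by (metis poly_mapping_eqI)
    let ?q = "scale_diff i (Poly_Mapping.lookup m i) p"
    have "m \<notin> Poly_Mapping.keys ?q" by (simp add: in_keys_iff lookup_scale_diff)
    then have "Poly_Mapping.keys ?q \<subset> Poly_Mapping.keys p" using m by (intro psubsetI keys_scale_diff) auto
    then have "?q = 0" by (intro less.hyps stable less.prems psubset_card_mono) auto
    then have "Poly_Mapping.lookup ?q m' = 0" by simp
    moreover have "(2::'a) ^ Poly_Mapping.lookup m i \<noteq> 2 ^ Poly_Mapping.lookup m' i"
    proof
      assume "(2::'a) ^ Poly_Mapping.lookup m i = 2 ^ Poly_Mapping.lookup m' i"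
      then have "of_nat (2 ^ Poly_Mapping.lookup m i) = (of_nat (2 ^ Poly_Mapping.lookup m' i) :: 'a)" by simp
      then have "(2::nat) ^ Poly_Mapping.lookup m i = 2 ^ Poly_Mapping.lookup m' i" by (simp only: of_nat_eq_iff)
      then show False using i by simp
    qed
    ultimately show False using m' by (simp add: lookup_scale_diff in_keys_iff)
  qed
qed

text \<open>This set of points is stable under doubling coordinates. Its coordinates are fixed by every
  field homomorphism.\<close>

lemma nonzero_at_power_of_2_point:
  fixes p :: "('i, 'a::field_char_0) mpoly"
  assumes "p \<noteq> 0"
  shows "\<exists>x. (\<forall>i. \<exists>n. x i = 2 ^ n) \<and> poly_eval (\<lambda>c. c) x p \<noteq> 0"
proof (rule ccontr)
  assume no: "\<not> ?thesis"
  define S where "S = {p :: ('i, 'a) mpoly. \<forall>x. (\<forall>i. \<exists>n. x i = 2 ^ n) \<longrightarrow> poly_eval (\<lambda>c. c) x p = 0}"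
  have "p = 0"
  proof (rule scaling_stable_imp_zero[of S])
    show "p \<in> S" using no unfolding S_def by blast
    show "scale_diff i a p \<in> S" if p: "p \<in> S" for p i a
      unfolding S_def
    proof (intro CollectI allI impI)
      fix x :: "'i \<Rightarrow> 'a" assume x: "\<forall>i. \<exists>n. x i = 2 ^ n"
      then obtain n where "x i = 2 ^ n" by blast
      then have "\<exists>n. 2 * x i = 2 ^ n" by (intro exI[of _ "Suc n"]) simp
      then have "\<forall>j. \<exists>n. (x(i := 2 * x i)) j = 2 ^ n" using x by simp
      then show "poly_eval (\<lambda>c. c) x (scale_diff i a p) = 0"
        using p x unfolding S_def poly_eval_scale_diff[OF hom_on_id] by simp
    qed
    show "Poly_Mapping.keys p \<noteq> {m}" if p: "p \<in> S" for p m
    proof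
      assume k: "Poly_Mapping.keys p = {m}"
      have "\<forall>i::'i. \<exists>n. (1::'a) = 2 ^ n" by (metis power_0)
      then have "poly_eval (\<lambda>c. c) (\<lambda>i. 1) p = 0"
        using p[unfolded S_def mem_Collect_eq, THEN spec, of "\<lambda>i. 1"] by blast
      then have "Poly_Mapping.lookup p m = 0" by (simp add: poly_eval_def k)
      then show False using k by (metis in_keys_iff singletonI)
    qed
  qed
  then show False using assms by simp
qed

section \<open>Rational functions\<close>

definition subfield_set :: "'a::field set \<Rightarrow> bool" where
  "subfield_set F \<longleftrightarrow> subring_set F \<and> (\<forall>x\<in>F. inverse x \<in> F)"

lemma subfield_setD:
  assumes "subfield_set F"
  shows "subring_set F" "x \<in> F \<Longrightarrow> inverse x \<in> F" "x \<in> F \<Longrightarrow> y \<in> F \<Longrightarrow> x / y \<in> F"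
  using assms by (auto simp: subfield_set_def divide_inverse intro!: subring_setD)

lemma field_hom_inverse:
  fixes h :: "'a::field \<Rightarrow> 'b::field"
  assumes A: "subfield_set A" and h: "hom_on A h" and x: "x \<in> A"
  shows "h (inverse x) = inverse (h x)" "h x = 0 \<longleftrightarrow> x = 0"
proof -
  note s = subfield_setD(1)[OF A]
  have *: "h x * h (inverse x) = 1" if "x \<noteq> 0"
    using hom_on_mult[OF s h x subfield_setD(2)[OF A x]] hom_on_1[OF s h] that by simp
  then show "h (inverse x) = inverse (h x)"
    by (cases "x = 0") (auto simp: hom_on_0[OF s h] inverse_unique)
  show "h x = 0 \<longleftrightarrow> x = 0" using * hom_on_0[OF s h] by (cases "x = 0") auto
qed

lemma field_hom_divide:
  fixes h :: "'a::field \<Rightarrow> 'b::field"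
  assumes A: "subfield_set A" and h: "hom_on A h" and x: "x \<in> A" "y \<in> A"
  shows "h (x / y) = h x / h y"
  using hom_on_mult[OF subfield_setD(1)[OF A] h x(1) subfield_setD(2)[OF A x(2)]] field_hom_inverse[OF A h x(2)]
  by (simp add: divide_inverse)

lemma subfield_set_UNIV [simp]: "subfield_set UNIV" by (simp add: subfield_set_def)

definition rvar :: "nat \<Rightarrow> 'a::idom ratfun" where "rvar i = Fract (poly_var i) 1"

abbreviation ratfun_of_poly :: "(nat, 'a::idom) mpoly \<Rightarrow> 'a ratfun" where
  "ratfun_of_poly \<equiv> poly_eval ratfun_const rvar"

lemma Fract_1_hom: "ring_hom_total (\<lambda>p. Fract p 1)"
  by (simp add: hom_on_def One_fract_def)

lemma ratfun_of_poly: "ratfun_of_poly p = Fract p 1"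
  using hom_eq_poly_eval[OF Fract_1_hom, of p] by (simp add: ratfun_const_def[abs_def] rvar_def[abs_def])

lemma Fract_eq_ratfun_of_poly: "Fract p q = ratfun_of_poly p / ratfun_of_poly q"
  by (simp add: ratfun_of_poly)

lemma ratfun_of_poly_eq_0_iff: "ratfun_of_poly p = 0 \<longleftrightarrow> p = 0"
  by (simp add: ratfun_of_poly Zero_fract_def eq_fract)

lemma ratfun_const_hom: "ring_hom_total (ratfun_const :: 'a::idom \<Rightarrow> _)"
  using hom_on_comp[OF poly_const_hom subset_UNIV Fract_1_hom] by (simp add: ratfun_const_def[abs_def])

lemma ratfun_const_eq_iff [simp]: "ratfun_const x = ratfun_const y \<longleftrightarrow> x = y"
  by (simp add: ratfun_const_def eq_fract)

lemma ratfun_const_simps [simp]: "ratfun_const 0 = 0" "ratfun_const 1 = 1"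
  by (simp_all add: ratfun_const_def Zero_fract_def One_fract_def)

lemma rvar_nonzero: "rvar i \<noteq> (0 :: 'a::idom ratfun)"
proof -
  have "poly_var i \<noteq> (0 :: (nat, 'a) mpoly)"
    by (metis lookup_single_eq lookup_zero poly_var_def zero_neq_one)
  then show ?thesis by (simp add: rvar_def Zero_fract_def eq_fract)
qed

lemma ratfunsE:
  assumes "f \<in> ratfuns K r"
  obtains p q where "p \<in> polys K {..<r}" "q \<in> polys K {..<r}" "q \<noteq> 0" "f = Fract p q"
    "f = ratfun_of_poly p / ratfun_of_poly q"
  using assms by (auto simp: ratfuns_def Fract_eq_ratfun_of_poly)

lemma ratfunsI: "p \<in> polys K {..<r} \<Longrightarrow> q \<in> polys K {..<r} \<Longrightarrow> q \<noteq> 0 \<Longrightarrow> Fract p q \<in> ratfuns K r"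
  by (auto simp: ratfuns_def)

lemma ratfuns_subfield:
  assumes K: "subring_set K"
  shows "subfield_set (ratfuns K r)"
proof -
  note P = subring_setD[OF polys_subring[OF K]]
  have "1 \<in> ratfuns K r" unfolding One_fract_def by (intro ratfunsI P) auto
  moreover have "x - y \<in> ratfuns K r \<and> x * y \<in> ratfuns K r" if "x \<in> ratfuns K r" "y \<in> ratfuns K r" for x y
  proof -
    obtain p q p' q' where "p \<in> polys K {..<r}" "q \<in> polys K {..<r}" "q \<noteq> 0" "x = Fract p q"
      "p' \<in> polys K {..<r}" "q' \<in> polys K {..<r}" "q' \<noteq> 0" "y = Fract p' q'"
      using \<open>x \<in> _\<close> \<open>y \<in> _\<close> by (metis ratfunsE)
    then show ?thesis by (auto intro!: ratfunsI P)
  qed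
  moreover have "inverse x \<in> ratfuns K r" if "x \<in> ratfuns K r" for x
  proof -
    obtain p q where pq: "p \<in> polys K {..<r}" "q \<in> polys K {..<r}" "q \<noteq> 0" "x = Fract p q"
      using \<open>x \<in> _\<close> by (rule ratfunsE)
    show ?thesis
    proof (cases "p = 0")
      case True
      then have "inverse x = Fract 0 1" using pq by (simp add: Zero_fract_def[symmetric] fract_collapse)
      then show ?thesis by (metis P(1,2) ratfunsI zero_neq_one)
    qed (use pq in \<open>auto intro!: ratfunsI\<close>)
  qed
  ultimately show ?thesis by (simp add: subfield_set_def subring_set_def)
qed

lemma ratfun_const_in_ratfuns: "1 \<in> K \<Longrightarrow> c \<in> K \<Longrightarrow> ratfun_const c \<in> ratfuns K r"
  unfolding ratfun_const_def
  by (intro ratfunsI polys_const) (auto simp flip: poly_const_simps(2) intro!: polys_const)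

lemma rvar_in_ratfuns: "1 \<in> K \<Longrightarrow> i < r \<Longrightarrow> rvar i \<in> ratfuns K r"
  unfolding rvar_def
  by (intro ratfunsI polys_var) (auto simp flip: poly_const_simps(2) intro!: polys_const)

lemma fract_map_hom:
  assumes "ring_hom_total \<phi>" "inj \<phi>"
  shows "ring_hom_total (fract_map \<phi> :: 'a::idom fract \<Rightarrow> _)" "q \<noteq> 0 \<Longrightarrow> fract_map \<phi> (Fract p q) = Fract (\<phi> p) (\<phi> q)"
proof -
  note h = phi_simps[OF assms(1)]
  have F: "fract_map \<phi> (Fract p q) = Fract (\<phi> p) (\<phi> q)" if "q \<noteq> 0" for p q
    by (rule fract_map_Fract) (use h assms that in auto)
  then show "q \<noteq> 0 \<Longrightarrow> fract_map \<phi> (Fract p q) = Fract (\<phi> p) (\<phi> q)" .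
  have nz: "\<phi> q \<noteq> 0" if "q \<noteq> 0" for q using that h(1) assms(2) by (metis injD)
  have "fract_map \<phi> (x + y) = fract_map \<phi> x + fract_map \<phi> y \<and> fract_map \<phi> (x * y) = fract_map \<phi> x * fract_map \<phi> y"
    for x y
  proof -
    obtain a b c d where "x = Fract a b" "b \<noteq> 0" "y = Fract c d" "d \<noteq> 0" by (cases x, cases y) auto
    then show ?thesis using nz by (simp add: F h)
  qed
  moreover have "fract_map \<phi> 1 = 1" by (simp add: One_fract_def F h)
  ultimately show "ring_hom_total (fract_map \<phi> :: 'a::idom fract \<Rightarrow> _)" by (simp add: hom_on_def)
qed

lemma subst_inj:
  fixes s :: "'i \<Rightarrow> ('i, 'a::comm_ring_1) mpoly"
  assumes "\<And>i. poly_eval poly_const t (s i) = poly_var i"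
  shows "inj (poly_eval poly_const s)"
proof (rule inj_on_inverseI[of _ "poly_eval poly_const t"])
  fix p :: "('i, 'a) mpoly"
  have "poly_eval poly_const t (poly_eval poly_const s p) = poly_eval poly_const poly_var p"
    by (simp add: hom_poly_eval[OF poly_eval_hom[OF poly_const_hom]] poly_eval_const assms)
  then show "poly_eval poly_const t (poly_eval poly_const s p) = p" by (simp add: poly_eval_id)
qed

lemma fract_map_poly_eval_const:
  assumes "inj (poly_eval \<phi> s :: (nat, 'a::idom) mpoly \<Rightarrow> _)" and phi: "ring_hom_total \<phi>"
  shows "fract_map (poly_eval \<phi> s) (ratfun_const c) = Fract (\<phi> c) 1"
    "fract_map (poly_eval \<phi> s) (rvar i) = ratfun_of_poly (s i)"
  using fract_map_hom(2)[OF poly_eval_hom[OF phi] assms(1)] total_hom_1[OF poly_eval_hom[OF phi, of s]]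
  by (simp_all add: ratfun_const_def rvar_def poly_eval_const[OF phi] poly_eval_var[OF phi] ratfun_of_poly)

lemma ratfun_hom_eqI:
  fixes g h :: "'a::idom ratfun \<Rightarrow> 'b::field"
  assumes g: "ring_hom_total g" and h: "ring_hom_total h" and f: "f \<in> ratfuns UNIV r"
    and c: "\<And>c. g (ratfun_const c) = h (ratfun_const c)" and v: "\<And>i. i < r \<Longrightarrow> g (rvar i) = h (rvar i)"
  shows "g f = h f"
proof -
  obtain p q where pq: "p \<in> polys UNIV {..<r}" "q \<in> polys UNIV {..<r}" "f = ratfun_of_poly p / ratfun_of_poly q"
    using f by (rule ratfunsE)
  have "g (ratfun_of_poly p) = h (ratfun_of_poly p)" if "p \<in> polys UNIV {..<r}" for p
    unfolding hom_poly_eval[OF g] hom_poly_eval[OF h] using that by (rule poly_eval_cong_polys) (auto simp: c v)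
  then show ?thesis using pq
    by (simp add: field_hom_divide[OF subfield_set_UNIV g] field_hom_divide[OF subfield_set_UNIV h])
qed

lemma hom_ratfuns_mem:
  fixes h :: "'a::idom ratfun \<Rightarrow> 'b::field"
  assumes h: "ring_hom_total h" and f: "f \<in> ratfuns UNIV r" and B: "subfield_set B"
    and c: "\<And>c. h (ratfun_const c) \<in> B" and v: "\<And>i. i < r \<Longrightarrow> h (rvar i) \<in> B"
  shows "h f \<in> B"
proof -
  obtain p q where pq: "p \<in> polys UNIV {..<r}" "q \<in> polys UNIV {..<r}" "f = ratfun_of_poly p / ratfun_of_poly q"
    using f by (rule ratfunsE)
  have "h (ratfun_of_poly p) \<in> B" if "p \<in> polys UNIV {..<r}" for p
    unfolding hom_poly_eval[OF h]
    by (rule poly_eval_polys_in_subring[OF subfield_setD(1)[OF B] that]) (auto simp: c v)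
  then show ?thesis using pq
    by (auto simp: field_hom_divide[OF subfield_set_UNIV h] intro!: subfield_setD(3)[OF B])
qed

lemma Poly_Mapping_map_eq_poly_eval:
  assumes "h 0 = 0"
  shows "Poly_Mapping.map h p = poly_eval (\<lambda>c. poly_const (h c)) poly_var (p :: ('i, 'a::comm_ring_1) mpoly)"
proof -
  have "poly_eval (\<lambda>c. poly_const (h c)) poly_var p
      = (\<Sum>m\<in>Poly_Mapping.keys p. Poly_Mapping.single m (h (Poly_Mapping.lookup p m)))"
    by (simp add: poly_eval_mono mono_eval_var)
  moreover have "Poly_Mapping.lookup \<dots> k = h (Poly_Mapping.lookup p k)" for k
  proof -
    have "Poly_Mapping.lookup (\<Sum>m\<in>Poly_Mapping.keys p. Poly_Mapping.single m (h (Poly_Mapping.lookup p m))) k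
        = (\<Sum>m\<in>Poly_Mapping.keys p. if m = k then h (Poly_Mapping.lookup p k) else 0)"
      unfolding lookup_sum by (intro sum.cong refl) (auto simp: lookup_single when_def)
    then show ?thesis using assms by (auto simp: in_keys_iff)
  qed
  ultimately show ?thesis
    by (intro poly_mapping_eqI) (simp add: Poly_Mapping.map.rep_eq when_def assms)
qed

lemma lookup_map_coeffs: "h 0 = 0 \<Longrightarrow> Poly_Mapping.lookup (Poly_Mapping.map h p) m = h (Poly_Mapping.lookup p m)"
  by (simp add: Poly_Mapping.map.rep_eq when_def)

lemma poly_eval_map_coeffs:
  assumes "\<phi> 0 = 0" "h 0 = 0"
  shows "poly_eval \<phi> x (Poly_Mapping.map h p) = poly_eval (\<lambda>c. \<phi> (h c)) x (p :: ('i, 'a::comm_ring_1) mpoly)"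
proof -
  have "Poly_Mapping.keys (Poly_Mapping.map h p) \<subseteq> Poly_Mapping.keys p"
    using assms(2) by (auto simp: in_keys_iff lookup_map_coeffs[of h])
  then show ?thesis
    unfolding poly_eval_mono using assms
    by (intro sum.mono_neutral_cong_left) (auto simp: in_keys_iff lookup_map_coeffs[of h])
qed

text \<open>Scaling the extra variables fixes \<open>K(x\<^sub>0, \<dots>, x\<^bsub>v-1\<^esub>)\<close>, hence their independence over this field.\<close>

lemma rvar_independent:
  fixes p :: "(nat, 'a::field_char_0 ratfun) mpoly"
  assumes "p \<in> polys (ratfuns UNIV v) {..<w}" and "poly_eval (\<lambda>c. c) (\<lambda>i. rvar (v + i)) p = 0"
  shows "p = 0"
proof (rule scaling_stable_imp_zero[of "{p \<in> polys (ratfuns UNIV v) {..<w}. poly_eval (\<lambda>c. c) (\<lambda>i. rvar (v + i)) p = 0}"])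
  let ?F = "ratfuns UNIV v :: 'a ratfun set"
  let ?y = "\<lambda>i. rvar (v + i) :: 'a ratfun"
  note F = subfield_setD(1)[OF ratfuns_subfield[OF subring_set_UNIV, of v]]
  show "p \<in> {p \<in> polys ?F {..<w}. poly_eval (\<lambda>c. c) ?y p = 0}" using assms by simp
  fix p i a
  assume p: "p \<in> {p \<in> polys ?F {..<w}. poly_eval (\<lambda>c. c) ?y p = 0}"
  define s where "s k j = (if j = v + i then poly_const k * poly_var j else poly_var j)" for k :: 'a and j
  have inj: "inj (poly_eval poly_const (s 2))"
    by (rule subst_inj[of "s (inverse 2)"])
      (auto simp: s_def poly_eval_var poly_eval_mult poly_eval_const mult.assoc[symmetric]
        simp flip: total_hom_mult[OF poly_const_hom])
  define \<mu> where "\<mu> = fract_map (poly_eval poly_const (s 2))"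
  have hom: "ring_hom_total \<mu>" unfolding \<mu>_def by (intro fract_map_hom poly_eval_hom inj) simp
  have muc: "\<mu> (ratfun_const c) = ratfun_const c" for c
    unfolding \<mu>_def by (subst fract_map_poly_eval_const[OF inj]) (auto simp: ratfun_const_def)
  have c2: "ratfun_const 2 = (2 :: 'a ratfun)" using hom_on_numeral[OF ratfun_const_hom] by blast
  have muv: "\<mu> (rvar j) = (if j = v + i then 2 * rvar j else rvar j)" for j
    unfolding \<mu>_def by (subst fract_map_poly_eval_const[OF inj])
      (auto simp: s_def poly_eval_var[OF ratfun_const_hom] poly_eval_mult[OF ratfun_const_hom]
        poly_eval_const[OF ratfun_const_hom] c2)
  have mu_fix: "\<mu> f = f" if "f \<in> ?F" for f
    by (rule ratfun_hom_eqI[OF hom hom_on_id that]) (auto simp: muc muv)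
  have "0 = \<mu> (poly_eval (\<lambda>c. c) ?y p)" using p total_hom_0[OF hom] by simp
  also have "\<dots> = poly_eval (\<lambda>c. c) (?y(i := 2 * ?y i)) p"
    unfolding hom_poly_eval[OF hom] using p by (intro poly_eval_cong_polys[of p]) (auto simp: mu_fix muv)
  finally have "poly_eval (\<lambda>c. c) ?y (scale_diff i a p) = 0"
    using p by (simp add: poly_eval_scale_diff)
  moreover have two: "(2::'a ratfun) \<in> ?F"
    using ratfun_const_in_ratfuns[of UNIV "2::'a" v] by (simp add: c2)
  have "scale_diff i a p \<in> polys ?F {..<w}"
    unfolding polys_def using p keys_scale_diff[of i a p]
    by (auto simp: lookup_scale_diff intro!: subring_setD[OF F] two dest: polysD)
  ultimately show "scale_diff i a p \<in> {p \<in> polys ?F {..<w}. poly_eval (\<lambda>c. c) ?y p = 0}" by simp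
next
  fix p m
  assume p: "p \<in> {p \<in> polys (ratfuns UNIV v) {..<w}. poly_eval (\<lambda>c. c) (\<lambda>i. rvar (v + i)) p = (0 :: 'a ratfun)}"
  show "Poly_Mapping.keys p \<noteq> {m}"
  proof
    assume k: "Poly_Mapping.keys p = {m}"
    then have "Poly_Mapping.lookup p m * (\<Prod>i\<in>Poly_Mapping.keys m. rvar (v + i) ^ Poly_Mapping.lookup m i) = 0"
      using p by (simp add: poly_eval_def)
    then have "Poly_Mapping.lookup p m = 0" by (auto simp: rvar_nonzero)
    then show False using k by (metis in_keys_iff singletonI)
  qed
qed

section \<open>Invariants of a trivialised semilinear action\<close>

text \<open>Independence of a family rather than of a set: a family can be mapped along a homomorphism
  without changing its index set.\<close>

definition independent_over :: "'a::field set \<Rightarrow> 'i set \<Rightarrow> ('i \<Rightarrow> 'a) \<Rightarrow> bool" where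
  "independent_over F I x \<longleftrightarrow> (\<forall>p\<in>polys F I. poly_eval (\<lambda>c. c) x p = 0 \<longrightarrow> p = 0)"

definition rational_values :: "'a::field set \<Rightarrow> nat \<Rightarrow> (nat \<Rightarrow> 'a) \<Rightarrow> 'a set" where
  "rational_values F w x = {poly_eval (\<lambda>c. c) x p / poly_eval (\<lambda>c. c) x q | p q.
     p \<in> polys F {..<w} \<and> q \<in> polys F {..<w} \<and> poly_eval (\<lambda>c. c) x q \<noteq> 0}"

abbreviation value_at :: "('i \<Rightarrow> 'a::comm_ring_1) \<Rightarrow> ('i, 'a) mpoly \<Rightarrow> 'a" where
  "value_at \<equiv> poly_eval (\<lambda>c. c)"

lemma value_at_hom: "ring_hom_total (value_at x)"
  by (rule poly_eval_hom) simp

lemmas value_at_simps = poly_eval_const[OF hom_on_id] poly_eval_var[OF hom_on_id]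
  poly_eval_add[OF hom_on_id] poly_eval_mult[OF hom_on_id] poly_eval_sum[OF hom_on_id]
  total_hom_diff[OF value_at_hom] total_hom_0[OF value_at_hom]
  total_hom_1[OF value_at_hom]

lemma polys_lookup: "subring_set K \<Longrightarrow> p \<in> polys K I \<Longrightarrow> Poly_Mapping.lookup p m \<in> K"
  using polysD(1)[of p K I m] subring_setD(1)[of K] by (cases "m \<in> Poly_Mapping.keys p") (auto simp: in_keys_iff)

definition linear_form :: "nat \<Rightarrow> (nat \<Rightarrow> 'a) \<Rightarrow> (nat, 'a::comm_ring_1) mpoly" where
  "linear_form w c = (\<Sum>j<w. poly_const (c j) * poly_var j)"

lemma linear_form_polys: "subring_set F \<Longrightarrow> (\<And>j. j < w \<Longrightarrow> c j \<in> F) \<Longrightarrow> linear_form w c \<in> polys F {..<w}"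
  unfolding linear_form_def
  by (intro subring_set_sum[OF polys_subring] subring_setD(6)[OF polys_subring] polys_const polys_var)
    (auto simp: subring_setD)

lemma poly_eval_linear_form:
  "ring_hom_total \<phi> \<Longrightarrow> poly_eval \<phi> x (linear_form w c) = (\<Sum>j<w. \<phi> (c j) * x j)"
  by (simp add: linear_form_def poly_eval_sum poly_eval_mult poly_eval_const poly_eval_var)

lemma linear_form_delta:
  "i < w \<Longrightarrow> linear_form w (\<lambda>j. if i = j then 1 else 0) = poly_var i"
  unfolding linear_form_def by (subst sum.remove[of _ i]) (auto intro: sum.neutral)

lemma subst_linear_form:
  fixes c :: "nat \<Rightarrow> 'a::comm_ring_1"
  assumes "\<And>j. j < w \<Longrightarrow> s j = linear_form w (P j)"
  shows "poly_eval poly_const s (linear_form w c) = linear_form w (\<lambda>k. \<Sum>j<w. c j * P j k)"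
proof -
  note ch = total_hom_mult[OF poly_const_hom]
    total_hom_sum[OF poly_const_hom]
  have "poly_eval poly_const s (linear_form w c) = (\<Sum>j<w. \<Sum>k<w. poly_const (c j * P j k) * poly_var k)"
    unfolding poly_eval_linear_form[OF poly_const_hom]
    by (intro sum.cong refl) (simp add: assms linear_form_def sum_distrib_left ch mult.assoc)
  also have "\<dots> = linear_form w (\<lambda>k. \<Sum>j<w. c j * P j k)"
    unfolding linear_form_def by (subst sum.swap) (simp add: ch sum_distrib_right)
  finally show ?thesis .
qed

text \<open>The matrix \<open>Q\<close> turns the basis \<open>y\<close> of a semilinear representation into a basis \<open>z\<close> of
  invariant vectors. An invariant of \<open>F(z)\<close> is written as a fraction whose denominator has as few
  terms as possible, one of them with coefficient 1; conjugation changes neither numerator nor denominator.\<close>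

theorem no_name_field:
  fixes \<Theta> :: "('l::field \<Rightarrow> 'l) set" and F :: "'l set" and y z :: "nat \<Rightarrow> 'l"
    and Q P :: "nat \<Rightarrow> nat \<Rightarrow> 'l" and N :: "('l \<Rightarrow> 'l) \<Rightarrow> nat \<Rightarrow> nat \<Rightarrow> 'l"
  defines "E \<equiv> {f \<in> F. \<forall>\<theta>\<in>\<Theta>. \<theta> f = f}"
  assumes \<Theta>: "\<And>\<theta>. \<theta> \<in> \<Theta> \<Longrightarrow> ring_hom_total \<theta>" and \<Theta>F: "\<And>\<theta> f. \<theta> \<in> \<Theta> \<Longrightarrow> f \<in> F \<Longrightarrow> \<theta> f \<in> F"
    and F: "subfield_set F" and y: "independent_over F {..<w} y"
    and \<Theta>y: "\<And>\<theta> i. \<theta> \<in> \<Theta> \<Longrightarrow> i < w \<Longrightarrow> \<theta> (y i) = (\<Sum>j<w. N \<theta> i j * y j)"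
    and QF: "\<And>i j. Q i j \<in> F" and PF: "\<And>i j. P i j \<in> F"
    and PQ: "\<And>i k. i < w \<Longrightarrow> k < w \<Longrightarrow> (\<Sum>j<w. P i j * Q j k) = (if i = k then 1 else 0)"
    and QP: "\<And>i k. i < w \<Longrightarrow> k < w \<Longrightarrow> (\<Sum>j<w. Q i j * P j k) = (if i = k then 1 else 0)"
    and cov: "\<And>\<theta> i k. \<theta> \<in> \<Theta> \<Longrightarrow> i < w \<Longrightarrow> k < w \<Longrightarrow> (\<Sum>j<w. \<theta> (Q i j) * N \<theta> j k) = Q i k"
    and z: "\<And>i. z i = (\<Sum>j<w. Q i j * y j)"
  shows "independent_over F {..<w} z"
    and "{f \<in> rational_values F w y. \<forall>\<theta>\<in>\<Theta>. \<theta> f = f} = rational_values E w z"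
proof -
  note Fr = subfield_setD(1)[OF F]
  have \<Theta>z: "\<theta> (z i) = z i" if t: "\<theta> \<in> \<Theta>" and i: "i < w" for \<theta> i
  proof -
    note h = \<Theta>[OF t]
    have "\<theta> (z i) = (\<Sum>j<w. \<theta> (Q i j) * (\<Sum>k<w. N \<theta> j k * y k))"
      unfolding z by (simp add: total_hom_sum[OF h] total_hom_mult[OF h] \<Theta>y t)
    also have "\<dots> = (\<Sum>k<w. (\<Sum>j<w. \<theta> (Q i j) * N \<theta> j k) * y k)"
      unfolding sum_distrib_left sum_distrib_right by (subst sum.swap) (simp add: mult.assoc)
    also have "\<dots> = z i" unfolding z using cov t i by (intro sum.cong) auto
    finally show ?thesis .
  qed
  define sQ where "sQ i = linear_form w (Q i)" for i
  define sP where "sP i = linear_form w (P i)" for i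
  have sQF: "poly_eval poly_const sQ p \<in> polys F {..<w}" if "p \<in> polys F {..<w}" for p
    by (rule poly_eval_polys_in_subring[OF polys_subring[OF Fr] that])
      (auto simp: sQ_def QF intro: polys_const linear_form_polys[OF Fr])
  have sPF: "poly_eval poly_const sP p \<in> polys F {..<w}" if "p \<in> polys F {..<w}" for p
    by (rule poly_eval_polys_in_subring[OF polys_subring[OF Fr] that])
      (auto simp: sP_def PF intro: polys_const linear_form_polys[OF Fr])
  have evQ: "value_at y (poly_eval poly_const sQ p) = value_at z p" for p
    unfolding hom_poly_eval[OF value_at_hom]
    by (simp add: sQ_def poly_eval_linear_form value_at_simps z[abs_def])
  have evP: "value_at z (poly_eval poly_const sP p) = value_at y p" if "p \<in> polys F {..<w}" for p
    unfolding hom_poly_eval[OF value_at_hom]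
  proof (rule poly_eval_cong_polys[OF that])
    fix i assume "i \<in> {..<w}" then have i: "i < w" by simp
    have "value_at z (sP i) = (\<Sum>j<w. P i j * (\<Sum>k<w. Q j k * y k))"
      by (simp add: sP_def poly_eval_linear_form z)
    also have "\<dots> = (\<Sum>k<w. (\<Sum>j<w. P i j * Q j k) * y k)"
      unfolding sum_distrib_left sum_distrib_right by (subst sum.swap) (simp add: mult.assoc)
    also have "\<dots> = (\<Sum>k<w. if i = k then y k else 0)"
      using PQ i by (intro sum.cong) auto
    also have "\<dots> = y i" using i by simp
    finally show "value_at z (sP i) = y i" .
  qed (simp add: value_at_simps)
  have sPQ: "poly_eval poly_const sP (poly_eval poly_const sQ p) = p" if "p \<in> polys F {..<w}" for p
  proof -
    have "poly_eval poly_const sP (poly_eval poly_const sQ p) = poly_eval poly_const poly_var p"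
      unfolding hom_poly_eval[OF poly_eval_hom[OF poly_const_hom]]
    proof (rule poly_eval_cong_polys[OF that])
      fix i assume "i \<in> {..<w}" then have i: "i < w" by simp
      have "poly_eval poly_const sP (sQ i) = linear_form w (\<lambda>k. \<Sum>j<w. Q i j * P j k)"
        unfolding sQ_def by (rule subst_linear_form) (simp add: sP_def)
      also have "\<dots> = linear_form w (\<lambda>k. if i = k then 1 else 0)"
        unfolding linear_form_def using QP i by (intro sum.cong) auto
      finally show "poly_eval poly_const sP (sQ i) = poly_var i" using linear_form_delta[OF i] by simp
    qed (simp add: poly_eval_const)
    then show ?thesis by (simp add: poly_eval_id)
  qed
  show indep: "independent_over F {..<w} z"
    unfolding independent_over_def
  proof (intro ballI impI)
    fix p assume p: "p \<in> polys F {..<w}" "value_at z p = 0"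
    have "poly_eval poly_const sQ p = 0"
      using y sQF[OF p(1)] evQ[of p] p(2) by (simp add: independent_over_def)
    then show "p = 0" using sPQ[OF p(1)] by (simp add: poly_eval_0)
  qed
  show "{f \<in> rational_values F w y. \<forall>\<theta>\<in>\<Theta>. \<theta> f = f} = rational_values E w z"
  proof (intro antisym subsetI)
    fix f assume "f \<in> rational_values E w z"
    then obtain p q where pq: "p \<in> polys E {..<w}" "q \<in> polys E {..<w}" "value_at z q \<noteq> 0"
      "f = value_at z p / value_at z q" by (auto simp: rational_values_def)
    have inv: "\<theta> (value_at z p) = value_at z p" if "\<theta> \<in> \<Theta>" "p \<in> polys E {..<w}" for \<theta> p
      unfolding hom_poly_eval[OF \<Theta>[OF that(1)]] using that(2)
      by (rule poly_eval_cong_polys) (use that in \<open>auto simp: E_def \<Theta>z\<close>)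
    have EF: "polys E {..<w} \<subseteq> polys F {..<w}" by (intro polys_mono) (auto simp: E_def)
    have "f \<in> rational_values F w y"
      unfolding rational_values_def using pq EF
      by (intro CollectI exI[of _ "poly_eval poly_const sQ p"] exI[of _ "poly_eval poly_const sQ q"])
        (auto simp: evQ intro: sQF)
    moreover have "\<theta> f = f" if "\<theta> \<in> \<Theta>" for \<theta>
      using pq inv[OF that] field_hom_divide[OF subfield_set_UNIV \<Theta>[OF that]] by simp
    ultimately show "f \<in> {f \<in> rational_values F w y. \<forall>\<theta>\<in>\<Theta>. \<theta> f = f}" by simp
  next
    fix f assume "f \<in> {f \<in> rational_values F w y. \<forall>\<theta>\<in>\<Theta>. \<theta> f = f}"
    then have f: "f \<in> rational_values F w y" and inv: "\<And>\<theta>. \<theta> \<in> \<Theta> \<Longrightarrow> \<theta> f = f" by auto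
    define D where "D q \<longleftrightarrow> q \<in> polys F {..<w} \<and> value_at z q \<noteq> 0 \<and>
      (\<exists>p\<in>polys F {..<w}. value_at z p = f * value_at z q)" for q
    obtain p1 q1 where "p1 \<in> polys F {..<w}" "q1 \<in> polys F {..<w}" "value_at y q1 \<noteq> 0"
      "f = value_at y p1 / value_at y q1" using f by (auto simp: rational_values_def)
    then have "D (poly_eval poly_const sP q1)"
      unfolding D_def by (intro conjI bexI[of _ "poly_eval poly_const sP p1"]) (auto simp: evP intro: sPF)
    then obtain q2 where q2: "D q2" and min: "\<And>q. D q \<Longrightarrow> card (Poly_Mapping.keys q2) \<le> card (Poly_Mapping.keys q)"
      using exists_least_iff[of "\<lambda>n. \<exists>q. D q \<and> card (Poly_Mapping.keys q) = n"] by (metis not_le)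
    have "q2 \<noteq> 0" using q2 by (auto simp: D_def value_at_simps)
    then obtain m where m: "m \<in> Poly_Mapping.keys q2" by (metis all_not_in_conv keys_eq_empty)
    define c where "c = inverse (Poly_Mapping.lookup q2 m)"
    have c: "c \<in> F" "c \<noteq> 0"
      using m q2 polysD(1)[of q2] by (auto simp: c_def D_def in_keys_iff intro!: subfield_setD(2)[OF F])
    define q where "q = poly_const c * q2"
    have lq: "Poly_Mapping.lookup q k = c * Poly_Mapping.lookup q2 k" for k
      unfolding q_def poly_const_def by (metis Poly_Mapping.map.rep_eq lookup_map_coeffs mult_map_scale_conv_mult mult_zero_right)
    have kq: "Poly_Mapping.keys q = Poly_Mapping.keys q2" using c by (auto simp: in_keys_iff lq)
    have lm: "Poly_Mapping.lookup q m = 1" using m by (simp add: lq c_def in_keys_iff)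
    have cP: "poly_const c * r \<in> polys F {..<w}" if "r \<in> polys F {..<w}" for r
      by (intro subring_setD(6)[OF polys_subring[OF Fr]] polys_const c that)
    obtain p2 where "p2 \<in> polys F {..<w}" "value_at z p2 = f * value_at z q2" using q2 by (auto simp: D_def)
    then obtain p where p: "p \<in> polys F {..<w}" "value_at z p = f * value_at z q"
      using cP[of p2] by (auto simp: q_def value_at_simps intro!: that[of "poly_const c * p2"])
    have qF: "q \<in> polys F {..<w}" and qz: "value_at z q \<noteq> 0"
      using q2 cP c by (auto simp: q_def D_def value_at_simps)
    have fixed: "Poly_Mapping.map \<theta> q = q \<and> Poly_Mapping.map \<theta> p = p" if t: "\<theta> \<in> \<Theta>" for \<theta>
    proof -
      note h = \<Theta>[OF t]
      have 0: "\<theta> 0 = 0" by (rule total_hom_0[OF h])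
      have mapF: "Poly_Mapping.map \<theta> r \<in> polys F {..<w}" if "r \<in> polys F {..<w}" for r
      proof -
        have "\<theta> (Poly_Mapping.lookup r m) \<in> F" for m by (rule \<Theta>F[OF t polys_lookup[OF Fr that]])
        moreover have "Poly_Mapping.keys m \<subseteq> {..<w}" if "m \<in> Poly_Mapping.keys (Poly_Mapping.map \<theta> r)" for m
        proof -
          have "m \<in> Poly_Mapping.keys r"
            using that lookup_map_coeffs[of \<theta> r m, OF 0] 0 by (metis in_keys_iff)
          then show ?thesis using polysD(2)[OF \<open>r \<in> _\<close>] by blast
        qed
        ultimately show ?thesis by (simp add: polys_def lookup_map_coeffs[of \<theta>, OF 0])
      qed
      have evm: "value_at z (Poly_Mapping.map \<theta> r) = \<theta> (value_at z r)" if "r \<in> polys F {..<w}" for r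
        unfolding poly_eval_map_coeffs[of "\<lambda>c. c" \<theta>, OF refl 0] hom_poly_eval[OF h]
        by (rule poly_eval_cong_polys[OF that]) (auto simp: \<Theta>z t)
      let ?q = "Poly_Mapping.map \<theta> q - q" and ?p = "Poly_Mapping.map \<theta> p - p"
      have qp: "?q \<in> polys F {..<w}" "?p \<in> polys F {..<w}"
        by (intro subring_setD(5)[OF polys_subring[OF Fr]] mapF qF p)+
      have rel: "value_at z ?p = f * value_at z ?q"
      proof -
        have "\<theta> (f * value_at z q) = f * \<theta> (value_at z q)"
          using total_hom_mult[OF h, of f "value_at z q"] inv[OF t] by simp
        then show ?thesis
          by (simp only: value_at_simps evm p qF right_diff_distrib)
      qed
      have "value_at z ?q = 0"
      proof (rule ccontr)
        assume "value_at z ?q \<noteq> 0"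
        then have "D ?q" using qp rel by (auto simp: D_def)
        then have "card (Poly_Mapping.keys q2) \<le> card (Poly_Mapping.keys ?q)" by (rule min)
        moreover have "Poly_Mapping.keys ?q \<subseteq> Poly_Mapping.keys q"
          by (auto simp: in_keys_iff lookup_minus lookup_map_coeffs[of \<theta>, OF 0] 0)
        moreover have "m \<notin> Poly_Mapping.keys ?q"
          using total_hom_1[OF h] by (simp add: in_keys_iff lookup_minus lookup_map_coeffs[of \<theta>, OF 0] lm)
        ultimately show False using m kq
          by (metis card_seteq finite_keys)
      qed
      then have "?q = 0" "?p = 0" using indep qp rel by (auto simp: independent_over_def)
      then show ?thesis by simp
    qed
    have inE: "r \<in> polys E {..<w}" if "r \<in> polys F {..<w}" "\<And>\<theta>. \<theta> \<in> \<Theta> \<Longrightarrow> Poly_Mapping.map \<theta> r = r" for r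
    proof -
      have "\<theta> (Poly_Mapping.lookup r k) = Poly_Mapping.lookup r k" if "\<theta> \<in> \<Theta>" for \<theta> k
        using lookup_map_coeffs[of \<theta> r k] total_hom_0[OF \<Theta>[OF that]] \<open>\<And>\<theta>. \<theta> \<in> \<Theta> \<Longrightarrow> Poly_Mapping.map \<theta> r = r\<close>[OF that] by simp
      then show ?thesis using that(1) by (auto simp: polys_def E_def)
    qed
    have "f = value_at z p / value_at z q" using p qz by simp
    then show "f \<in> rational_values E w z"
      unfolding rational_values_def using inE[OF p(1)] inE[OF qF] fixed qz by blast
  qed
qed

lemma ring_iso_subring_of:
  "h \<in> ring_iso (subring_of A) (subring_of B) \<longleftrightarrow> hom_on A h \<and> bij_betw h A B"
  by (auto simp: ring_iso_def Ring.ring_hom_def subring_of_def ring_of_type_algebra_def hom_on_def bij_betw_def)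

lemma ratfuns_iso_rational_values:
  fixes E :: "'l::field set"
  assumes E: "subfield_set E" and z: "independent_over E {..<w} z"
  shows "\<exists>\<Phi>\<in>ring_iso (subring_of (ratfuns E w)) (subring_of (rational_values E w z)).
    \<forall>c\<in>E. \<Phi> (ratfun_const c) = c"
proof -
  note Er = subfield_setD(1)[OF E]
  note P = subring_setD[OF polys_subring[OF Er]]
  have nz: "value_at z q \<noteq> 0" if "q \<in> polys E {..<w}" "q \<noteq> 0" for q
    using z that by (auto simp: independent_over_def)
  define R where "R f x \<longleftrightarrow> (\<exists>p q. p \<in> polys E {..<w} \<and> q \<in> polys E {..<w} \<and> q \<noteq> 0 \<and> f = Fract p q \<and>
    x = value_at z p / value_at z q)" for f x
  have cross: "value_at z p / value_at z q = value_at z p' / value_at z q' \<longleftrightarrow> Fract p q = Fract p' q'"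
    if "p \<in> polys E {..<w}" "q \<in> polys E {..<w}" "q \<noteq> 0" "p' \<in> polys E {..<w}" "q' \<in> polys E {..<w}" "q' \<noteq> 0"
    for p q p' q'
  proof -
    have "value_at z p / value_at z q = value_at z p' / value_at z q' \<longleftrightarrow> value_at z (p * q' - p' * q) = 0"
      using nz that by (simp add: value_at_simps frac_eq_eq)
    also have "\<dots> \<longleftrightarrow> p * q' - p' * q = 0"
      using nz[of "p * q' - p' * q"] P(5)[OF P(6)[OF that(1,5)] P(6)[OF that(4,2)]]
        total_hom_0[OF value_at_hom] by metis
    finally show ?thesis using that by (simp add: eq_fract)
  qed
  have uniq: "x = x'" if "R f x" "R f x'" for f x x' using that cross unfolding R_def by metis
  define \<Phi> where "\<Phi> f = (THE x. R f x)" for f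
  have \<Phi>: "\<Phi> (Fract p q) = value_at z p / value_at z q"
    if "p \<in> polys E {..<w}" "q \<in> polys E {..<w}" "q \<noteq> 0" for p q
  proof -
    have r: "R (Fract p q) (value_at z p / value_at z q)" unfolding R_def using that by blast
    show ?thesis unfolding \<Phi>_def by (rule the_equality) (rule r, rule uniq[OF _ r])
  qed
  have "hom_on (ratfuns E w) \<Phi>"
    unfolding hom_on_def
  proof (intro conjI ballI)
    show "\<Phi> 1 = 1" using \<Phi>[OF P(2) P(2)] by (simp add: One_fract_def value_at_simps)
    fix x y assume "x \<in> ratfuns E w" "y \<in> ratfuns E w"
    then obtain p q p' q' where x: "p \<in> polys E {..<w}" "q \<in> polys E {..<w}" "q \<noteq> 0" "x = Fract p q"
      and y: "p' \<in> polys E {..<w}" "q' \<in> polys E {..<w}" "q' \<noteq> 0" "y = Fract p' q'"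
      by (auto simp: ratfuns_def)
    note v = nz[OF x(2,3)] nz[OF y(2,3)]
    have "x + y = Fract (p * q' + p' * q) (q * q')" "x * y = Fract (p * p') (q * q')" using x y by simp_all
    moreover have "q * q' \<noteq> 0" using x(3) y(3) by simp
    moreover have "p * q' + p' * q \<in> polys E {..<w}" "q * q' \<in> polys E {..<w}" "p * p' \<in> polys E {..<w}"
      by (intro P x y)+
    ultimately have "\<Phi> (x + y) = value_at z (p * q' + p' * q) / value_at z (q * q')"
      "\<Phi> (x * y) = value_at z (p * p') / value_at z (q * q')"
      by (simp_all add: \<Phi>)
    moreover have "\<Phi> x = value_at z p / value_at z q" "\<Phi> y = value_at z p' / value_at z q'"
      using x y by (simp_all add: \<Phi>)
    ultimately show "\<Phi> (x + y) = \<Phi> x + \<Phi> y" "\<Phi> (x * y) = \<Phi> x * \<Phi> y"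
      using v by (simp_all add: value_at_simps add_frac_eq)
  qed
  moreover have "bij_betw \<Phi> (ratfuns E w) (rational_values E w z)"
    unfolding bij_betw_def
  proof
    show "inj_on \<Phi> (ratfuns E w)"
    proof (rule inj_onI)
      fix f g assume fg: "f \<in> ratfuns E w" "g \<in> ratfuns E w" "\<Phi> f = \<Phi> g"
      obtain p q where f: "p \<in> polys E {..<w}" "q \<in> polys E {..<w}" "q \<noteq> 0" "f = Fract p q"
        using fg(1) by (auto simp: ratfuns_def)
      obtain p' q' where g: "p' \<in> polys E {..<w}" "q' \<in> polys E {..<w}" "q' \<noteq> 0" "g = Fract p' q'"
        using fg(2) by (auto simp: ratfuns_def)
      show "f = g" using fg(3) cross[OF f(1-3) g(1-3)] by (simp add: f g \<Phi>)
    qed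
    show "\<Phi> ` ratfuns E w = rational_values E w z"
    proof (intro antisym subsetI)
      fix x assume "x \<in> \<Phi> ` ratfuns E w"
      then obtain p q where "p \<in> polys E {..<w}" "q \<in> polys E {..<w}" "q \<noteq> 0" "x = \<Phi> (Fract p q)"
        by (auto simp: ratfuns_def)
      then show "x \<in> rational_values E w z" using nz \<Phi> unfolding rational_values_def by blast
    next
      fix x assume "x \<in> rational_values E w z"
      then obtain p q where x: "p \<in> polys E {..<w}" "q \<in> polys E {..<w}" "value_at z q \<noteq> 0"
        "x = value_at z p / value_at z q" by (auto simp: rational_values_def)
      then have "q \<noteq> 0" by (auto simp: value_at_simps)
      then show "x \<in> \<Phi> ` ratfuns E w" using x \<Phi> by (auto simp: image_iff intro!: bexI[of _ "Fract p q"] ratfunsI)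
    qed
  qed
  moreover have "\<Phi> (ratfun_const c) = c" if "c \<in> E" for c
    using \<Phi>[OF polys_const[OF that] P(2)] by (simp add: ratfun_const_def value_at_simps)
  ultimately show ?thesis
    by (intro bexI[of _ \<Phi>]) (auto simp: ring_iso_subring_of)
qed

section \<open>Pure extensions\<close>

abbreviation field_generated :: "'a::field set \<Rightarrow> 'a set" where
  "field_generated \<equiv> generate_field ring_of_type_algebra"

lemma type_algebra_ops:
  fixes x y :: "'a::field"
  shows "\<ominus>\<^bsub>ring_of_type_algebra\<^esub> x = - x" "x \<noteq> 0 \<Longrightarrow> inv\<^bsub>ring_of_type_algebra\<^esub> x = inverse x"
    "x \<oplus>\<^bsub>ring_of_type_algebra\<^esub> y = x + y" "x \<otimes>\<^bsub>ring_of_type_algebra\<^esub> y = x * y"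
    "\<zero>\<^bsub>ring_of_type_algebra\<^esub> = (0::'a)" "\<one>\<^bsub>ring_of_type_algebra\<^esub> = (1::'a)"
proof -
  interpret R: field "ring_of_type_algebra :: 'a ring" by (rule field_from_type_algebra)
  show *: "x \<oplus>\<^bsub>ring_of_type_algebra\<^esub> y = x + y" "x \<otimes>\<^bsub>ring_of_type_algebra\<^esub> y = x * y"
    "\<zero>\<^bsub>ring_of_type_algebra\<^esub> = (0::'a)" "\<one>\<^bsub>ring_of_type_algebra\<^esub> = (1::'a)" for x y :: 'a
    by (simp_all add: ring_of_type_algebra_def)
  have c: "carrier ring_of_type_algebra = (UNIV :: 'a set)" by (simp add: ring_of_type_algebra_def)
  show "\<ominus>\<^bsub>ring_of_type_algebra\<^esub> x = - x" by (rule R.minus_equality) (simp_all add: * c)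
  show "inv\<^bsub>ring_of_type_algebra\<^esub> x = inverse x" if "x \<noteq> 0"
    using that by (intro R.comm_inv_char) (simp_all add: * c)
qed

lemma field_generated_subfield: "subfield_set (field_generated H)"
proof -
  note g = generate_field.intros[where R = "ring_of_type_algebra :: 'a ring" and H = H, unfolded type_algebra_ops]
  have minus: "- x \<in> field_generated H" if "x \<in> field_generated H" for x using g(3)[OF that] .
  have add: "x + y \<in> field_generated H" if "x \<in> field_generated H" "y \<in> field_generated H" for x y
    using g(5)[OF that] .
  have "0 \<in> field_generated H" using add[OF g(1) minus[OF g(1)]] by simp
  moreover have "inverse x \<in> field_generated H" if "x \<in> field_generated H" "x \<noteq> 0" for x
    using generate_field.m_inv[OF that(1)] that by (simp add: type_algebra_ops)
  ultimately have "inverse x \<in> field_generated H" if "x \<in> field_generated H" for x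
    using that by (cases "x = 0") auto
  moreover have "x - y \<in> field_generated H" if "x \<in> field_generated H" "y \<in> field_generated H" for x y
    using add[OF that(1) minus[OF that(2)]] by simp
  ultimately show ?thesis using g(1) g(6) by (simp add: subfield_set_def subring_set_def)
qed

lemma field_generated_incl: "H \<subseteq> field_generated H"
  by (auto intro: generate_field.incl)

lemma field_generated_least:
  assumes "subfield_set F" "H \<subseteq> F"
  shows "field_generated H \<subseteq> F"
proof
  note F = subring_setD[OF subfield_setD(1)[OF assms(1)]] subfield_setD(2)[OF assms(1)]
  fix x assume "x \<in> field_generated H"
  then show "x \<in> F"
  proof induction
    case (m_inv h)
    then show ?case using F by (simp add: type_algebra_ops)
  qed (use assms F in \<open>auto simp: type_algebra_ops\<close>)
qed

lemma hom_image_field_generated: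
  fixes h :: "'a::field \<Rightarrow> 'b::field"
  assumes A: "subfield_set A" and h: "hom_on A h" and H: "H \<subseteq> A"
  shows "h ` field_generated H = field_generated (h ` H)"
proof
  note As = subfield_setD(1)[OF A]
  note G = field_generated_subfield
  note Gr = subring_setD[OF subfield_setD(1)[OF G]]
  let ?B = "{x \<in> A. h x \<in> field_generated (h ` H)}"
  have "subfield_set ?B"
    unfolding subfield_set_def subring_set_def
    by (auto simp: hom_on_diff[OF As h] hom_on_mult[OF As h] hom_on_1[OF As h] field_hom_inverse(1)[OF A h]
        intro: Gr subfield_setD(2)[OF G] subring_setD[OF As] subfield_setD(2)[OF A])
  then have "field_generated H \<subseteq> ?B"
    by (rule field_generated_least) (use H field_generated_incl[of "h ` H"] in auto)
  then show "h ` field_generated H \<subseteq> field_generated (h ` H)" by auto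
  have GA: "field_generated H \<subseteq> A" by (rule field_generated_least[OF A H])
  have "subfield_set (h ` field_generated H)"
    unfolding subfield_set_def subring_set_def
  proof (intro conjI ballI)
    show "1 \<in> h ` field_generated H" using hom_on_1[OF As h] Gr(2) by (metis image_eqI)
    fix x assume "x \<in> h ` field_generated H"
    then obtain a where a: "a \<in> field_generated H" "x = h a" by auto
    then show "inverse x \<in> h ` field_generated H"
      using field_hom_inverse(1)[OF A h, of a] GA subfield_setD(2)[OF G a(1)] by (metis image_eqI subsetD)
    fix y assume "y \<in> h ` field_generated H"
    then obtain b where b: "b \<in> field_generated H" "y = h b" by auto
    have ab: "a \<in> A" "b \<in> A" using a b GA by auto
    show "x - y \<in> h ` field_generated H" unfolding a b hom_on_diff[OF As h ab, symmetric]
      by (intro imageI Gr a b)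
    show "x * y \<in> h ` field_generated H" unfolding a b hom_on_mult[OF As h ab, symmetric]
      by (intro imageI Gr a b)
  qed
  then show "field_generated (h ` H) \<subseteq> h ` field_generated H"
    by (rule field_generated_least) (use field_generated_incl in auto)
qed

lemma independent_family_imp_set:
  assumes k: "subring_set k" and x: "independent_over k I x"
  shows "algebraically_independent k (x ` I)"
  unfolding algebraically_independent_def
proof (intro ballI impI)
  fix p assume p: "p \<in> polys k (x ` I)" "value_at (\<lambda>s. s) p = 0"
  let ?r = "inv_into I x"
  let ?p = "poly_eval poly_const (\<lambda>s. poly_var (?r s)) p"
  have "?p \<in> polys k I"
    by (rule poly_eval_polys_in_subring[OF polys_subring[OF k] p(1)])
      (auto intro!: polys_const polys_var subring_setD[OF k] inv_into_into)
  moreover have "value_at x ?p = value_at (\<lambda>s. s) p"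
    unfolding hom_poly_eval[OF value_at_hom]
    by (rule poly_eval_cong_polys[OF p(1)]) (auto simp: value_at_simps f_inv_into_f)
  ultimately have "?p = 0" using x p(2) by (auto simp: independent_over_def)
  moreover have "poly_eval poly_const (\<lambda>i. poly_var (x i)) ?p = poly_eval poly_const poly_var p"
    unfolding hom_poly_eval[OF poly_eval_hom[OF poly_const_hom]]
    by (rule poly_eval_cong_polys[OF p(1)]) (auto simp: poly_eval_const poly_eval_var f_inv_into_f)
  ultimately show "p = 0" by (simp add: poly_eval_id poly_eval_0)
qed

lemma independent_over_image:
  fixes h :: "'a::comm_ring_1 \<Rightarrow> 'b::field"
  assumes k: "subring_set k" and h: "hom_on k h" "inj_on h k"
    and ind: "\<And>p. p \<in> polys k I \<Longrightarrow> poly_eval h x p = 0 \<Longrightarrow> p = 0"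
  shows "independent_over (h ` k) I x"
  unfolding independent_over_def
proof (intro ballI impI)
  fix p assume p: "p \<in> polys (h ` k) I" "value_at x p = 0"
  define g where "g = inv_into k h"
  have h0: "h 0 = 0" by (rule hom_on_0[OF k h(1)])
  have g0: "g 0 = 0" using inv_into_f_f[OF h(2) subring_setD(1)[OF k]] h0 by (simp add: g_def)
  have gk: "g c \<in> k" "h (g c) = c" if "c \<in> h ` k" for c
    using that by (simp_all add: g_def inv_into_into f_inv_into_f)
  have "poly_eval h x (Poly_Mapping.map g p) = value_at x p"
    unfolding poly_eval_map_coeffs[of h g, OF h0 g0] by (rule poly_eval_cong_polys[OF p(1)]) (auto simp: gk)
  moreover have "Poly_Mapping.map g p \<in> polys k I"
  proof -
    have "m \<in> Poly_Mapping.keys p" if "m \<in> Poly_Mapping.keys (Poly_Mapping.map g p)" for m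
      using that g0 by (metis in_keys_iff lookup_map_coeffs[of g, OF g0])
    then show ?thesis using polysD[OF p(1)] gk by (auto simp: polys_def lookup_map_coeffs[of g, OF g0])
  qed
  ultimately have z: "Poly_Mapping.map g p = 0" using ind p(2) by simp
  show "p = 0"
  proof (rule poly_mapping_eqI)
    fix m
    have "g (Poly_Mapping.lookup p m) = 0" using z lookup_map_coeffs[of g p m, OF g0] by simp
    then show "Poly_Mapping.lookup p m = Poly_Mapping.lookup 0 m"
      using gk(2)[OF polys_lookup[OF hom_image_subring[OF k h(1) k order_refl] p(1)], of m] h0 by simp
  qed
qed

lemma pure_over_iso:
  fixes h :: "'a::field \<Rightarrow> 'b::field"
  assumes A: "subfield_set A" and k: "subring_set k" "k \<subseteq> A" and h: "hom_on A h" and bij: "bij_betw h A B"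
    and pure: "pure_over k A"
  shows "pure_over (h ` k) B"
proof -
  note As = subfield_setD(1)[OF A]
  obtain S where S: "S \<subseteq> A" "algebraically_independent k S" "A = field_generated (k \<union> S)"
    using pure by (auto simp: pure_over_def)
  have inj: "inj_on h A" and B: "B = h ` A" using bij by (auto simp: bij_betw_def)
  have hk: "subring_set (h ` k)" by (rule hom_image_subring[OF As h k])
  have "independent_over (h ` k) S h"
  proof (rule independent_over_image[OF k(1) hom_on_subset[OF h k(2)] inj_on_subset[OF inj k(2)]])
    fix p assume p: "p \<in> polys k S" "poly_eval h h p = 0"
    have "h (value_at (\<lambda>s. s) p) = 0"
      using hom_on_poly_eval_polys[OF As h p(1), of "\<lambda>c. c" "\<lambda>s. s"] k(2) S(1) p(2) by auto
    moreover have "value_at (\<lambda>s. s) p \<in> A"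
      using k(2) S(1) by (intro poly_eval_polys_in_subring[OF As p(1)]) auto
    ultimately have "value_at (\<lambda>s. s) p = 0" using field_hom_inverse(2)[OF A h] by blast
    then show "p = 0" using S(2) p(1) by (simp add: algebraically_independent_def)
  qed
  from independent_family_imp_set[OF hk this] have "algebraically_independent (h ` k) (h ` S)" .
  moreover have "B = field_generated (h ` k \<union> h ` S)"
    using hom_image_field_generated[OF A h, of "k \<union> S"] k(2) S(1) unfolding S(3)[symmetric] B image_Un by simp
  moreover have "h ` S \<subseteq> B" using S(1) B by auto
  ultimately show ?thesis unfolding pure_over_def by (intro exI[of _ "h ` S"] conjI)
qed

text \<open>A polynomial in the transcendence basis and the new variables is regrouped as a polynomial
  in the new variables whose coefficients \<open>q\<close> are polynomials in the basis. The new variables are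
  independent over \<open>E\<close>, so a relation makes the values of these coefficients vanish.\<close>

lemma pure_over_ratfuns:
  fixes E :: "'a::field set"
  assumes k: "subring_set k" and E: "subfield_set E" and pure: "pure_over k E"
  shows "pure_over (ratfun_const ` k) (ratfuns E r)"
proof -
  note Er = subfield_setD(1)[OF E]
  note RE = ratfuns_subfield[OF Er, of r]
  obtain S where S: "S \<subseteq> E" "algebraically_independent k S" "E = field_generated (k \<union> S)"
    using pure by (auto simp: pure_over_def)
  have kE: "k \<subseteq> E" unfolding S(3) using field_generated_incl by blast
  define I where "I = S <+> {..<r}"
  define x where "x = case_sum (ratfun_const :: 'a \<Rightarrow> _) rvar"
  have *: "p = 0" if p: "p \<in> polys k I" "poly_eval ratfun_const x p = 0" for p :: "('a + nat, 'a) mpoly"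
  proof -
    define q :: "(nat, ('a, 'a) mpoly) mpoly" where "q = poly_eval (\<lambda>c. poly_const (poly_const c))
      (case_sum (\<lambda>s. poly_const (poly_var s)) poly_var) p"
    have q: "q \<in> polys (polys k S) {..<r}"
      unfolding q_def
      by (rule poly_eval_polys_in_subring[OF polys_subring[OF polys_subring[OF k]] p(1)])
        (auto simp: I_def intro!: polys_const polys_var subring_setD[OF k] subring_setD(2)[OF polys_subring[OF k]])
    let ?v = "value_at (\<lambda>s::'a. s)"
    have v0: "?v 0 = 0" by (simp add: value_at_simps)
    have vh: "ring_hom_total (\<lambda>q. ratfun_const (?v q))"
      by (rule hom_on_comp[OF value_at_hom subset_UNIV ratfun_const_hom])
    have "poly_eval (\<lambda>q. ratfun_const (?v q)) rvar q = poly_eval ratfun_const x p"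
      unfolding q_def hom_poly_eval[OF poly_eval_hom[OF vh]]
      by (intro poly_eval_cong)
        (auto simp: x_def poly_eval_const[OF vh] poly_eval_var[OF vh] value_at_simps split: sum.splits)
    then have "ratfun_of_poly (Poly_Mapping.map ?v q) = 0"
      using p(2) by (simp add: poly_eval_map_coeffs[of ratfun_const ?v, OF ratfun_const_simps(1) v0])
    then have z: "Poly_Mapping.map ?v q = 0" by (simp add: ratfun_of_poly_eq_0_iff)
    have "q = 0"
    proof (rule poly_mapping_eqI)
      fix m
      have "?v (Poly_Mapping.lookup q m) = 0" using z lookup_map_coeffs[of ?v q m, OF v0] by simp
      then show "Poly_Mapping.lookup q m = Poly_Mapping.lookup 0 m"
        using S(2) polys_lookup[OF polys_subring[OF k] q, of m] by (simp add: algebraically_independent_def)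
    qed
    have h1: "ring_hom_total (poly_eval poly_const (\<lambda>s::'a. poly_var (Inl s :: 'a + nat)) :: ('a, 'a) mpoly \<Rightarrow> _)"
      by (rule poly_eval_hom[OF poly_const_hom])
    have "poly_eval (poly_eval poly_const (\<lambda>s. poly_var (Inl s))) (\<lambda>i. poly_var (Inr i)) q
        = poly_eval poly_const poly_var p"
      unfolding q_def hom_poly_eval[OF poly_eval_hom[OF h1]]
      by (intro poly_eval_cong)
        (auto simp: poly_eval_const[OF h1] poly_eval_var[OF h1] poly_eval_const poly_eval_var split: sum.splits)
    then show "p = 0" using \<open>q = 0\<close> by (simp add: poly_eval_id poly_eval_0[OF h1])
  qed
  have rk: "subring_set (ratfun_const ` k)"
    by (rule hom_image_subring[OF subring_set_UNIV ratfun_const_hom k subset_UNIV])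
  have "independent_over (ratfun_const ` k) I x"
    by (rule independent_over_image[OF k hom_on_subset[OF ratfun_const_hom subset_UNIV]]) (auto intro: * inj_onI)
  from independent_family_imp_set[OF rk this] have ind: "algebraically_independent (ratfun_const ` k) (x ` I)" .
  have xI: "x ` I = ratfun_const ` S \<union> rvar ` {..<r}" unfolding I_def Plus_def image_Un image_image by (simp add: x_def)
  have sub: "x ` I \<subseteq> ratfuns E r"
    unfolding xI using S(1) subring_setD(2)[OF Er] by (auto intro!: ratfun_const_in_ratfuns rvar_in_ratfuns)
  let ?B = "field_generated (ratfun_const ` k \<union> x ` I)"
  have "ratfuns E r = ?B"
  proof
    show "?B \<subseteq> ratfuns E r"
      by (rule field_generated_least[OF RE])
        (use sub kE subring_setD(2)[OF Er] in \<open>auto intro!: ratfun_const_in_ratfuns\<close>)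
    have "ratfun_const ` E = field_generated (ratfun_const ` (k \<union> S))"
      by (subst S(3)) (rule hom_image_field_generated[OF subfield_set_UNIV ratfun_const_hom subset_UNIV])
    also have "\<dots> \<subseteq> ?B"
      by (rule field_generated_least[OF field_generated_subfield])
        (use field_generated_incl[of "ratfun_const ` k \<union> x ` I"] in \<open>auto simp: xI\<close>)
    finally have EB: "ratfun_const c \<in> ?B" if "c \<in> E" for c using that by blast
    have vB: "rvar i \<in> ?B" if "i < r" for i
      using field_generated_incl[of "ratfun_const ` k \<union> x ` I"] that by (auto simp: xI)
    have pB: "ratfun_of_poly p \<in> ?B" if "p \<in> polys E {..<r}" for p
      by (rule poly_eval_polys_in_subring[OF subfield_setD(1)[OF field_generated_subfield] that]) (auto simp: EB vB)
    show "ratfuns E r \<subseteq> ?B"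
      by (auto elim!: ratfunsE intro!: subfield_setD(3)[OF field_generated_subfield] pB)
  qed
  then show ?thesis using ind sub unfolding pure_over_def by (intro exI[of _ "x ` I"] conjI)
qed

lemma stably_pure_over_iso:
  fixes E E' :: "'a::field set"
  assumes k: "subring_set k" "k \<subseteq> E" and E: "subfield_set E"
    and h: "h \<in> ring_iso (subring_of (ratfuns E r)) (subring_of (ratfuns E' s))"
    and hk: "\<forall>c\<in>k. h (ratfun_const c) = ratfun_const c" and pure: "pure_over k E"
  shows "stably_pure_over k E'"
proof -
  note Er = subfield_setD(1)[OF E]
  have P: "pure_over (ratfun_const ` k) (ratfuns E r)" by (rule pure_over_ratfuns[OF k(1) E pure])
  have sub: "ratfun_const ` k \<subseteq> ratfuns E r"
    using k(2) subring_setD(2)[OF Er] by (auto intro!: ratfun_const_in_ratfuns)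
  have rk: "subring_set (ratfun_const ` k)"
    by (rule hom_image_subring[OF subring_set_UNIV ratfun_const_hom k(1) subset_UNIV])
  have "pure_over (h ` ratfun_const ` k) (ratfuns E' s)"
    using h pure_over_iso[OF ratfuns_subfield[OF Er] rk sub _ _ P] by (auto simp: ring_iso_subring_of)
  moreover have "h ` ratfun_const ` k = ratfun_const ` k" using hk by (auto simp: image_iff)
  ultimately show ?thesis by (auto simp: stably_pure_over_def)
qed

section \<open>Covariant frames\<close>

lemma det_in_subring:
  assumes F: "subring_set F" and A: "A \<in> carrier_mat n n" and mem: "\<And>i j. i < n \<Longrightarrow> j < n \<Longrightarrow> A $$ (i, j) \<in> F"
  shows "det A \<in> F"
proof -
  have sg: "signof p \<in> F" for p :: "nat \<Rightarrow> nat"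
    using subring_setD(2,3)[OF F] by (auto simp: sign_def)
  show ?thesis unfolding det_def'[OF A]
    by (intro subring_set_sum[OF F] subring_setD(6)[OF F] subring_set_prod[OF F] mem sg)
      (auto dest: permutes_in_image)
qed

lemma hom_on_det:
  assumes F: "subring_set F" and h: "hom_on F h" and A: "A \<in> carrier_mat n n"
    and mem: "\<And>i j. i < n \<Longrightarrow> j < n \<Longrightarrow> A $$ (i, j) \<in> F"
  shows "h (det A) = det (map_mat h A)"
proof -
  have sg: "signof p \<in> F" "h (signof p) = signof p" for p :: "nat \<Rightarrow> nat"
    using subring_setD(2,3)[OF F] hom_on_uminus[OF F h, of 1] hom_on_1[OF F h] by (auto simp: sign_def)
  have A': "map_mat h A \<in> carrier_mat n n" using A by simp
  have pr: "(\<Prod>i = 0..<n. A $$ (i, p i)) \<in> F" "h (\<Prod>i = 0..<n. A $$ (i, p i)) = (\<Prod>i = 0..<n. map_mat h A $$ (i, p i))"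
    if p: "p permutes {0..<n}" for p
  proof -
    have m: "i < n \<Longrightarrow> p i < n" for i using p by (auto dest: permutes_in_image)
    show "(\<Prod>i = 0..<n. A $$ (i, p i)) \<in> F" by (intro subring_set_prod[OF F] mem) (auto simp: m)
    have "h (\<Prod>i = 0..<n. A $$ (i, p i)) = (\<Prod>i = 0..<n. h (A $$ (i, p i)))"
      by (intro hom_on_prod[OF F h] mem) (auto simp: m)
    also have "\<dots> = (\<Prod>i = 0..<n. map_mat h A $$ (i, p i))" using A m by (intro prod.cong) auto
    finally show "h (\<Prod>i = 0..<n. A $$ (i, p i)) = (\<Prod>i = 0..<n. map_mat h A $$ (i, p i))" .
  qed
  show ?thesis unfolding det_def'[OF A] det_def'[OF A']
    by (subst hom_on_sum[OF F h]) (auto simp: sg pr hom_on_mult[OF F h] intro!: subring_setD(6)[OF F])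
qed

text \<open>By Cramer's rule the inverse has its entries in the field generated by the entries.\<close>

lemma subfield_matrix_inverse:
  fixes Q :: "nat \<Rightarrow> nat \<Rightarrow> 'l::field"
  assumes F: "subfield_set F" and Q: "\<And>i j. Q i j \<in> F" and det: "det (mat w w (\<lambda>(i, j). Q i j)) \<noteq> 0"
  shows "\<exists>P. (\<forall>i j. P i j \<in> F) \<and>
    (\<forall>i<w. \<forall>k<w. (\<Sum>j<w. P i j * Q j k) = (if i = k then 1 else 0)) \<and>
    (\<forall>i<w. \<forall>k<w. (\<Sum>j<w. Q i j * P j k) = (if i = k then 1 else 0))"
proof -
  note Fr = subfield_setD(1)[OF F]
  define A where "A = mat w w (\<lambda>(i, j). Q i j)"
  have A: "A \<in> carrier_mat w w" by (simp add: A_def)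
  have AF: "A $$ (i, j) \<in> F" if "i < w" "j < w" for i j using that Q by (simp add: A_def)
  define P where "P i j = (if i < w \<and> j < w then adj_mat A $$ (i, j) / det A else 0)" for i j
  have "adj_mat A $$ (i, j) \<in> F" if "i < w" "j < w" for i j
  proof -
    have "det (mat_delete A j i) \<in> F"
      by (rule det_in_subring[OF Fr, of _ "w - 1"]) (use A that Q in \<open>auto simp: mat_delete_def A_def\<close>)
    then have "cofactor A j i \<in> F"
      unfolding cofactor_def by (intro subring_setD[OF Fr])
    then show ?thesis using A that by (simp add: adj_mat_def)
  qed
  moreover have "det A \<in> F" by (rule det_in_subring[OF Fr A AF])
  ultimately have PF: "P i j \<in> F" for i j
    using subring_setD(1)[OF Fr] by (auto simp: P_def intro!: subfield_setD(3)[OF F])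
  have d: "det A \<noteq> 0" using det by (simp add: A_def)
  note adj = adj_mat[OF A]
  have 1: "(\<Sum>j<w. P i j * Q j k) = (if i = k then 1 else 0)" if ik: "i < w" "k < w" for i k
  proof -
    have "(adj_mat A * A) $$ (i, k) = (\<Sum>j<w. adj_mat A $$ (i, j) * Q j k)"
      using adj(1) A ik by (simp add: scalar_prod_def A_def lessThan_atLeast0)
    also have "(adj_mat A * A) $$ (i, k) = (if i = k then det A else 0)" using adj(3) ik by simp
    finally have e: "(\<Sum>j<w. adj_mat A $$ (i, j) * Q j k) = (if i = k then det A else 0)" by simp
    have "(\<Sum>j<w. P i j * Q j k) = (\<Sum>j<w. adj_mat A $$ (i, j) * Q j k) / det A"
      unfolding sum_divide_distrib using ik by (intro sum.cong) (auto simp: P_def)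
    then show ?thesis using e d by simp
  qed
  have 2: "(\<Sum>j<w. Q i j * P j k) = (if i = k then 1 else 0)" if ik: "i < w" "k < w" for i k
  proof -
    have "(A * adj_mat A) $$ (i, k) = (\<Sum>j<w. Q i j * adj_mat A $$ (j, k))"
      using adj(1) A ik by (simp add: scalar_prod_def A_def lessThan_atLeast0)
    also have "(A * adj_mat A) $$ (i, k) = (if i = k then det A else 0)" using adj(2) ik by simp
    finally have e: "(\<Sum>j<w. Q i j * adj_mat A $$ (j, k)) = (if i = k then det A else 0)" by simp
    have "(\<Sum>j<w. Q i j * P j k) = (\<Sum>j<w. Q i j * adj_mat A $$ (j, k)) / det A"
      unfolding sum_divide_distrib using ik by (intro sum.cong) (auto simp: P_def)
    then show ?thesis using e d by simp
  qed
  show ?thesis using PF 1 2 by blast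
qed

text \<open>The matrix \<open>\<tau>\<close> is given on \<open>G\<close> as a fraction, with numerators \<open>a\<close> and denominator \<open>b\<close> that are
  combinations over \<open>F\<close> of functions \<open>e m\<close>; in the application \<open>e m g\<close> is a monomial in the coordinates of
  \<open>g x\<close> at the generic point \<open>x\<close>. Applying \<open>\<theta>\<close> to \<open>e\<close> and \<open>\<tau>\<close> amounts to a permutation \<open>\<pi>\<close> of \<open>G\<close>, up to the factor \<open>N \<theta>\<close> for \<open>\<tau>\<close>.
  A denominator of least support, normalised, does not change as a function on \<open>G\<close> under \<open>\<theta>\<close>. Numerators
  supported on as few functions \<open>e m\<close> as possible are unique, so \<open>\<theta>\<close> changes their coefficients by \<open>N \<theta>\<close> only.\<close>

theorem covariant_frame:
  fixes \<Theta> :: "('l::field_char_0 \<Rightarrow> 'l) set" and e :: "'m \<Rightarrow> 'g \<Rightarrow> 'l" and \<tau> :: "'g \<Rightarrow> nat \<Rightarrow> nat \<Rightarrow> 'l"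
    and N :: "('l \<Rightarrow> 'l) \<Rightarrow> nat \<Rightarrow> nat \<Rightarrow> 'l"
  assumes \<Theta>: "\<And>\<theta>. \<theta> \<in> \<Theta> \<Longrightarrow> ring_hom_total \<theta>" and \<Theta>F: "\<And>\<theta> f. \<theta> \<in> \<Theta> \<Longrightarrow> f \<in> F \<Longrightarrow> \<theta> f \<in> F"
    and F: "subfield_set F" and NF: "\<And>\<theta> i j. \<theta> \<in> \<Theta> \<Longrightarrow> N \<theta> i j \<in> F" and T: "finite T"
    and move: "\<And>\<theta>. \<theta> \<in> \<Theta> \<Longrightarrow> \<exists>\<pi>. \<pi> ` G = G \<and> (\<forall>g\<in>G. \<forall>m\<in>T. e m (\<pi> g) = \<theta> (e m g)) \<and>
      (\<forall>g\<in>G. \<forall>i<w. \<forall>k<w. \<tau> (\<pi> g) i k = (\<Sum>j<w. \<theta> (\<tau> g i j) * N \<theta> j k))"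
    and bF: "\<And>m. m \<in> T \<Longrightarrow> b m \<in> F" and aF: "\<And>i j m. m \<in> T \<Longrightarrow> a i j m \<in> F"
    and rel: "\<And>g i j. g \<in> G \<Longrightarrow> i < w \<Longrightarrow> j < w \<Longrightarrow>
      (\<Sum>m\<in>T. b m * e m g) * \<tau> g i j = (\<Sum>m\<in>T. a i j m * e m g)"
    and nz: "g0 \<in> G" "(\<Sum>m\<in>T. b m * e m g0) \<noteq> 0"
    and det: "\<And>g. g \<in> G \<Longrightarrow> det (mat w w (\<lambda>(i, j). \<tau> g i j)) \<noteq> 0"
  shows "\<exists>Q. (\<forall>i j. Q i j \<in> F) \<and> det (mat w w (\<lambda>(i, j). Q i j)) \<noteq> 0 \<and>
    (\<forall>\<theta>\<in>\<Theta>. \<forall>i<w. \<forall>k<w. (\<Sum>j<w. \<theta> (Q i j) * N \<theta> j k) = Q i k)"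
proof -
  note Fr = subfield_setD(1)[OF F]
  define ev where "ev b g = (\<Sum>m\<in>T. b m * e m g)" for b g
  have ev_diff: "ev (\<lambda>m. b m - c m) g = ev b g - ev c g" for b c g
    by (simp add: ev_def left_diff_distrib sum_subtractf)
  have ev_scale: "ev (\<lambda>m. x * b m) g = x * ev b g" for x b g
    by (simp add: ev_def sum_distrib_left mult.assoc)
  have ev_sum: "ev (\<lambda>m. \<Sum>j<w. c j m * x j) g = (\<Sum>j<w. ev (c j) g * x j)" for c x g
    unfolding ev_def sum_distrib_right by (subst sum.swap) (simp add: mult_ac)
  define R where "R b a \<longleftrightarrow> (\<forall>m\<in>T. b m \<in> F \<and> (\<forall>i j. a i j m \<in> F)) \<and>
    (\<forall>g\<in>G. \<forall>i<w. \<forall>j<w. ev b g * \<tau> g i j = ev (a i j) g)" for b a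
  define \<theta>a where "\<theta>a \<theta> a i k m = (\<Sum>j<w. \<theta> (a i j m) * N \<theta> j k)" for \<theta> a and i k :: nat and m :: 'm
  have R_move: "R (\<lambda>m. \<theta> (b m)) (\<theta>a \<theta> a)" if t: "\<theta> \<in> \<Theta>" and R: "R b a" for \<theta> b a
  proof -
    note h = \<Theta>[OF t]
    obtain \<pi> where \<pi>: "\<pi> ` G = G" "\<forall>g\<in>G. \<forall>m\<in>T. e m (\<pi> g) = \<theta> (e m g)"
      "\<forall>g\<in>G. \<forall>i<w. \<forall>k<w. \<tau> (\<pi> g) i k = (\<Sum>j<w. \<theta> (\<tau> g i j) * N \<theta> j k)" using move[OF t] by blast
    have ev_move: "ev (\<lambda>m. \<theta> (c m)) (\<pi> g) = \<theta> (ev c g)" if "g \<in> G" for c g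
      unfolding ev_def using \<pi>(2) that
      by (simp add: total_hom_sum[OF h] total_hom_mult[OF h])
    have "ev (\<lambda>m. \<theta> (b m)) g * \<tau> g i k = ev (\<theta>a \<theta> a i k) g" if g: "g \<in> G" and ik: "i < w" "k < w" for g i k
    proof -
      obtain g' where g': "g' \<in> G" "g = \<pi> g'" using g \<pi>(1) by blast
      have "ev (\<lambda>m. \<theta> (b m)) g * \<tau> g i k = (\<Sum>j<w. \<theta> (ev b g' * \<tau> g' i j) * N \<theta> j k)"
        using \<pi>(3) g' ik ev_move[OF g'(1), of b]
        by (simp add: total_hom_mult[OF h] sum_distrib_left mult.assoc)
      also have "\<dots> = (\<Sum>j<w. \<theta> (ev (a i j) g') * N \<theta> j k)"
        using R g' ik by (intro sum.cong) (auto simp: R_def)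
      also have "\<dots> = (\<Sum>j<w. ev (\<lambda>m. \<theta> (a i j m)) g * N \<theta> j k)"
        using ev_move[OF g'(1)] g'(2) by simp
      also have "\<dots> = ev (\<theta>a \<theta> a i k) g" unfolding \<theta>a_def ev_sum ..
      finally show ?thesis .
    qed
    moreover have "\<theta>a \<theta> a i k m \<in> F" if "m \<in> T" for i k m
      unfolding \<theta>a_def using R that t
      by (intro subring_set_sum[OF Fr] subring_setD(6)[OF Fr] \<Theta>F[OF t] NF[OF t]) (auto simp: R_def)
    ultimately show ?thesis using R \<Theta>F[OF t] by (auto simp: R_def)
  qed
  have R_diff: "R (\<lambda>m. b m - b' m) (\<lambda>i j m. a i j m - a' i j m)" if "R b a" "R b' a'" for b a b' a'
    using that by (auto simp: R_def ev_diff left_diff_distrib intro!: subring_setD(5)[OF Fr])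
  have R_scale: "R (\<lambda>m. x * b m) (\<lambda>i j m. x * a i j m)" if "R b a" "x \<in> F" for x b a
    using that by (auto simp: R_def ev_scale mult.assoc intro!: subring_setD(6)[OF Fr])
  define supp where "supp b = {m \<in> T. b m \<noteq> (0::'l)}" for b
  have fsupp: "finite (supp b)" for b using T by (simp add: supp_def)
  define good where "good b \<longleftrightarrow> (\<exists>a. R b a) \<and> (\<exists>g\<in>G. ev b g \<noteq> 0)" for b
  have "R b a" unfolding R_def ev_def using bF aF rel by simp
  then have "good b" unfolding good_def ev_def using nz by blast
  then obtain b1 where b1: "good b1" and min: "\<And>b. good b \<Longrightarrow> card (supp b1) \<le> card (supp b)"
    using exists_least_iff[of "\<lambda>n. \<exists>b. good b \<and> card (supp b) = n"] by (metis not_le)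
  obtain g1 where g1: "g1 \<in> G" "ev b1 g1 \<noteq> 0" using b1 by (auto simp: good_def)
  have "\<exists>m\<in>T. b1 m \<noteq> 0"
  proof (rule ccontr)
    assume "\<not> ?thesis"
    then have "ev b1 g1 = 0" unfolding ev_def by (intro sum.neutral) auto
    then show False using g1 by simp
  qed
  then obtain m1 where m1: "m1 \<in> T" "b1 m1 \<noteq> 0" by blast
  obtain a1 where a1: "R b1 a1" using b1 by (auto simp: good_def)
  define \<beta> where "\<beta> m = inverse (b1 m1) * b1 m" for m
  have iF: "inverse (b1 m1) \<in> F" using a1 m1 by (auto simp: R_def intro: subfield_setD(2)[OF F])
  from R_scale[OF a1 iF] obtain \<alpha>0 where \<alpha>0: "R \<beta> \<alpha>0" unfolding \<beta>_def by blast
  have \<beta>1: "\<beta> m1 = 1" using m1 by (simp add: \<beta>_def)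
  have ev\<beta>: "ev \<beta> g1 \<noteq> 0" using g1 m1 unfolding \<beta>_def ev_scale by simp
  \<comment> \<open>A conjugate of \<open>\<beta>\<close> differs from \<open>\<beta>\<close> by a relation of smaller support.\<close>
  have \<beta>_inv: "ev (\<lambda>m. \<theta> (\<beta> m)) g = ev \<beta> g" if t: "\<theta> \<in> \<Theta>" and g: "g \<in> G" for \<theta> g
  proof (rule ccontr)
    assume ne: "ev (\<lambda>m. \<theta> (\<beta> m)) g \<noteq> ev \<beta> g"
    let ?d = "\<lambda>m. \<theta> (\<beta> m) - \<beta> m"
    have "good ?d" unfolding good_def ev_diff using R_diff[OF R_move[OF t \<alpha>0] \<alpha>0] g ne by auto
    then have "card (supp b1) \<le> card (supp ?d)" by (rule min)
    moreover have "supp ?d \<subseteq> supp b1"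
      using total_hom_0[OF \<Theta>[OF t]] by (auto simp: supp_def \<beta>_def)
    moreover have "m1 \<notin> supp ?d" "m1 \<in> supp b1"
      using \<beta>1 m1 total_hom_1[OF \<Theta>[OF t]] by (auto simp: supp_def)
    ultimately show False by (metis card_seteq fsupp)
  qed
  define A where "A S a \<longleftrightarrow> S \<subseteq> T \<and> R \<beta> a \<and> (\<forall>m\<in>T - S. \<forall>i j. a i j m = 0)" for S a
  have "A T \<alpha>0" using \<alpha>0 by (simp add: A_def)
  then obtain S where "\<exists>a. A S a" and S_min: "\<And>S'. (\<exists>a. A S' a) \<Longrightarrow> card S \<le> card S'"
    using exists_least_iff[of "\<lambda>n. \<exists>S. (\<exists>a. A S a) \<and> card S = n"] by (metis not_le)
  then obtain \<alpha> where \<alpha>: "A S \<alpha>" by blast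
  have ST: "S \<subseteq> T" "finite S" using \<alpha> T finite_subset by (auto simp: A_def)
  have unique: "c m = 0" if c: "\<And>m. m \<in> T \<Longrightarrow> c m \<in> F" "\<And>m. m \<in> T - S \<Longrightarrow> c m = 0"
    "\<And>g. g \<in> G \<Longrightarrow> ev c g = 0" and m: "m \<in> T" for c m
  proof (rule ccontr)
    assume cm: "c m \<noteq> 0"
    then have mS: "m \<in> S" using c(2) m by blast
    define a' where "a' i j l = \<alpha> i j l - (\<alpha> i j m / c m) * c l" for i j l
    have ev_a': "ev (a' i j) g = ev (\<alpha> i j) g" if "g \<in> G" for i j g
      unfolding a'_def[abs_def] ev_diff ev_scale c(3)[OF that] by simp
    have "a' i j l \<in> F" if "l \<in> T" for i j l
      using \<alpha> c(1) m that unfolding a'_def A_def R_def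
      by (intro subring_setD(5,6)[OF Fr] subfield_setD(3)[OF F]) auto
    then have "R \<beta> a'" using \<alpha> ev_a' by (auto simp: A_def R_def)
    moreover have "a' i j l = 0" if "l \<in> T - (S - {m})" for i j l
    proof (cases "l = m")
      case True
      then show ?thesis using cm by (simp add: a'_def)
    next
      case False
      then have "l \<in> T - S" using that by blast
      then show ?thesis using \<alpha> c(2) by (simp add: a'_def A_def)
    qed
    ultimately have "A (S - {m}) a'" using ST unfolding A_def by blast
    then have "card S \<le> card (S - {m})" using S_min by blast
    then show False using mS ST(2) by (metis card_Diff1_less not_le)
  qed
  have cov: "\<theta>a \<theta> \<alpha> i k m = \<alpha> i k m" if t: "\<theta> \<in> \<Theta>" and ik: "i < w" "k < w" and m: "m \<in> T" for \<theta> i k m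
  proof -
    have R1: "R (\<lambda>m. \<theta> (\<beta> m)) (\<theta>a \<theta> \<alpha>)" using R_move[OF t] \<alpha> by (simp add: A_def)
    have "\<theta>a \<theta> \<alpha> i k m - \<alpha> i k m = 0"
    proof (rule unique[OF _ _ _ m])
      show "\<theta>a \<theta> \<alpha> i k m - \<alpha> i k m \<in> F" if "m \<in> T" for m
        using R1 \<alpha> that by (auto simp: A_def R_def intro!: subring_setD(5)[OF Fr])
      show "\<theta>a \<theta> \<alpha> i k m - \<alpha> i k m = 0" if "m \<in> T - S" for m
        using \<alpha> that total_hom_0[OF \<Theta>[OF t]] by (simp add: A_def \<theta>a_def)
      show "ev (\<lambda>m. \<theta>a \<theta> \<alpha> i k m - \<alpha> i k m) g = 0" if "g \<in> G" for g
        using R1 \<alpha> that ik \<beta>_inv[OF t that] by (auto simp: A_def R_def ev_diff)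
    qed
    then show ?thesis by simp
  qed
  have \<alpha>F: "\<alpha> i j m \<in> F" if "m \<in> T" for i j m using \<alpha> that by (auto simp: A_def R_def)
  \<comment> \<open>A combination of the coefficient matrices with rational weights is invertible, because the
    combination with weights \<open>e m g1\<close> is.\<close>
  define M where "M = mat w w (\<lambda>(i, j). \<Sum>m\<in>T. poly_const (\<alpha> i j m) * poly_var m)"
  have detM: "value_at x (det M) = det (mat w w (\<lambda>(i, j). \<Sum>m\<in>T. \<alpha> i j m * x m))" for x
  proof -
    have "map_mat (value_at x) M = mat w w (\<lambda>(i, j). \<Sum>m\<in>T. \<alpha> i j m * x m)"
      by (rule eq_matI) (auto simp: M_def value_at_simps)
    then show ?thesis using hom_on_det[OF subring_set_UNIV value_at_hom, of M w x] by (simp add: M_def)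
  qed
  have "value_at (\<lambda>m. e m g1) (det M) \<noteq> 0"
  proof -
    have "mat w w (\<lambda>(i, j). \<Sum>m\<in>T. \<alpha> i j m * e m g1) = ev \<beta> g1 \<cdot>\<^sub>m mat w w (\<lambda>(i, j). \<tau> g1 i j)"
      using \<alpha> g1 by (intro eq_matI) (auto simp: A_def R_def ev_def)
    then show ?thesis using det[OF g1(1)] ev\<beta> unfolding detM by (simp add: det_smult)
  qed
  then have "det M \<noteq> 0" by (auto simp: value_at_simps)
  then obtain u where u: "\<And>m. \<exists>n. u m = 2 ^ n" and du: "value_at u (det M) \<noteq> 0"
    using nonzero_at_power_of_2_point by blast
  have two: "(2::'l) ^ n \<in> F" for n
  proof -
    have "(1::'l) + 1 \<in> F" by (intro subring_setD[OF Fr])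
    then show ?thesis by (intro subring_setD(7)[OF Fr]) simp
  qed
  have uF: "u m \<in> F" for m using u[of m] two by auto
  have uinv: "\<theta> (u m) = u m" if "\<theta> \<in> \<Theta>" for \<theta> m
    using u[of m] total_hom_power[OF \<Theta>[OF that]] hom_on_numeral[OF \<Theta>[OF that]] by auto
  define Q where "Q i j = (\<Sum>m\<in>T. \<alpha> i j m * u m)" for i j
  have "Q i j \<in> F" for i j
    unfolding Q_def by (intro subring_set_sum[OF Fr] subring_setD(6)[OF Fr] \<alpha>F uF)
  moreover have "det (mat w w (\<lambda>(i, j). Q i j)) \<noteq> 0" using du unfolding detM Q_def .
  moreover have "(\<Sum>j<w. \<theta> (Q i j) * N \<theta> j k) = Q i k" if t: "\<theta> \<in> \<Theta>" and ik: "i < w" "k < w" for \<theta> i k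
  proof -
    note h = \<Theta>[OF t]
    have "(\<Sum>j<w. \<theta> (Q i j) * N \<theta> j k) = (\<Sum>j<w. \<Sum>m\<in>T. \<theta> (\<alpha> i j m) * N \<theta> j k * u m)"
      unfolding Q_def using uinv[OF t]
      by (simp add: total_hom_sum[OF h] total_hom_mult[OF h]
          sum_distrib_left sum_distrib_right mult_ac)
    also have "\<dots> = (\<Sum>m\<in>T. \<theta>a \<theta> \<alpha> i k m * u m)"
      unfolding \<theta>a_def sum_distrib_right by (rule sum.swap)
    also have "\<dots> = Q i k" unfolding Q_def using cov[OF t ik] by (intro sum.cong) auto
    finally show ?thesis .
  qed
  ultimately show ?thesis by blast
qed

section \<open>Linear algebraic groups\<close>

lemma GL_simps: "g \<otimes>\<^bsub>GL n\<^esub> h = g * h" "\<one>\<^bsub>GL n\<^esub> = 1\<^sub>m n"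
  by (simp_all add: GL_def units_of_def ring_mat_def)

lemma GL_group: "group (GL n :: 'a::field mat monoid)"
proof -
  have "ring (ring_mat TYPE('a) n ())" by (rule ring_mat)
  then show ?thesis unfolding GL_def by (intro monoid.units_group ring.is_monoid)
qed

lemma GL_carrier_mat: "g \<in> carrier (GL n) \<Longrightarrow> g \<in> carrier_mat n n"
  by (auto simp: GL_def units_of_def Units_def ring_mat_def)

lemma GL_iff_det:
  assumes g: "g \<in> carrier_mat n n"
  shows "g \<in> carrier (GL n) \<longleftrightarrow> det (g :: 'a::field mat) \<noteq> 0"
proof
  assume "g \<in> carrier (GL n)"
  then obtain h where "h \<in> carrier_mat n n" "g * h = 1\<^sub>m n"
    by (auto simp: GL_def units_of_def Units_def ring_mat_def)
  then have "det g * det h = 1" using det_mult[OF g, of h] by simp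
  then show "det g \<noteq> 0" by auto
next
  assume "det g \<noteq> 0"
  then show "g \<in> carrier (GL n)" using det_non_zero_imp_unit[OF g] by (simp add: GL_def units_of_def)
qed

lemma GL_inv:
  assumes "g \<in> carrier (GL n :: 'a::field mat monoid)"
  shows "inv\<^bsub>GL n\<^esub> g \<in> carrier_mat n n" "g * inv\<^bsub>GL n\<^esub> g = 1\<^sub>m n" "inv\<^bsub>GL n\<^esub> g * g = 1\<^sub>m n"
    "inv\<^bsub>GL n\<^esub> g \<in> carrier (GL n)"
  using group.inv_closed[OF GL_group assms] group.r_inv[OF GL_group assms] group.l_inv[OF GL_group assms]
  by (auto simp: GL_simps GL_carrier_mat)

text \<open>The generating sets are closed under intersection because polynomials can be multiplied.\<close>

lemma zariski_basic_neighbourhood: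
  fixes ev :: "'p \<Rightarrow> ('i, 'a::field) mpoly \<Rightarrow> 'a"
  assumes "generate_topology_on {{g \<in> S. ev g p \<noteq> 0} | p. p \<in> P} U" and "g \<in> U"
    and mult: "\<And>p q. p \<in> P \<Longrightarrow> q \<in> P \<Longrightarrow> p * q \<in> P" "\<And>g p q. ev g (p * q) = ev g p * ev g q"
  shows "\<exists>p\<in>P. g \<in> S \<and> ev g p \<noteq> 0 \<and> {h \<in> S. ev h p \<noteq> 0} \<subseteq> U"
  using assms(1,2)
proof (induction arbitrary: g)
  case (Int a b)
  obtain p q where p: "p \<in> P" "g \<in> S" "ev g p \<noteq> 0" "{h \<in> S. ev h p \<noteq> 0} \<subseteq> a"
    and q: "q \<in> P" "ev g q \<noteq> 0" "{h \<in> S. ev h q \<noteq> 0} \<subseteq> b"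
    using Int.IH[of g] Int.prems by blast
  then show ?case using mult by (intro bexI[of _ "p * q"]) auto
next
  case (UN K)
  then obtain k where "k \<in> K" "g \<in> k" by blast
  then obtain p where "p \<in> P" "g \<in> S" "ev g p \<noteq> 0" "{h \<in> S. ev h p \<noteq> 0} \<subseteq> k" using UN.IH by blast
  then show ?case using \<open>k \<in> K\<close> by blast
qed auto

lemma to_ac_hom: "ring_hom_total (to_ac :: 'k::field \<Rightarrow> _)"
  by (simp add: hom_on_def)

lemma base_field_subring: "subring_set (base_field :: 'k::field alg_closure set)"
  unfolding base_field_def by (rule hom_image_subring[OF subring_set_UNIV to_ac_hom subring_set_UNIV subset_UNIV])

lemma zariski_closed_separation:
  assumes "closedin (zariski_GL K n) G" and "subring_set K" and "g \<in> carrier (GL n)" "g \<notin> G"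
  shows "\<exists>p\<in>polys K ({..<n} \<times> {..<n}). entry_poly_eval g p \<noteq> 0 \<and> (\<forall>h\<in>G. entry_poly_eval h p = 0)"
proof -
  let ?P = "polys K ({..<n} \<times> {..<n})"
  note P = subring_setD[OF polys_subring[OF assms(2)]]
  have top: "topspace (zariski_GL K n) = carrier (GL n)"
  proof -
    have "carrier (GL n) = {g \<in> carrier (GL n). entry_poly_eval g 1 \<noteq> 0}" by (simp add: value_at_simps)
    moreover have "(1 :: (nat \<times> nat, 'a) mpoly) \<in> ?P" by (rule P)
    ultimately show ?thesis unfolding zariski_GL_def topology_generated_by_topspace by blast
  qed
  have sub: "G \<subseteq> carrier (GL n)" and op: "openin (zariski_GL K n) (carrier (GL n) - G)"
    using assms(1) unfolding closedin_def top by auto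
  have gen: "generate_topology_on {{g \<in> carrier (GL n). entry_poly_eval g p \<noteq> 0} | p. p \<in> ?P} (carrier (GL n) - G)"
    using op unfolding zariski_GL_def openin_topology_generated_by_iff .
  obtain p where p: "p \<in> ?P" "entry_poly_eval g p \<noteq> 0"
    "{h \<in> carrier (GL n). entry_poly_eval h p \<noteq> 0} \<subseteq> carrier (GL n) - G"
    using zariski_basic_neighbourhood[of "carrier (GL n)" entry_poly_eval ?P, OF gen, of g] assms(3,4) P(6)
    by (auto simp: value_at_simps)
  then show ?thesis using sub by (intro bexI[of _ p]) auto
qed

text \<open>The coordinates of the point \<open>(x, A x)\<close>, those of \<open>A x\<close> being numbered from \<open>v\<close> on.\<close>

definition orbit_point :: "nat \<Rightarrow> 'a::comm_ring_1 mat \<Rightarrow> (nat \<Rightarrow> 'a) \<Rightarrow> nat \<Rightarrow> 'a" where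
  "orbit_point v A x k = (if k < v then x k else \<Sum>j<v. A $$ (k - v, j) * x j)"

lemma orbit_point_low [simp]: "k < v \<Longrightarrow> orbit_point v A x k = x k"
  by (simp add: orbit_point_def)

context
  fixes n :: nat and G :: "'k::field_char_0 alg_closure mat set"
  assumes G: "linear_algebraic_group n G"
begin

lemma G_subgroup: "subgroup G (GL n)" and G_closed: "closedin (zariski_GL base_field n) G"
  using G by (auto simp: linear_algebraic_group_def)

lemma G_GL: "g \<in> G \<Longrightarrow> g \<in> carrier (GL n)"
  using subgroup.subset[OF G_subgroup] by auto

lemma G_mat: "g \<in> G \<Longrightarrow> g \<in> carrier_mat n n"
  using G_GL GL_carrier_mat by blast

lemma G_mult: "g \<in> G \<Longrightarrow> h \<in> G \<Longrightarrow> g * h \<in> G"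
  using subgroup.m_closed[OF G_subgroup] by (simp add: GL_simps)

lemma G_one: "1\<^sub>m n \<in> G"
  using subgroup.one_closed[OF G_subgroup] by (simp add: GL_simps)

lemma G_inv: "g \<in> G \<Longrightarrow> inv\<^bsub>GL n\<^esub> g \<in> G"
  using subgroup.m_inv_closed[OF G_subgroup] .

lemma action_mult:
  assumes "linear_action n G v \<rho>" "g \<in> G" "h \<in> G"
  shows "\<rho> (g * h) = \<rho> g * \<rho> h"
  using assms hom_mult[of \<rho> "GL_sub n G" "GL v" g h] by (simp add: linear_action_def GL_simps)

lemma action_GL: "linear_action n G v \<rho> \<Longrightarrow> g \<in> G \<Longrightarrow> \<rho> g \<in> carrier (GL v)"
  using hom_in_carrier[of \<rho> "GL_sub n G" "GL v" g] by (simp add: linear_action_def)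

lemma action_mat: "linear_action n G v \<rho> \<Longrightarrow> g \<in> G \<Longrightarrow> \<rho> g \<in> carrier_mat v v"
  using action_GL GL_carrier_mat by blast

lemma action_one:
  assumes "linear_action n G v \<rho>"
  shows "\<rho> (1\<^sub>m n) = 1\<^sub>m v"
proof -
  let ?x = "\<rho> (1\<^sub>m n)"
  have x: "?x \<in> carrier (GL v)" using action_GL[OF assms G_one] .
  have "?x * ?x = ?x" using action_mult[OF assms G_one G_one] by simp
  then have "?x * ?x * inv\<^bsub>GL v\<^esub> ?x = ?x * inv\<^bsub>GL v\<^esub> ?x" by simp
  then show ?thesis using GL_inv[OF x] GL_carrier_mat[OF x]
    by (simp add: assoc_mult_mat[of ?x v v ?x v "inv\<^bsub>GL v\<^esub> ?x" v])
qed

lemma action_inv: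
  assumes \<rho>: "linear_action n G v \<rho>" and g: "g \<in> G"
  shows "\<rho> (inv\<^bsub>GL n\<^esub> g) = inv\<^bsub>GL v\<^esub> (\<rho> g)"
proof -
  note GV = GL_group[of v, where 'a = "'k alg_closure"]
  have "\<rho> (inv\<^bsub>GL n\<^esub> g) \<otimes>\<^bsub>GL v\<^esub> \<rho> g = \<one>\<^bsub>GL v\<^esub>"
    using action_mult[OF \<rho> G_inv[OF g] g] action_one[OF \<rho>] GL_inv(3)[OF G_GL[OF g]] by (simp add: GL_simps)
  then show ?thesis
    using group.inv_equality[OF GV] action_GL[OF \<rho>] g G_inv[OF g] by metis
qed

lemma free_orbit_inj:
  assumes \<rho>: "linear_action n G v \<rho>" and x: "x \<in> carrier_vec v"
    and stab: "stabilizer (GL_sub n G) (\<lambda>g v. \<rho> g *\<^sub>v v) x = {1\<^sub>m n}"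
    and g: "g \<in> G" "h \<in> G" and eq: "\<rho> g *\<^sub>v x = \<rho> h *\<^sub>v x"
  shows "g = h"
proof -
  let ?i = "inv\<^bsub>GL n\<^esub> g"
  note i = G_inv[OF g(1)]
  note m = action_mat[OF \<rho>]
  have "\<rho> (?i * h) *\<^sub>v x = \<rho> ?i *\<^sub>v (\<rho> h *\<^sub>v x)"
    using action_mult[OF \<rho> i g(2)] assoc_mult_mat_vec[OF m[OF i] m[OF g(2)] x] by simp
  also have "\<dots> = \<rho> (?i * g) *\<^sub>v x"
    using action_mult[OF \<rho> i g(1)] assoc_mult_mat_vec[OF m[OF i] m[OF g(1)] x] eq by simp
  also have "\<dots> = x" using GL_inv(3)[OF G_GL[OF g(1)]] action_one[OF \<rho>] x by simp
  finally have "?i * h \<in> stabilizer (GL_sub n G) (\<lambda>g v. \<rho> g *\<^sub>v v) x"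
    using G_mult[OF i g(2)] by (simp add: stabilizer_def)
  then have "?i * h = 1\<^sub>m n" using stab by simp
  then have "g * (?i * h) = g" using G_mat[OF g(1)] by simp
  moreover have "g * (?i * h) = (g * ?i) * h"
    using assoc_mult_mat[OF G_mat[OF g(1)] G_mat[OF i] G_mat[OF g(2)]] by simp
  ultimately show ?thesis using GL_inv(2)[OF G_GL[OF g(1)]] G_mat[OF g(2)] by simp
qed

lemma almost_free_basic:
  assumes free: "almost_free n G v \<rho>"
  shows "\<exists>c\<in>polys UNIV {..<v}. (\<exists>x. value_at x c \<noteq> 0) \<and>
    (\<forall>x\<in>carrier_vec v. value_at (\<lambda>i. x $ i) c \<noteq> 0 \<longrightarrow> stabilizer (GL_sub n G) (\<lambda>g v. \<rho> g *\<^sub>v v) x = {1\<^sub>m n})"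
proof -
  obtain U where U: "openin (zariski_vec base_field v) U" "U \<noteq> {}"
    "\<And>x. x \<in> U \<Longrightarrow> stabilizer (GL_sub n G) (\<lambda>g v. \<rho> g *\<^sub>v v) x = {1\<^sub>m n}"
    using free by (auto simp: almost_free_def)
  obtain x where x: "x \<in> U" using U by blast
  let ?P = "polys base_field {..<v} :: (nat, 'k alg_closure) mpoly set"
  have gen: "generate_topology_on {{v' \<in> carrier_vec v. poly_eval (\<lambda>c. c) (\<lambda>i. v' $ i) p \<noteq> 0} | p. p \<in> ?P} U"
    using U(1) unfolding zariski_vec_def openin_topology_generated_by_iff .
  obtain p where p: "p \<in> ?P" "value_at (\<lambda>i. x $ i) p \<noteq> 0"
    "{y \<in> carrier_vec v. value_at (\<lambda>i. y $ i) p \<noteq> 0} \<subseteq> U"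
    using zariski_basic_neighbourhood[of "carrier_vec v" "\<lambda>y :: 'k alg_closure vec. value_at (\<lambda>i. y $ i)" ?P, OF gen x]
      subring_setD(6)[OF polys_subring[OF base_field_subring]]
    by (auto simp: value_at_simps)
  have "p \<in> polys UNIV {..<v}" using p(1) polys_mono[of base_field UNIV "{..<v}" "{..<v}"] by blast
  then show ?thesis using p U(3) by (intro bexI[of _ p]) auto
qed

end

section \<open>The group element as a rational function\<close>

lemma fun_eval_hom: "ring_hom_total (\<lambda>F :: 'z \<Rightarrow> 'a::comm_ring_1. F z)"
  by (simp add: hom_on_def plus_fun_def times_fun_def one_fun_def)

lemma fun_const_hom: "ring_hom_total (\<lambda>c _ :: 'z. c :: 'a::comm_ring_1)"
  by (simp add: hom_on_def plus_fun_def times_fun_def one_fun_def fun_eq_iff)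

lemma fun_poly_eval: "poly_eval (\<lambda>c _. c) f p z = value_at (\<lambda>i. f i z) p"
  using hom_poly_eval[OF fun_eval_hom[of z], of "\<lambda>c _. c" f p] by simp

lemma fun_power: "((F :: 'z \<Rightarrow> 'a::comm_ring_1) ^ n) z = F z ^ n"
  using total_hom_power[OF fun_eval_hom] .

lemma mult_set_common_denominator:
  assumes A: "subring_set A" and M: "mult_set A M" and D: "finite D" "\<forall>t\<in>D. \<exists>b\<in>M. b * t \<in> A"
  shows "\<exists>b\<in>M. \<forall>t\<in>D. b * t \<in> A"
  using D
proof (induction D)
  case empty
  then show ?case using M by (auto simp: mult_set_def)
next
  case (insert t D)
  then obtain b c where b: "b \<in> M" "\<forall>t\<in>D. b * t \<in> A" and c: "c \<in> M" "c * t \<in> A" by auto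
  have bc: "b \<in> A" "c \<in> A" using b c M by (auto simp: mult_set_def)
  have "(b * c) * s \<in> A" if "s \<in> insert t D" for s
  proof (cases "s = t")
    case True
    have "b * (c * t) \<in> A" by (rule subring_setD(6)[OF A bc(1) c(2)])
    then show ?thesis using True by (simp add: mult.assoc)
  next
    case False
    then have "b * s \<in> A" using that b by auto
    then have "c * (b * s) \<in> A" by (rule subring_setD(6)[OF A bc(2)])
    then show ?thesis by (simp add: mult_ac)
  qed
  then show ?case using b c M by (intro bexI[of _ "b * c"]) (auto simp: mult_set_def)
qed

text \<open>For an almost free action \<open>g\<close> is a rational function of \<open>x\<close> and \<open>g x\<close>:
  two homomorphisms from the regular functions on \<open>G \<times> D(c)\<close> to the ground field are two
  points \<open>(g, x)\<close>, and they have the same \<open>x\<close> and \<open>g x\<close> only if they are equal.\<close>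

theorem rational_group_element:
  fixes G :: "'k::field_char_0 alg_closure mat set" and \<rho> \<tau> :: "'k alg_closure mat \<Rightarrow> 'k alg_closure mat"
  assumes G: "linear_algebraic_group n G" and \<rho>: "linear_action n G v \<rho>" and free: "almost_free n G v \<rho>"
    and \<tau>: "linear_action n G w \<tau>"
  shows "\<exists>c\<in>polys UNIV {..<v}. \<exists>b\<in>polys UNIV {..<v + v}. \<exists>a. (\<forall>i j. a i j \<in> polys UNIV {..<v + v}) \<and>
    (\<exists>g\<in>G. \<exists>x. value_at x c \<noteq> 0 \<and> value_at (orbit_point v (\<rho> g) x) b \<noteq> 0) \<and>
    (\<forall>g\<in>G. \<forall>x. value_at x c \<noteq> 0 \<longrightarrow> (\<forall>i<w. \<forall>j<w. value_at (orbit_point v (\<rho> g) x) b * \<tau> g $$ (i, j)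
       = value_at (orbit_point v (\<rho> g) x) (a i j)))"
proof -
  obtain c where c: "c \<in> polys UNIV {..<v}" and "\<exists>x. value_at x c \<noteq> 0"
    and stab: "\<And>x. x \<in> carrier_vec v \<Longrightarrow> value_at (\<lambda>i. x $ i) c \<noteq> 0 \<Longrightarrow>
      stabilizer (GL_sub n G) (\<lambda>g v. \<rho> g *\<^sub>v v) x = {1\<^sub>m n}"
    using almost_free_basic[OF G free] by blast
  then obtain x0 where x0: "value_at x0 c \<noteq> 0" by blast
  \<comment> \<open>\<open>r\<close> retracts all pairs onto the set \<open>Z\<close> of admissible ones, so
    that functions on \<open>Z\<close> become functions on a type.\<close>
  define Z where "Z = {(g, x). g \<in> G \<and> value_at x c \<noteq> 0}"
  define r where "r z = (if z \<in> Z then z else (1\<^sub>m n, x0))" for z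
  have rZ: "fst (r z) \<in> G" "value_at (snd (r z)) c \<noteq> 0" for z
    using x0 G_one[OF G] by (auto simp: r_def Z_def)
  have r_id: "r (g, x) = (g, x)" if "g \<in> G" "value_at x c \<noteq> 0" for g x
    using that by (simp add: r_def Z_def)
  define \<kappa> :: "'k alg_closure \<Rightarrow> ('k alg_closure mat \<times> (nat \<Rightarrow> 'k alg_closure)) \<Rightarrow> 'k alg_closure"
    where "\<kappa> c z = c" for c z
  have \<kappa>: "ring_hom_total \<kappa>" using fun_const_hom by (simp add: \<kappa>_def[abs_def])
  have pe: "poly_eval \<kappa> f p z = value_at (\<lambda>i. f i z) p" for f p z
    unfolding \<kappa>_def[abs_def] by (rule fun_poly_eval)
  define U where "U k z = orbit_point v (\<rho> (fst (r z))) (snd (r z)) k" for k z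
  define E where "E ij z = fst (r z) $$ ij" for ij z
  define D where "D z = inverse (det (fst (r z)))" for z
  define C' where "C' z = inverse (value_at (snd (r z)) c)" for z
  define us where "us = map U [0..<v + v]"
  define ts where "ts = map E (List.product [0..<n] [0..<n]) @ [D, C']"
  define A where "A = adjoins (Set.range \<kappa>) us"
  define C where "C = adjoins A ts"
  note Ks = consts_subring[OF \<kappa>]
  have As: "subring_set A" unfolding A_def by (intro adjoins_subring Ks)
  have Cs: "subring_set C" unfolding C_def by (intro adjoins_subring As)
  have AC: "A \<subseteq> C" unfolding C_def by (intro adjoins_incl As)
  have KA: "\<kappa> a \<in> A" for a unfolding A_def using adjoins_incl[OF Ks] by blast
  have UA: "U k \<in> A" if "k < v + v" for k
    unfolding A_def by (rule adjoins_elem[OF Ks]) (use that in \<open>auto simp: us_def\<close>)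
  have EC: "E (i, j) \<in> C" if "i < n" "j < n" for i j
    unfolding C_def by (rule adjoins_elem[OF As]) (use that in \<open>auto simp: ts_def\<close>)
  have DC: "D \<in> C" "C' \<in> C"
    unfolding C_def by (rule adjoins_elem[OF As], simp add: ts_def)+
  have KC: "\<kappa> a \<in> C" and UC: "k < v + v \<Longrightarrow> U k \<in> C" for a k using KA UA AC by auto
  have Epoly: "poly_eval \<kappa> E p \<in> C" if "p \<in> polys K ({..<n} \<times> {..<n})" for p K
    by (rule poly_eval_polys_in_subring[OF Cs that]) (auto simp: KC EC)
  have cpoly: "poly_eval \<kappa> U c \<in> C"
    by (rule poly_eval_polys_in_subring[OF Cs c]) (auto simp: KC UC)
  have c_val: "poly_eval \<kappa> U c z = value_at (snd (r z)) c" for z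
    unfolding pe by (rule poly_eval_cong_polys[OF c]) (auto simp: U_def)
  define Det where "Det = det (mat n n (\<lambda>ij. E ij))"
  have DetC: "Det \<in> C" unfolding Det_def by (rule det_in_subring[OF Cs, of _ n]) (auto simp: EC)
  have Det_val: "Det z = det (fst (r z))" for z
  proof -
    have "map_mat (\<lambda>F. F z) (mat n n (\<lambda>ij. E ij)) = fst (r z)"
      using G_mat[OF G rZ(1)[of z]] by (intro eq_matI) (auto simp: E_def)
    then show ?thesis unfolding Det_def
      using hom_on_det[OF subring_set_UNIV fun_eval_hom[of z], of "mat n n (\<lambda>ij. E ij)" n] by simp
  qed
  have det_nz: "det g \<noteq> 0" if "g \<in> G" for g using GL_iff_det[OF G_mat[OF G that]] G_GL[OF G that] by blast
  have reg: "\<exists>F\<in>C. (\<forall>z. F z = f (fst (r z))) \<and> (\<exists>p\<in>polys base_field ({..<n} \<times> {..<n}). \<exists>d.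
      F = poly_eval \<kappa> E p * D ^ d \<and> (\<forall>g\<in>G. f g = entry_poly_eval g p / det g ^ d))" if f: "regular_function n G f" for f
  proof -
    obtain p d where p: "p \<in> polys base_field ({..<n} \<times> {..<n})" "\<forall>g\<in>G. f g = entry_poly_eval g p / det g ^ d"
      using f by (auto simp: regular_function_def)
    have "(poly_eval \<kappa> E p * D ^ d) z = f (fst (r z))" for z
    proof -
      have "(poly_eval \<kappa> E p * D ^ d) z = entry_poly_eval (fst (r z)) p * inverse (det (fst (r z))) ^ d"
        by (simp add: times_fun_def fun_power pe D_def E_def)
      then show ?thesis using p(2) rZ(1) by (simp add: divide_inverse power_inverse)
    qed
    moreover have "poly_eval \<kappa> E p * D ^ d \<in> C" by (intro subring_setD(6,7)[OF Cs] Epoly[OF p(1)] DC)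
    ultimately show ?thesis using p by blast
  qed
  \<comment> \<open>homomorphisms to the ground field are points\<close>
  define gp where "gp \<psi> = mat n n (\<lambda>ij. \<psi> (E ij))" for \<psi> :: "_ \<Rightarrow> 'k alg_closure"
  have ev_E: "\<psi> (poly_eval \<kappa> E p) = entry_poly_eval (gp \<psi>) p"
    if "hom_on C \<psi>" "\<And>a. \<psi> (\<kappa> a) = a" "p \<in> polys K ({..<n} \<times> {..<n})" for \<psi> p K
  proof -
    have "\<psi> (poly_eval \<kappa> E p) = poly_eval (\<lambda>a. \<psi> (\<kappa> a)) (\<lambda>i. \<psi> (E i)) p"
      by (rule hom_on_poly_eval_polys[OF Cs that(1,3)]) (auto simp: KC EC)
    also have "\<dots> = entry_poly_eval (gp \<psi>) p"
      by (rule poly_eval_cong_polys[OF that(3)]) (auto simp: that(2) gp_def)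
    finally show ?thesis .
  qed
  have D1: "D * Det = 1" using det_nz rZ(1) by (auto simp: fun_eq_iff times_fun_def one_fun_def D_def Det_val)
  have psi_D: "\<psi> D * det (gp \<psi>) = 1" if "hom_on C \<psi>" for \<psi>
  proof -
    have "\<psi> Det = det (map_mat \<psi> (mat n n (\<lambda>ij. E ij)))"
      unfolding Det_def by (rule hom_on_det[OF Cs that, of _ n]) (auto simp: EC)
    also have "map_mat \<psi> (mat n n (\<lambda>ij. E ij)) = gp \<psi>" by (intro eq_matI) (auto simp: gp_def)
    finally have "\<psi> Det = det (gp \<psi>)" .
    then show ?thesis using hom_on_mult[OF Cs that DC(1) DetC] D1 hom_on_1[OF Cs that] by simp
  qed
  have gpG: "gp \<psi> \<in> G" if h: "hom_on C \<psi>" "\<And>a. \<psi> (\<kappa> a) = a" for \<psi>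
  proof (rule ccontr)
    assume no: "gp \<psi> \<notin> G"
    have "gp \<psi> \<in> carrier_mat n n" by (simp add: gp_def)
    moreover have "det (gp \<psi>) \<noteq> 0" using psi_D[OF h(1)] by auto
    ultimately have "gp \<psi> \<in> carrier (GL n)" by (simp add: GL_iff_det)
    from zariski_closed_separation[OF G_closed[OF G] base_field_subring this no] obtain p where
      p: "p \<in> polys base_field ({..<n} \<times> {..<n})" "entry_poly_eval (gp \<psi>) p \<noteq> 0"
        "\<forall>h\<in>G. entry_poly_eval h p = 0" by blast
    have "poly_eval \<kappa> E p = 0"
      using p(3) rZ(1) by (auto simp: fun_eq_iff zero_fun_def pe E_def)
    then have "entry_poly_eval (gp \<psi>) p = \<psi> 0" using ev_E[OF h p(1)] by metis
    then show False using p(2) unfolding hom_on_0[OF Cs h(1)] by blast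
  qed
  have psi_reg: "\<psi> F = f (gp \<psi>)"
    if h: "hom_on C \<psi>" "\<And>a. \<psi> (\<kappa> a) = a" and f: "regular_function n G f" "\<And>z. F z = f (fst (r z))" for \<psi> f F
  proof -
    obtain F' p d where F': "\<forall>z. F' z = f (fst (r z))" "p \<in> polys base_field ({..<n} \<times> {..<n})"
      "F' = poly_eval \<kappa> E p * D ^ d" "\<forall>g\<in>G. f g = entry_poly_eval g p / det g ^ d" using reg[OF f(1)] by blast
    have "F = F'" using F'(1) f(2) by (simp add: fun_eq_iff)
    then have "\<psi> F = \<psi> (poly_eval \<kappa> E p) * \<psi> D ^ d"
      unfolding F'(3) using hom_on_mult[OF Cs h(1) Epoly[OF F'(2)] subring_setD(7)[OF Cs DC(1), of d]]
      by (simp add: hom_on_power[OF Cs h(1) DC(1)])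
    also have "\<psi> D = inverse (det (gp \<psi>))" using psi_D[OF h(1)] by (metis inverse_unique mult.commute)
    finally show ?thesis using F'(4) gpG[OF h] ev_E[OF h F'(2)] by (simp add: divide_inverse power_inverse)
  qed
  have regC: "F \<in> C" if f: "regular_function n G f" "\<And>z. F z = f (fst (r z))" for f F
    using reg[OF f(1)] f(2) by (metis ext)
  have reg_\<rho>: "regular_function n G (\<lambda>g. \<rho> g $$ (i, j))" if "i < v" "j < v" for i j
    using \<rho> that by (simp add: linear_action_def)
  have reg_\<tau>: "regular_function n G (\<lambda>g. \<tau> g $$ (i, j))" if "i < w" "j < w" for i j
    using \<tau> that by (simp add: linear_action_def)
  have psi_U: "\<psi> (U (v + i)) = (\<Sum>j<v. \<rho> (gp \<psi>) $$ (i, j) * \<psi> (U j))"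
    if h: "hom_on C \<psi>" "\<And>a. \<psi> (\<kappa> a) = a" and i: "i < v" for \<psi> i
  proof -
    define R where "R j z = \<rho> (fst (r z)) $$ (i, j)" for j z
    have R: "R j \<in> C" "\<psi> (R j) = \<rho> (gp \<psi>) $$ (i, j)" if "j < v" for j
      by (rule regC[OF reg_\<rho>[OF i that]], simp add: R_def, rule psi_reg[OF h reg_\<rho>[OF i that]], simp add: R_def)
    have "U (v + i) = (\<Sum>j<v. R j * U j)"
    proof
      fix z
      have "(\<Sum>j<v. R j * U j) z = (\<Sum>j<v. R j z * U j z)"
        using total_hom_sum[OF fun_eval_hom[of z], of "\<lambda>j. R j * U j" "{..<v}"]
        by (simp add: times_fun_def)
      then show "U (v + i) z = (\<Sum>j<v. R j * U j) z" by (simp add: U_def R_def orbit_point_def)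
    qed
    then have "\<psi> (U (v + i)) = (\<Sum>j<v. \<psi> (R j * U j))"
      using hom_on_sum[OF Cs h(1), of "{..<v}" "\<lambda>j. R j * U j"] R(1) UC subring_setD(6)[OF Cs] by simp
    also have "\<dots> = (\<Sum>j<v. \<rho> (gp \<psi>) $$ (i, j) * \<psi> (U j))"
      using R UC by (intro sum.cong) (auto simp: hom_on_mult[OF Cs h(1)])
    finally show ?thesis .
  qed
  have agree: "\<psi> t = \<psi>' t"
    if h: "hom_on C \<psi>" "hom_on C \<psi>'" "\<And>a. \<psi> (\<kappa> a) = a" "\<And>a. \<psi>' (\<kappa> a) = a"
      and eqA: "\<And>x. x \<in> A \<Longrightarrow> \<psi> x = \<psi>' x" and t: "t \<in> C" for \<psi> \<psi>' t
  proof -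
    define x where "x = vec v (\<lambda>i. \<psi> (U i))"
    have x: "x \<in> carrier_vec v" by (simp add: x_def)
    have cx: "\<psi> (poly_eval \<kappa> U c) = value_at (\<lambda>i. x $ i) c"
    proof -
      have "\<psi> (poly_eval \<kappa> U c) = poly_eval (\<lambda>a. \<psi> (\<kappa> a)) (\<lambda>i. \<psi> (U i)) c"
        by (rule hom_on_poly_eval_polys[OF Cs h(1) c]) (auto simp: KC UC)
      also have "\<dots> = value_at (\<lambda>i. x $ i) c" by (rule poly_eval_cong_polys[OF c]) (auto simp: h(3) x_def)
      finally show ?thesis .
    qed
    have C1: "C' * poly_eval \<kappa> U c = 1"
      using rZ(2) by (auto simp: fun_eq_iff times_fun_def one_fun_def C'_def c_val)
    have C2: "\<chi> C' * \<chi> (poly_eval \<kappa> U c) = 1" if "hom_on C \<chi>" for \<chi> :: "_ \<Rightarrow> 'k alg_closure"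
      using hom_on_mult[OF Cs that DC(2) cpoly] C1 hom_on_1[OF Cs that] by simp
    have "value_at (\<lambda>i. x $ i) c \<noteq> 0" using C2[OF h(1)] cx by auto
    note st = stab[OF x this]
    have mv: "\<rho> g *\<^sub>v x = vec v (\<lambda>i. \<Sum>j<v. \<rho> g $$ (i, j) * \<psi> (U j))" if "g \<in> G" for g
      using action_mat[OF G \<rho> that]
      by (intro eq_vecI) (auto simp: scalar_prod_def x_def lessThan_atLeast0)
    have "\<rho> (gp \<psi>) *\<^sub>v x = \<rho> (gp \<psi>') *\<^sub>v x"
      unfolding mv[OF gpG[OF h(1,3)]] mv[OF gpG[OF h(2,4)]]
    proof (intro vec_eq_iff[THEN iffD2] conjI allI impI)
      fix i assume "i < dim_vec (vec v (\<lambda>i. \<Sum>j<v. \<rho> (gp \<psi>') $$ (i, j) * \<psi> (U j)))"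
      then have i: "i < v" by simp
      have "(\<Sum>j<v. \<rho> (gp \<psi>) $$ (i, j) * \<psi> (U j)) = (\<Sum>j<v. \<rho> (gp \<psi>') $$ (i, j) * \<psi>' (U j))"
        using psi_U[OF h(1,3) i] psi_U[OF h(2,4) i] eqA[OF UA[of "v + i"]] i by simp
      also have "\<dots> = (\<Sum>j<v. \<rho> (gp \<psi>') $$ (i, j) * \<psi> (U j))"
        using eqA[OF UA] by (intro sum.cong) auto
      finally show "vec v (\<lambda>i. \<Sum>j<v. \<rho> (gp \<psi>) $$ (i, j) * \<psi> (U j)) $ i =
        vec v (\<lambda>i. \<Sum>j<v. \<rho> (gp \<psi>') $$ (i, j) * \<psi> (U j)) $ i" using i by simp
    qed simp
    then have gg: "gp \<psi> = gp \<psi>'"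
      by (rule free_orbit_inj[OF G \<rho> x st gpG[OF h(1,3)] gpG[OF h(2,4)]])
    define S where "S = {f \<in> C. \<psi> f = \<psi>' f}"
    have "subring_set S"
      unfolding subring_set_def S_def
      by (auto simp: hom_on_1[OF Cs h(1)] hom_on_1[OF Cs h(2)] hom_on_diff[OF Cs h(1)] hom_on_diff[OF Cs h(2)]
          hom_on_mult[OF Cs h(1)] hom_on_mult[OF Cs h(2)] intro: subring_setD[OF Cs])
    moreover have "A \<subseteq> S" using eqA AC by (auto simp: S_def)
    moreover have "E (i, j) \<in> S" if "i < n" "j < n" for i j
    proof -
      have "gp \<psi> $$ (i, j) = gp \<psi>' $$ (i, j)" using gg by simp
      then show ?thesis using that EC by (simp add: S_def gp_def)
    qed
    moreover have "D \<in> S"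
      using psi_D[OF h(1)] psi_D[OF h(2)] gg DC by (auto simp: S_def) (metis inverse_unique mult.commute)
    moreover have "C' \<in> S"
    proof -
      have "poly_eval \<kappa> U c \<in> A"
        by (rule poly_eval_polys_in_subring[OF As c]) (auto simp: KA UA)
      then have "\<psi> (poly_eval \<kappa> U c) = \<psi>' (poly_eval \<kappa> U c)" by (rule eqA)
      then have "\<psi> C' = \<psi>' C'" using C2[OF h(1)] C2[OF h(2)] by (metis inverse_unique mult.commute)
      then show ?thesis using DC by (simp add: S_def)
    qed
    ultimately have "C \<subseteq> S"
      unfolding C_def by (intro adjoins_least[OF As]) (auto simp: ts_def)
    then show ?thesis using t by (auto simp: S_def)
  qed
  have red: "\<forall>(F :: ('k alg_closure mat \<times> (nat \<Rightarrow> 'k alg_closure)) \<Rightarrow> 'k alg_closure) m. F ^ m = 0 \<longrightarrow> F = 0"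
  proof (intro allI impI ext)
    fix F :: "('k alg_closure mat \<times> (nat \<Rightarrow> 'k alg_closure)) \<Rightarrow> 'k alg_closure" and m z
    assume "F ^ m = 0"
    then have "F z ^ m = 0" using fun_power[of F m z] by (simp add: zero_fun_def)
    then show "F z = 0 z" by (simp add: zero_fun_def)
  qed
  have "\<exists>M. mult_set A M \<and> (\<forall>t\<in>C. \<exists>b\<in>M. b * t \<in> A)"
  proof (rule determined_imp_rational[OF \<kappa> red A_def C_def])
    fix \<psi> \<psi>' :: "_ \<Rightarrow> 'k alg_closure" and t
    assume h: "hom_on C \<psi>" "hom_on C \<psi>'" "\<And>a. \<psi> (\<kappa> a) = a" "\<And>a. \<psi>' (\<kappa> a) = a"
      "\<And>x. x \<in> A \<Longrightarrow> \<psi> x = \<psi>' x" "t \<in> C"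
    show "\<psi> t = \<psi>' t" by (rule agree[OF h(1,2)]) (use h in auto)
  qed
  then obtain M where M: "mult_set A M" and frac: "\<forall>t\<in>C. \<exists>b\<in>M. b * t \<in> A" by blast
  define R where "R ij z = \<tau> (fst (r z)) $$ ij" for ij z
  have RC: "R (i, j) \<in> C" if "i < w" "j < w" for i j
    using regC[OF reg_\<tau>[OF that], of "R (i, j)"] by (simp add: R_def)
  have "\<forall>t\<in>R ` ({..<w} \<times> {..<w}). \<exists>b\<in>M. b * t \<in> A" using frac RC by auto
  from mult_set_common_denominator[OF As M _ this] obtain B where
    B: "B \<in> M" "\<And>i j. i < w \<Longrightarrow> j < w \<Longrightarrow> B * R (i, j) \<in> A" by auto
  have A_poly: "\<exists>p\<in>polys UNIV {..<v + v}. f = poly_eval \<kappa> U p" if "f \<in> A" for f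
  proof -
    let ?S = "poly_eval \<kappa> U ` polys UNIV {..<v + v}"
    have "subring_set ?S"
      by (rule hom_image_subring[OF subring_set_UNIV poly_eval_hom[OF \<kappa>] polys_subring[OF subring_set_UNIV] subset_UNIV])
    moreover have "Set.range \<kappa> \<subseteq> ?S"
      using poly_eval_const[OF \<kappa>, of U] polys_const[of _ UNIV "{..<v + v}"] by (metis UNIV_I image_eqI image_subsetI)
    moreover have "set us \<subseteq> ?S"
    proof -
      have "U k \<in> ?S" if "k < v + v" for k
        using imageI[OF polys_var[of k "{..<v + v}" UNIV], of "poly_eval \<kappa> U"] that
        by (simp add: poly_eval_var[OF \<kappa>])
      then show ?thesis by (auto simp: us_def)
    qed
    ultimately have "A \<subseteq> ?S" unfolding A_def by (intro adjoins_least Ks)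
    then show ?thesis using that by auto
  qed
  obtain b where b: "b \<in> polys UNIV {..<v + v}" "B = poly_eval \<kappa> U b"
    using A_poly[of B] B(1) M by (auto simp: mult_set_def)
  have "\<exists>p. p \<in> polys UNIV {..<v + v} \<and> (i < w \<longrightarrow> j < w \<longrightarrow> B * R (i, j) = poly_eval \<kappa> U p)" for i j
    using A_poly[OF B(2)[of i j]] by (cases "i < w \<and> j < w") (auto intro: exI[of _ 0])
  then obtain a where a: "\<And>i j. a i j \<in> polys UNIV {..<v + v}"
    "\<And>i j. i < w \<Longrightarrow> j < w \<Longrightarrow> B * R (i, j) = poly_eval \<kappa> U (a i j)" by metis
  have "B \<noteq> 0" using B(1) M by (auto simp: mult_set_def)
  then obtain z where "B z \<noteq> 0" by (auto simp: fun_eq_iff zero_fun_def)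
  then have "value_at (orbit_point v (\<rho> (fst (r z))) (snd (r z))) b \<noteq> 0"
    by (simp add: b(2) pe U_def[abs_def])
  moreover have "value_at (orbit_point v (\<rho> g) x) b * \<tau> g $$ (i, j) = value_at (orbit_point v (\<rho> g) x) (a i j)"
    if "g \<in> G" "value_at x c \<noteq> 0" "i < w" "j < w" for g x i j
  proof -
    have "(B * R (i, j)) (g, x) = poly_eval \<kappa> U (a i j) (g, x)" using a(2)[OF that(3,4)] by simp
    then show ?thesis using r_id[OF that(1,2)] by (simp add: times_fun_def b(2) pe R_def U_def)
  qed
  ultimately show ?thesis using c b(1) a(1) rZ[of z] by blast
qed

section \<open>The action on rational functions\<close>

text \<open>The summand of dimension \<open>v\<close> has the coordinates 0 to \<open>v - 1\<close>, the
  other one the coordinates \<open>v\<close> to \<open>v + w - 1\<close>. The remaining variables are left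
  alone, so that invertible matrices give automorphisms.\<close>

definition pair_subst :: "nat \<Rightarrow> 'a::field mat \<Rightarrow> nat \<Rightarrow> 'a mat \<Rightarrow> nat \<Rightarrow> (nat, 'a) mpoly" where
  "pair_subst v A w B i = (if i < v then \<Sum>j<v. poly_const (A $$ (i, j)) * poly_var j
     else if i < v + w then \<Sum>j<w. poly_const (B $$ (i - v, j)) * poly_var (v + j) else poly_var i)"

definition pair_act :: "nat \<Rightarrow> 'a::field mat \<Rightarrow> nat \<Rightarrow> 'a mat \<Rightarrow> 'a ratfun \<Rightarrow> 'a ratfun" where
  "pair_act v A w B = fract_map (poly_eval poly_const (pair_subst v (inv\<^bsub>GL v\<^esub> A) w (inv\<^bsub>GL w\<^esub> B)))"

lemmas poly_subst_simps = poly_eval_const[OF poly_const_hom] poly_eval_var[OF poly_const_hom]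
  poly_eval_mult[OF poly_const_hom] poly_eval_sum[OF poly_const_hom]
lemmas ratfun_const_ops = total_hom_mult[OF ratfun_const_hom]
  total_hom_add[OF ratfun_const_hom]
  total_hom_sum[OF ratfun_const_hom]
lemmas ratfun_of_poly_simps = poly_eval_const[OF ratfun_const_hom] poly_eval_var[OF ratfun_const_hom]
  poly_eval_mult[OF ratfun_const_hom] poly_eval_sum[OF ratfun_const_hom]

lemma mat_mult_entry:
  assumes "A \<in> carrier_mat n n" "B \<in> carrier_mat n n" "i < n" "k < n"
  shows "(A * B) $$ (i, k) = (\<Sum>j<n. A $$ (i, j) * B $$ (j, k))"
  using assms by (simp add: scalar_prod_def lessThan_atLeast0)

lemma linear_combination_inverse:
  fixes x :: "nat \<Rightarrow> 'b::comm_ring_1"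
  assumes A: "A \<in> carrier_mat n n" "B \<in> carrier_mat n n" "A * B = (1\<^sub>m n :: 'a::comm_ring_1 mat)"
    and h: "ring_hom_total h" and i: "i < n"
  shows "(\<Sum>j<n. h (A $$ (i, j)) * (\<Sum>k<n. h (B $$ (j, k)) * x k)) = x i"
proof -
  have "(\<Sum>j<n. h (A $$ (i, j)) * (\<Sum>k<n. h (B $$ (j, k)) * x k))
      = (\<Sum>k<n. h (\<Sum>j<n. A $$ (i, j) * B $$ (j, k)) * x k)"
    unfolding total_hom_sum[OF h] total_hom_mult[OF h]
      sum_distrib_left sum_distrib_right
    by (subst sum.swap) (simp add: mult.assoc)
  also have "\<dots> = (\<Sum>k<n. if i = k then x k else 0)"
  proof (intro sum.cong refl)
    fix k assume "k \<in> {..<n}"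
    then have "(\<Sum>j<n. A $$ (i, j) * B $$ (j, k)) = (if i = k then 1 else 0)"
      using mat_mult_entry[OF A(1,2) i, of k] A(3) i by simp
    then show "h (\<Sum>j<n. A $$ (i, j) * B $$ (j, k)) * x k = (if i = k then x k else 0)"
      using total_hom_0[OF h] total_hom_1[OF h] by simp
  qed
  also have "\<dots> = x i" using i by simp
  finally show ?thesis .
qed

lemma pair_subst_inj:
  assumes A: "A \<in> carrier_mat v v" "A' \<in> carrier_mat v v" "A * A' = 1\<^sub>m v"
    and B: "B \<in> carrier_mat w w" "B' \<in> carrier_mat w w" "B * B' = 1\<^sub>m w"
  shows "inj (poly_eval poly_const (pair_subst v A w B))"
proof (rule subst_inj)
  fix i
  show "poly_eval poly_const (pair_subst v A' w B') (pair_subst v A w B i) = poly_var i"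
  proof (cases "i < v")
    case True
    then show ?thesis
      using linear_combination_inverse[OF A poly_const_hom True, of poly_var]
      by (simp add: pair_subst_def poly_subst_simps)
  next
    case False
    show ?thesis
    proof (cases "i < v + w")
      case True
      then have "i - v < w" "v + (i - v) = i" using False by auto
      then show ?thesis using False True
          linear_combination_inverse[OF B poly_const_hom, of "i - v" "\<lambda>j. poly_var (v + j)"]
        by (simp add: pair_subst_def poly_subst_simps)
    qed (use False in \<open>simp add: pair_subst_def poly_subst_simps\<close>)
  qed
qed

context
  fixes A :: "'a::field mat" and v :: nat and B :: "'a mat" and w :: nat
  assumes A: "A \<in> carrier (GL v)" and B: "B \<in> carrier (GL w)"
begin

lemma pair_subst_inv_inj: "inj (poly_eval poly_const (pair_subst v (inv\<^bsub>GL v\<^esub> A) w (inv\<^bsub>GL w\<^esub> B)))"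
  by (rule pair_subst_inj[OF GL_inv(1)[OF A] GL_carrier_mat[OF A] GL_inv(3)[OF A]
        GL_inv(1)[OF B] GL_carrier_mat[OF B] GL_inv(3)[OF B]])

lemma pair_act_hom: "ring_hom_total (pair_act v A w B)"
  unfolding pair_act_def by (intro fract_map_hom poly_eval_hom poly_const_hom pair_subst_inv_inj)

lemma pair_act_const: "pair_act v A w B (ratfun_const c) = ratfun_const c"
  unfolding pair_act_def fract_map_poly_eval_const(1)[OF pair_subst_inv_inj poly_const_hom]
  by (simp add: ratfun_const_def)

lemma pair_act_var1:
  "i < v \<Longrightarrow> pair_act v A w B (rvar i) = (\<Sum>j<v. ratfun_const ((inv\<^bsub>GL v\<^esub> A) $$ (i, j)) * rvar j)"
  unfolding pair_act_def fract_map_poly_eval_const(2)[OF pair_subst_inv_inj poly_const_hom]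
  by (simp add: pair_subst_def ratfun_of_poly_simps)

lemma pair_act_var2:
  "i < w \<Longrightarrow> pair_act v A w B (rvar (v + i)) = (\<Sum>j<w. ratfun_const ((inv\<^bsub>GL w\<^esub> B) $$ (i, j)) * rvar (v + j))"
  unfolding pair_act_def fract_map_poly_eval_const(2)[OF pair_subst_inv_inj poly_const_hom]
  by (simp add: pair_subst_def ratfun_of_poly_simps)

end

lemma GL_act_eq_pair_act: "GL_act v A = pair_act v A 0 (1\<^sub>m 0)"
proof -
  have "linear_subst v A' = poly_eval poly_const (pair_subst v A' 0 B')" for A' B' :: "'a mat"
  proof -
    have "pair_subst v A' 0 B' = (\<lambda>i. if i < v then \<Sum>j<v. poly_const (A' $$ (i, j)) * poly_var j else poly_var i)"
      by (rule ext) (simp add: pair_subst_def)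
    then show ?thesis by (simp add: linear_subst_def)
  qed
  then show ?thesis unfolding GL_act_def pair_act_def by simp
qed

lemma GL_act_on_first_factor:
  assumes A: "A \<in> carrier (GL v)" and B: "B \<in> carrier (GL w)" and f: "f \<in> ratfuns UNIV v"
  shows "GL_act v A f = pair_act v A w B f"
proof -
  have o: "1\<^sub>m 0 \<in> carrier (GL 0 :: 'a mat monoid)" by (simp add: GL_iff_det)
  show ?thesis unfolding GL_act_eq_pair_act
    by (rule ratfun_hom_eqI[OF pair_act_hom[OF A o] pair_act_hom[OF A B] f])
      (simp_all add: pair_act_const[OF A o] pair_act_const[OF A B] pair_act_var1[OF A o] pair_act_var1[OF A B])
qed

lemma galois_groupD:
  assumes "\<sigma> \<in> galois_group"
  shows "ring_hom_total \<sigma>" "bij \<sigma>" "\<sigma> (to_ac c) = to_ac c" "c' \<in> base_field \<Longrightarrow> \<sigma> c' = c'"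
proof -
  have "subring_of UNIV = (ring_of_type_algebra :: 'a alg_closure ring)"
    by (simp add: subring_of_def ring_of_type_algebra_def)
  then have "\<sigma> \<in> ring_iso (subring_of UNIV) (subring_of UNIV)" using assms by (simp add: galois_group_def)
  then show "ring_hom_total \<sigma>" "bij \<sigma>" by (auto simp: ring_iso_subring_of)
  show "\<sigma> (to_ac c) = to_ac c" "c' \<in> base_field \<Longrightarrow> \<sigma> c' = c'"
    using assms by (auto simp: galois_group_def base_field_def)
qed

lemma galois_group_inv:
  assumes s: "\<sigma> \<in> galois_group"
  shows "inv_into UNIV \<sigma> \<in> galois_group"
proof -
  note b = galois_groupD(2)[OF s]
  have "hom_on UNIV (inv_into UNIV \<sigma>)"
    by (rule hom_on_inv_into[OF subring_set_UNIV galois_groupD(1)[OF s] b])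
  moreover have "bij (inv_into UNIV \<sigma>)" using b by (rule bij_imp_bij_inv)
  moreover have "inv_into UNIV \<sigma> (to_ac c) = to_ac c" for c
    using inv_f_f[OF bij_is_inj[OF b], of "to_ac c"] galois_groupD(3)[OF s] by simp
  moreover have "subring_of UNIV = (ring_of_type_algebra :: 'a alg_closure ring)"
    by (simp add: subring_of_def ring_of_type_algebra_def)
  ultimately show ?thesis
    using ring_iso_subring_of[of "inv_into UNIV \<sigma>" UNIV UNIV] by (simp add: galois_group_def)
qed

context
  fixes \<sigma> :: "'k::field alg_closure \<Rightarrow> 'k alg_closure"
  assumes s: "\<sigma> \<in> galois_group"
begin

lemma galois_act_eq: "galois_act \<sigma> = fract_map (poly_eval (\<lambda>c. poly_const (\<sigma> c)) poly_var)"
  and galois_subst_inj: "inj (poly_eval (\<lambda>c. poly_const (\<sigma> c)) poly_var :: (nat, 'k alg_closure) mpoly \<Rightarrow> _)"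
proof -
  have 0: "\<sigma> 0 = 0" by (rule total_hom_0[OF galois_groupD(1)[OF s]])
  have eq: "Poly_Mapping.map \<sigma> = (poly_eval (\<lambda>c. poly_const (\<sigma> c)) poly_var :: (nat, 'k alg_closure) mpoly \<Rightarrow> _)"
    using Poly_Mapping_map_eq_poly_eval[of \<sigma>, OF 0] by (rule ext)
  then show "galois_act \<sigma> = fract_map (poly_eval (\<lambda>c. poly_const (\<sigma> c)) poly_var)" by (simp add: galois_act_def)
  have "inj (Poly_Mapping.map \<sigma> :: (nat, 'k alg_closure) mpoly \<Rightarrow> _)"
  proof (rule injI, rule poly_mapping_eqI)
    fix p q :: "(nat, 'k alg_closure) mpoly" and m
    assume "Poly_Mapping.map \<sigma> p = Poly_Mapping.map \<sigma> q"
    then have "\<sigma> (Poly_Mapping.lookup p m) = \<sigma> (Poly_Mapping.lookup q m)"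
      using lookup_map_coeffs[of \<sigma>, OF 0] by metis
    then show "Poly_Mapping.lookup p m = Poly_Mapping.lookup q m"
      using bij_is_inj[OF galois_groupD(2)[OF s]] by (simp add: inj_eq)
  qed
  then show "inj (poly_eval (\<lambda>c. poly_const (\<sigma> c)) poly_var :: (nat, 'k alg_closure) mpoly \<Rightarrow> _)" by (simp add: eq)
qed

lemma galois_const_hom: "ring_hom_total (\<lambda>c. poly_const (\<sigma> c) :: (nat, 'k alg_closure) mpoly)"
  by (rule hom_on_comp[OF galois_groupD(1)[OF s] subset_UNIV poly_const_hom])

lemma galois_act_hom: "ring_hom_total (galois_act \<sigma>)"
  unfolding galois_act_eq by (intro fract_map_hom poly_eval_hom galois_const_hom galois_subst_inj)

lemma galois_act_const: "galois_act \<sigma> (ratfun_const c) = ratfun_const (\<sigma> c)"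
  unfolding galois_act_eq fract_map_poly_eval_const(1)[OF galois_subst_inj galois_const_hom]
  by (simp add: ratfun_const_def)

lemma galois_act_var: "galois_act \<sigma> (rvar i) = rvar i"
  unfolding galois_act_eq fract_map_poly_eval_const(2)[OF galois_subst_inj galois_const_hom]
  by (simp add: ratfun_of_poly_simps)

lemma galois_entry_poly_eval:
  assumes "p \<in> polys base_field ({..<n} \<times> {..<n})" "g \<in> carrier_mat n n"
  shows "entry_poly_eval (map_mat \<sigma> g) p = \<sigma> (entry_poly_eval g p)"
  unfolding hom_poly_eval[OF galois_groupD(1)[OF s]]
  by (rule poly_eval_cong_polys[OF assms(1)]) (use assms(2) galois_groupD(4)[OF s] in auto)

lemma galois_det: "g \<in> carrier_mat n n \<Longrightarrow> det (map_mat \<sigma> g) = \<sigma> (det g)"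
  using hom_on_det[OF subring_set_UNIV galois_groupD(1)[OF s]] by simp

end

text \<open>\<open>G\<close> is cut out by equations over the base field.\<close>

lemma galois_group_preserves:
  assumes G: "linear_algebraic_group n G" and s: "\<sigma> \<in> galois_group" and g: "g \<in> G"
  shows "map_mat \<sigma> g \<in> G"
proof (rule ccontr)
  assume no: "map_mat \<sigma> g \<notin> G"
  note gm = G_mat[OF G g]
  have "map_mat \<sigma> g \<in> carrier_mat n n" using gm by simp
  moreover have "det g \<noteq> 0" using GL_iff_det[OF gm] G_GL[OF G g] by simp
  then have "det (map_mat \<sigma> g) \<noteq> 0"
    unfolding galois_det[OF s gm] by (simp add: field_hom_inverse(2)[OF subfield_set_UNIV galois_groupD(1)[OF s]])
  ultimately have "map_mat \<sigma> g \<in> carrier (GL n)" by (simp add: GL_iff_det)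
  from zariski_closed_separation[OF G_closed[OF G] base_field_subring this no] obtain p where
    p: "p \<in> polys base_field ({..<n} \<times> {..<n})" "entry_poly_eval (map_mat \<sigma> g) p \<noteq> 0"
      "\<forall>h\<in>G. entry_poly_eval h p = 0" by blast
  then show False using g galois_entry_poly_eval[OF s p(1) gm]
    by (simp add: total_hom_0[OF galois_groupD(1)[OF s]])
qed

lemma galois_group_image:
  assumes G: "linear_algebraic_group n G" and s: "\<sigma> \<in> galois_group"
  shows "map_mat \<sigma> ` G = G"
proof
  show "map_mat \<sigma> ` G \<subseteq> G" using galois_group_preserves[OF G s] by blast
  show "G \<subseteq> map_mat \<sigma> ` G"
  proof
    fix g assume g: "g \<in> G"
    have "map_mat \<sigma> (map_mat (inv_into UNIV \<sigma>) g) = g"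
      using galois_groupD(2)[OF s] by (intro eq_matI) (auto simp: bij_is_surj surj_f_inv_f)
    then show "g \<in> map_mat \<sigma> ` G"
      using galois_group_preserves[OF G galois_group_inv[OF s] g] by (metis image_eqI)
  qed
qed

lemma galois_action:
  assumes G: "linear_algebraic_group n G" and s: "\<sigma> \<in> galois_group" and g: "g \<in> G"
    and \<rho>: "linear_action n G v \<rho>" and ij: "i < v" "j < v"
  shows "\<rho> (map_mat \<sigma> g) $$ (i, j) = \<sigma> (\<rho> g $$ (i, j))"
proof -
  note h = galois_groupD(1)[OF s]
  note gm = G_mat[OF G g]
  obtain p d where p: "p \<in> polys base_field ({..<n} \<times> {..<n})"
    "\<And>g. g \<in> G \<Longrightarrow> \<rho> g $$ (i, j) = entry_poly_eval g p / det g ^ d"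
    using \<rho> ij unfolding linear_action_def regular_function_def by blast
  show ?thesis
    unfolding p(2)[OF g] p(2)[OF galois_group_preserves[OF G s g]] galois_entry_poly_eval[OF s p(1) gm] galois_det[OF s gm]
    by (simp add: field_hom_divide[OF subfield_set_UNIV h] total_hom_power[OF h])
qed

lemma fixed_subfield:
  assumes F: "subfield_set F" and \<Theta>: "\<And>\<theta>. \<theta> \<in> \<Theta> \<Longrightarrow> ring_hom_total \<theta>"
  shows "subfield_set {f \<in> F. \<forall>\<theta>\<in>\<Theta>. \<theta> f = f}"
  unfolding subfield_set_def subring_set_def
  by (auto simp: total_hom_1[OF \<Theta>] total_hom_diff[OF \<Theta>] total_hom_mult[OF \<Theta>]
      field_hom_inverse(1)[OF subfield_set_UNIV \<Theta>] intro: subring_setD[OF subfield_setD(1)[OF F]] subfield_setD(2)[OF F])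

lemma ratfuns_mono: "r \<le> s \<Longrightarrow> ratfuns K r \<subseteq> ratfuns K s"
  using polys_mono[of K K "{..<r}" "{..<s}"] by (fastforce simp: ratfuns_def)

text \<open>A polynomial in all variables is a polynomial in the last \<open>w\<close> ones over the field
  generated by the others.\<close>

lemma rational_values_rvar:
  "rational_values (ratfuns UNIV v) w (\<lambda>i. rvar (v + i)) = (ratfuns UNIV (v + w) :: 'a::field ratfun set)"
proof (intro antisym subsetI)
  let ?L = "ratfuns UNIV (v + w) :: 'a ratfun set" and ?F = "ratfuns UNIV v :: 'a ratfun set"
  let ?y = "\<lambda>i. rvar (v + i) :: 'a ratfun"
  note L = ratfuns_subfield[OF subring_set_UNIV, of "v + w", where 'a = 'a]
  fix f assume "f \<in> rational_values ?F w ?y"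
  then obtain p q where pq: "p \<in> polys ?F {..<w}" "q \<in> polys ?F {..<w}" "f = value_at ?y p / value_at ?y q"
    by (auto simp: rational_values_def)
  have "value_at ?y p \<in> ?L" if "p \<in> polys ?F {..<w}" for p
    using ratfuns_mono[of v "v + w" UNIV]
    by (intro poly_eval_polys_in_subring[OF subfield_setD(1)[OF L] that]) (auto intro: rvar_in_ratfuns)
  then show "f \<in> ?L" using pq subfield_setD(3)[OF L] by blast
next
  let ?F = "ratfuns UNIV v :: 'a ratfun set" and ?y = "\<lambda>i. rvar (v + i) :: 'a ratfun"
  note F = subfield_setD(1)[OF ratfuns_subfield[OF subring_set_UNIV, of v, where 'a = 'a]]
  fix f :: "'a ratfun" assume "f \<in> ratfuns UNIV (v + w)"
  then obtain p q where pq: "p \<in> polys UNIV {..<v + w}" "q \<in> polys UNIV {..<v + w}" "q \<noteq> 0"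
    "f = ratfun_of_poly p / ratfun_of_poly q" by (rule ratfunsE)
  define s :: "(nat, 'a) mpoly \<Rightarrow> (nat, 'a ratfun) mpoly" where "s = poly_eval (\<lambda>c. poly_const (ratfun_const c))
    (\<lambda>i. if i < v then poly_const (rvar i) else poly_var (i - v))"
  have s: "s p \<in> polys ?F {..<w}" "value_at ?y (s p) = ratfun_of_poly p" if p: "p \<in> polys UNIV {..<v + w}" for p
  proof -
    show "s p \<in> polys ?F {..<w}" unfolding s_def
      by (rule poly_eval_polys_in_subring[OF polys_subring[OF F] p])
        (auto intro!: polys_const polys_var ratfun_const_in_ratfuns rvar_in_ratfuns subring_setD[OF F])
    show "value_at ?y (s p) = ratfun_of_poly p" unfolding s_def hom_poly_eval[OF value_at_hom]
      by (rule poly_eval_cong_polys[OF p]) (auto simp: value_at_simps)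
  qed
  show "f \<in> rational_values ?F w ?y"
    unfolding rational_values_def using pq s(1)[OF pq(1)] s(1)[OF pq(2)]
    by (intro CollectI exI[of _ "s p"] exI[of _ "s q"]) (simp add: s(2) ratfun_of_poly_eq_0_iff)
qed

definition pair_invariants where
  "pair_invariants G v \<rho> w \<tau> = {f \<in> ratfuns UNIV (v + w).
     (\<forall>g\<in>G. pair_act v (\<rho> g) w (\<tau> g) f = f) \<and> (\<forall>\<sigma>\<in>galois_group. galois_act \<sigma> f = f)}"

text \<open>The relation between \<open>\<tau> g\<close>, \<open>x\<close> and \<open>g x\<close> is carried from points over the ground field to the generic
  point \<open>x\<close>, whose coordinates are the variables. There it yields a covariant frame for the coordinates of the
  second summand.\<close>

theorem no_name_lemma:
  fixes G :: "'k::field_char_0 alg_closure mat set" and \<rho> \<tau> :: "'k alg_closure mat \<Rightarrow> 'k alg_closure mat"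
  assumes G: "linear_algebraic_group n G" and \<rho>: "linear_action n G v \<rho>" and free: "almost_free n G v \<rho>"
    and \<tau>: "linear_action n G w \<tau>"
  shows "subfield_set (invariant_field G v \<rho>)"
    and "\<exists>\<Phi>\<in>ring_iso (subring_of (ratfuns (invariant_field G v \<rho>) w)) (subring_of (pair_invariants G v \<rho> w \<tau>)).
      \<forall>c\<in>invariant_field G v \<rho>. \<Phi> (ratfun_const c) = c"
proof -
  let ?F = "ratfuns UNIV v :: 'k alg_closure ratfun set"
  note F = ratfuns_subfield[OF subring_set_UNIV, of v, where 'a = "'k alg_closure"]
  note Fr = subfield_setD(1)[OF F]
  note \<rho>GL = action_GL[OF G \<rho>] and \<tau>GL = action_GL[OF G \<tau>]
  note \<rho>m = action_mat[OF G \<rho>] and \<tau>m = action_mat[OF G \<tau>]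
  define \<Theta> where "\<Theta> = (\<lambda>g. pair_act v (\<rho> g) w (\<tau> g)) ` G \<union> galois_act ` galois_group"
  have \<Theta>: "ring_hom_total \<theta>" if "\<theta> \<in> \<Theta>" for \<theta>
    using that pair_act_hom[OF \<rho>GL \<tau>GL] by (auto simp: \<Theta>_def galois_act_hom)
  have cF: "ratfun_const c \<in> ?F" for c by (intro ratfun_const_in_ratfuns) auto
  have vF: "rvar i \<in> ?F" if "i < v" for i by (intro rvar_in_ratfuns that) auto
  have \<Theta>F: "\<theta> f \<in> ?F" if t: "\<theta> \<in> \<Theta>" and f: "f \<in> ?F" for \<theta> f
  proof (rule hom_ratfuns_mem[OF \<Theta>[OF t] f F])
    show "\<theta> (ratfun_const c) \<in> ?F" for c
      using t cF pair_act_const[OF \<rho>GL \<tau>GL] by (auto simp: \<Theta>_def galois_act_const)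
    show "\<theta> (rvar i) \<in> ?F" if "i < v" for i
      using t cF vF that pair_act_var1[OF \<rho>GL \<tau>GL]
      by (auto simp: \<Theta>_def galois_act_var intro!: subring_set_sum[OF Fr] subring_setD(6)[OF Fr])
  qed
  have inv_eq: "invariant_field G v \<rho> = {f \<in> ?F. \<forall>\<theta>\<in>\<Theta>. \<theta> f = f}"
    unfolding invariant_field_def \<Theta>_def
    by (auto simp: GL_act_on_first_factor[OF \<rho>GL \<tau>GL])
  show Esub: "subfield_set (invariant_field G v \<rho>)"
    unfolding inv_eq by (rule fixed_subfield[OF F \<Theta>])
  have pair_eq: "pair_invariants G v \<rho> w \<tau> = {f \<in> ratfuns UNIV (v + w). \<forall>\<theta>\<in>\<Theta>. \<theta> f = f}"
    unfolding pair_invariants_def \<Theta>_def by auto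
  \<comment> \<open>the points \<open>(x, g x)\<close> for generic \<open>x\<close>\<close>
  define pt where "pt g = orbit_point v (map_mat ratfun_const (\<rho> g)) rvar" for g
  \<comment> \<open>A monomial in the coordinates of \<open>(x, g x)\<close> splits into its parts
    \<open>low m\<close> in \<open>x\<close> and \<open>e m g\<close> in \<open>g x\<close>.\<close>
  define e where "e m g = (\<Prod>k\<in>Poly_Mapping.keys m - {..<v}. pt g k ^ Poly_Mapping.lookup m k)" for m g
  define low :: "_ \<Rightarrow> 'k alg_closure ratfun" where
    "low m = (\<Prod>k\<in>Poly_Mapping.keys m \<inter> {..<v}. rvar k ^ Poly_Mapping.lookup m k)" for m
  have mono: "mono_eval (pt g) m = low m * e m g" for g m
  proof -
    have "mono_eval (pt g) m = (\<Prod>k\<in>Poly_Mapping.keys m \<inter> {..<v}. pt g k ^ Poly_Mapping.lookup m k)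
        * (\<Prod>k\<in>Poly_Mapping.keys m - {..<v}. pt g k ^ Poly_Mapping.lookup m k)"
      unfolding mono_eval_def
      by (subst prod.union_disjoint[symmetric]) (auto intro!: prod.cong)
    also have "(\<Prod>k\<in>Poly_Mapping.keys m \<inter> {..<v}. pt g k ^ Poly_Mapping.lookup m k) = low m"
      unfolding low_def by (intro prod.cong) (auto simp: pt_def)
    finally show ?thesis by (simp add: e_def)
  qed
  have lowF: "low m \<in> ?F" for m
    unfolding low_def by (intro subring_set_prod[OF Fr] subring_setD(7)[OF Fr] vF) auto
  have pt_high: "pt g (v + i) = (\<Sum>j<v. ratfun_const (\<rho> g $$ (i, j)) * rvar j)" if "g \<in> G" "i < v" for g i
    using \<rho>m[OF that(1)] that(2) by (auto simp: pt_def orbit_point_def intro!: sum.cong)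
  obtain c b a where c: "c \<in> polys UNIV {..<v}" and b: "b \<in> polys UNIV {..<v + v}"
    and a: "\<And>i j. a i j \<in> polys UNIV {..<v + v}"
    and nz: "\<exists>g\<in>G. \<exists>x. value_at x c \<noteq> 0 \<and> value_at (orbit_point v (\<rho> g) x) b \<noteq> 0"
    and rel: "\<And>g x i j. g \<in> G \<Longrightarrow> value_at x c \<noteq> 0 \<Longrightarrow> i < w \<Longrightarrow> j < w \<Longrightarrow>
      value_at (orbit_point v (\<rho> g) x) b * \<tau> g $$ (i, j) = value_at (orbit_point v (\<rho> g) x) (a i j)"
    using rational_group_element[OF G \<rho> free \<tau>] by blast
  \<comment> \<open>an identity at all points of a non-empty open set holds at the generic point\<close>
  define gen where "gen g = poly_eval poly_const (orbit_point v (map_mat poly_const (\<rho> g)) poly_var)" for g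
  have gen_pt: "ratfun_of_poly (gen g p) = poly_eval ratfun_const (pt g) p"
    and gen_val: "value_at x (gen g p) = value_at (orbit_point v (\<rho> g) x) p"
    if g: "g \<in> G" and p: "p \<in> polys UNIV {..<v + v}" for g p x
  proof -
    show "ratfun_of_poly (gen g p) = poly_eval ratfun_const (pt g) p"
      unfolding gen_def hom_poly_eval[OF poly_eval_hom[OF ratfun_const_hom]]
      using \<rho>m[OF g] by (intro poly_eval_cong_polys[OF p]) (auto simp: ratfun_of_poly_simps pt_def orbit_point_def)
    show "value_at x (gen g p) = value_at (orbit_point v (\<rho> g) x) p"
      unfolding gen_def hom_poly_eval[OF value_at_hom]
      using \<rho>m[OF g] by (intro poly_eval_cong_polys[OF p]) (auto simp: value_at_simps orbit_point_def)
  qed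
  have c0: "c \<noteq> 0" using nz by (auto simp: value_at_simps)
  have rel_gen: "poly_eval ratfun_const (pt g) b * ratfun_const (\<tau> g $$ (i, j)) = poly_eval ratfun_const (pt g) (a i j)"
    if g: "g \<in> G" and ij: "i < w" "j < w" for g i j
  proof -
    let ?d = "gen g b * poly_const (\<tau> g $$ (i, j)) - gen g (a i j)"
    have "value_at x (c * ?d) = 0" for x
      using rel[OF g _ ij, of x] by (cases "value_at x c = 0") (simp_all add: value_at_simps gen_val[OF g] a b)
    then have "c * ?d = 0" using nonzero_at_power_of_2_point by blast
    then have "?d = 0" using c0 by simp
    then have "ratfun_of_poly (gen g b * poly_const (\<tau> g $$ (i, j))) = ratfun_of_poly (gen g (a i j))" by simp
    then show ?thesis by (simp add: ratfun_of_poly_simps gen_pt[OF g] a b)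
  qed
  obtain g0 where g0: "g0 \<in> G" "poly_eval ratfun_const (pt g0) b \<noteq> 0"
  proof -
    obtain g x where g: "g \<in> G" "value_at (orbit_point v (\<rho> g) x) b \<noteq> 0" using nz by blast
    then have "gen g b \<noteq> 0" using gen_val[OF g(1) b, of x] by (auto simp: value_at_simps)
    then show ?thesis using that[OF g(1)] gen_pt[OF g(1) b] by (simp add: ratfun_of_poly_eq_0_iff[symmetric])
  qed
  define T where "T = Poly_Mapping.keys b \<union> (\<Union>i<w. \<Union>j<w. Poly_Mapping.keys (a i j))"
  have T: "finite T" by (simp add: T_def)
  have T_keys: "k < v + v" if "m \<in> T" "k \<in> Poly_Mapping.keys m" for m k
    using that polysD(2)[OF b, of m k] polysD(2)[OF a, of m _ _ k] by (auto simp: T_def)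
  have expand: "poly_eval ratfun_const (pt g) p = (\<Sum>m\<in>T. (ratfun_const (Poly_Mapping.lookup p m) * low m) * e m g)"
    if "Poly_Mapping.keys p \<subseteq> T" for g p
    unfolding poly_eval_superset[OF ratfun_const_hom T that] mono by (simp add: mult.assoc)
  have keysT: "Poly_Mapping.keys b \<subseteq> T" "i < w \<Longrightarrow> j < w \<Longrightarrow> Poly_Mapping.keys (a i j) \<subseteq> T" for i j
    by (auto simp: T_def)
  define y where "y i = (rvar (v + i) :: 'k alg_closure ratfun)" for i
  define t where "t g i j = ratfun_const (\<tau> g $$ (i, j))" for g i j
  have e_move: "e m g' = \<theta> (e m g)"
    if h: "ring_hom_total \<theta>" and m: "m \<in> T" and pt: "\<And>i. i < v \<Longrightarrow> \<theta> (pt g (v + i)) = pt g' (v + i)" for m g g' \<theta>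
  proof -
    have "\<theta> (pt g k) = pt g' k" if "k \<in> Poly_Mapping.keys m - {..<v}" for k
      using pt[of "k - v"] T_keys[OF m, of k] that by auto
    then show ?thesis unfolding e_def
      by (simp add: total_hom_prod[OF h] total_hom_power[OF h])
  qed
  define good where "good \<theta> N \<longleftrightarrow> (\<forall>i j. N i j \<in> ?F) \<and> (\<forall>i<w. \<theta> (y i) = (\<Sum>j<w. N i j * y j)) \<and>
    (\<exists>\<pi>. \<pi> ` G = G \<and> (\<forall>g\<in>G. \<forall>m\<in>T. e m (\<pi> g) = \<theta> (e m g)) \<and>
      (\<forall>g\<in>G. \<forall>i<w. \<forall>k<w. t (\<pi> g) i k = (\<Sum>j<w. \<theta> (t g i j) * N j k)))" for \<theta> N
  have goodI: "good \<theta> N"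
    if "\<And>i j. N i j \<in> ?F" "\<And>i. i < w \<Longrightarrow> \<theta> (y i) = (\<Sum>j<w. N i j * y j)" "\<pi> ` G = G"
      "\<And>g m. g \<in> G \<Longrightarrow> m \<in> T \<Longrightarrow> e m (\<pi> g) = \<theta> (e m g)"
      "\<And>g i k. g \<in> G \<Longrightarrow> i < w \<Longrightarrow> k < w \<Longrightarrow> t (\<pi> g) i k = (\<Sum>j<w. \<theta> (t g i j) * N j k)" for \<theta> N \<pi>
    unfolding good_def by (intro conjI exI[of _ \<pi>]) (simp_all add: that)
  have "\<exists>N. good \<theta> N" if "\<theta> \<in> \<Theta>" for \<theta>
    using that unfolding \<Theta>_def
  proof (elim UnE imageE)
    \<comment> \<open>\<open>h\<close> acts on functions by \<open>x \<mapsto> h\<^sup>-\<^sup>1 x\<close>,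
      and \<open>g h\<^sup>-\<^sup>1 x\<close> is the image of \<open>h\<^sup>-\<^sup>1 x\<close> under
      \<open>g\<close>\<close>
    fix h assume h: "h \<in> G" and \<theta>: "\<theta> = pair_act v (\<rho> h) w (\<tau> h)"
    note hom = pair_act_hom[OF \<rho>GL[OF h] \<tau>GL[OF h]]
    let ?h = "inv\<^bsub>GL n\<^esub> h"
    define N where "N i j = ratfun_const ((inv\<^bsub>GL w\<^esub> (\<tau> h)) $$ (i, j))" for i j
    have hi: "?h \<in> G" by (rule G_inv[OF G h])
    have act: "\<phi> (g * ?h) $$ (i, k) = (\<Sum>j<r. \<phi> g $$ (i, j) * (inv\<^bsub>GL r\<^esub> (\<phi> h)) $$ (j, k))"
      if "linear_action n G r \<phi>" "g \<in> G" "i < r" "k < r" for \<phi> r g i k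
      using action_mult[OF G that(1,2) hi] action_inv[OF G that(1) h]
        mat_mult_entry[OF action_mat[OF G that(1,2)] action_mat[OF G that(1) hi] that(3,4)] by simp
    have "(\<lambda>g. g * ?h) ` G = G"
    proof
      show "(\<lambda>g. g * ?h) ` G \<subseteq> G" using G_mult[OF G _ hi] by auto
      show "G \<subseteq> (\<lambda>g. g * ?h) ` G"
      proof
        fix g assume g: "g \<in> G"
        have "g * h * ?h = g"
          using assoc_mult_mat[OF G_mat[OF G g] G_mat[OF G h] G_mat[OF G hi]] GL_inv(2)[OF G_GL[OF G h]] G_mat[OF G g] by simp
        then show "g \<in> (\<lambda>g. g * ?h) ` G" using G_mult[OF G g h] by (metis image_eqI)
      qed
    qed
    moreover have "e m (g * ?h) = \<theta> (e m g)" if g: "g \<in> G" and m: "m \<in> T" for g m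
    proof (rule e_move[OF _ m])
      fix i assume i: "i < v"
      have "\<theta> (pt g (v + i)) = (\<Sum>j<v. ratfun_const (\<rho> g $$ (i, j)) *
          (\<Sum>k<v. ratfun_const ((inv\<^bsub>GL v\<^esub> (\<rho> h)) $$ (j, k)) * rvar k))"
        unfolding \<theta> pt_high[OF g i]
        by (simp add: total_hom_sum[OF hom] total_hom_mult[OF hom]
            pair_act_const[OF \<rho>GL[OF h] \<tau>GL[OF h]] pair_act_var1[OF \<rho>GL[OF h] \<tau>GL[OF h]])
      also have "\<dots> = (\<Sum>k<v. ratfun_const (\<Sum>j<v. \<rho> g $$ (i, j) * (inv\<^bsub>GL v\<^esub> (\<rho> h)) $$ (j, k)) * rvar k)"
        unfolding ratfun_const_ops sum_distrib_left sum_distrib_right by (subst sum.swap) (simp add: mult.assoc)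
      also have "\<dots> = pt (g * ?h) (v + i)"
        unfolding pt_high[OF G_mult[OF G g hi] i] using act[OF \<rho> g i] by (intro sum.cong) auto
      finally show "\<theta> (pt g (v + i)) = pt (g * ?h) (v + i)" .
    qed (use hom \<theta> in simp)
    moreover have "t (g * ?h) i k = (\<Sum>j<w. \<theta> (t g i j) * N j k)" if "g \<in> G" "i < w" "k < w" for g i k
      unfolding t_def act[OF \<tau> that] N_def \<theta> pair_act_const[OF \<rho>GL[OF h] \<tau>GL[OF h]] by (simp add: ratfun_const_ops)
    moreover have "\<theta> (y i) = (\<Sum>j<w. N i j * y j)" if "i < w" for i
      using pair_act_var2[OF \<rho>GL[OF h] \<tau>GL[OF h] that] by (simp add: N_def y_def \<theta>)
    moreover have "N i j \<in> ?F" for i j by (simp add: N_def cF)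
    ultimately have "good \<theta> N" by (intro goodI[where \<pi> = "\<lambda>g. g * ?h"])
    then show ?thesis by blast
  next
    \<comment> \<open>\<open>x\<close> has rational coordinates, so an automorphism of the ground field
      moves \<open>g x\<close> to \<open>\<sigma>(g) x\<close>\<close>
    fix \<sigma> assume s: "\<sigma> \<in> galois_group" and \<theta>: "\<theta> = galois_act \<sigma>"
    note hom = galois_act_hom[OF s]
    define N where "N i j = (if i = j then 1 else 0 :: 'k alg_closure ratfun)" for i j :: nat
    have N1: "(\<Sum>j<w. x j * N j k) = x k" "(\<Sum>j<w. N k j * x j) = x k" if "k < w" for x k
      using that by (auto simp: N_def sum.remove[of "{..<w}" k] intro: sum.neutral)
    have "e m (map_mat \<sigma> g) = \<theta> (e m g)" if g: "g \<in> G" and m: "m \<in> T" for g m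
    proof (rule e_move[OF _ m])
      fix i assume i: "i < v"
      show "\<theta> (pt g (v + i)) = pt (map_mat \<sigma> g) (v + i)"
        unfolding \<theta> pt_high[OF g i] pt_high[OF galois_group_preserves[OF G s g] i]
        using galois_action[OF G s g \<rho> i]
        by (simp add: total_hom_sum[OF hom] total_hom_mult[OF hom]
            galois_act_const[OF s] galois_act_var[OF s])
    qed (use hom \<theta> in simp)
    moreover have "t (map_mat \<sigma> g) i k = (\<Sum>j<w. \<theta> (t g i j) * N j k)" if "g \<in> G" "i < w" "k < w" for g i k
      using galois_action[OF G s that(1) \<tau> that(2,3)] unfolding N1(1)[OF that(3)]
      by (simp add: t_def \<theta> galois_act_const[OF s])
    moreover have "\<theta> (y i) = (\<Sum>j<w. N i j * y j)" if "i < w" for i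
      unfolding N1(2)[OF that] by (simp add: y_def \<theta> galois_act_var[OF s])
    moreover have "N i j \<in> ?F" for i j using subring_setD(1,2)[OF Fr] by (simp add: N_def)
    ultimately have "good \<theta> N"
      by (intro goodI[where \<pi> = "map_mat \<sigma>"] galois_group_image[OF G s])
    then show ?thesis by blast
  qed
  then obtain N where N: "\<And>\<theta>. \<theta> \<in> \<Theta> \<Longrightarrow> good \<theta> (N \<theta>)" by metis
  have det_t: "det (mat w w (\<lambda>(i, j). t g i j)) \<noteq> 0" if g: "g \<in> G" for g
  proof -
    have "mat w w (\<lambda>(i, j). t g i j) = map_mat ratfun_const (\<tau> g)"
      using \<tau>m[OF g] by (intro eq_matI) (auto simp: t_def)
    then have "det (mat w w (\<lambda>(i, j). t g i j)) = ratfun_const (det (\<tau> g))"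
      using hom_on_det[OF subring_set_UNIV ratfun_const_hom \<tau>m[OF g]] by simp
    moreover have "det (\<tau> g) \<noteq> 0" using GL_iff_det[OF \<tau>m[OF g]] \<tau>GL[OF g] by simp
    ultimately show ?thesis by (metis ratfun_const_eq_iff ratfun_const_simps(1))
  qed
  have "\<exists>Q. (\<forall>i j. Q i j \<in> ?F) \<and> det (mat w w (\<lambda>(i, j). Q i j)) \<noteq> 0 \<and>
    (\<forall>\<theta>\<in>\<Theta>. \<forall>i<w. \<forall>k<w. (\<Sum>j<w. \<theta> (Q i j) * N \<theta> j k) = Q i k)"
  proof (rule covariant_frame[where T = T and e = e and G = G and \<tau> = t and ?g0.0 = g0
        and b = "\<lambda>m. ratfun_const (Poly_Mapping.lookup b m) * low m"
        and a = "\<lambda>i j m. ratfun_const (Poly_Mapping.lookup (a i j) m) * low m"])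
    show "N \<theta> i j \<in> ?F" if "\<theta> \<in> \<Theta>" for \<theta> i j using N[OF that] by (simp add: good_def)
    show "\<exists>\<pi>. \<pi> ` G = G \<and> (\<forall>g\<in>G. \<forall>m\<in>T. e m (\<pi> g) = \<theta> (e m g)) \<and>
      (\<forall>g\<in>G. \<forall>i<w. \<forall>k<w. t (\<pi> g) i k = (\<Sum>j<w. \<theta> (t g i j) * N \<theta> j k))" if "\<theta> \<in> \<Theta>" for \<theta>
      using N[OF that] by (simp add: good_def)
    show "(\<Sum>m\<in>T. ratfun_const (Poly_Mapping.lookup b m) * low m * e m g) * t g i j =
      (\<Sum>m\<in>T. ratfun_const (Poly_Mapping.lookup (a i j) m) * low m * e m g)" if "g \<in> G" "i < w" "j < w" for g i j
      using rel_gen[OF that] unfolding expand[OF keysT(1)] expand[OF keysT(2)[OF that(2,3)]] t_def .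
    show "(\<Sum>m\<in>T. ratfun_const (Poly_Mapping.lookup b m) * low m * e m g0) \<noteq> 0"
      using g0(2) unfolding expand[OF keysT(1)] .
    show "det (mat w w (\<lambda>(i, j). t g i j)) \<noteq> 0" if "g \<in> G" for g by (rule det_t[OF that])
  qed (auto intro: \<Theta> \<Theta>F F T g0 subring_setD(6)[OF Fr] cF lowF)
  then obtain Q where Q: "\<And>i j. Q i j \<in> ?F" "det (mat w w (\<lambda>(i, j). Q i j)) \<noteq> 0"
    "\<And>\<theta> i k. \<theta> \<in> \<Theta> \<Longrightarrow> i < w \<Longrightarrow> k < w \<Longrightarrow> (\<Sum>j<w. \<theta> (Q i j) * N \<theta> j k) = Q i k" by blast
  obtain P where P: "\<And>i j. P i j \<in> ?F"
    "\<And>i k. i < w \<Longrightarrow> k < w \<Longrightarrow> (\<Sum>j<w. P i j * Q j k) = (if i = k then 1 else 0)"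
    "\<And>i k. i < w \<Longrightarrow> k < w \<Longrightarrow> (\<Sum>j<w. Q i j * P j k) = (if i = k then 1 else 0)"
    using subfield_matrix_inverse[OF F Q(1,2)] by blast
  define z where "z i = (\<Sum>j<w. Q i j * y j)" for i
  have y_ind: "independent_over ?F {..<w} y"
    unfolding independent_over_def y_def[abs_def] using rvar_independent by blast
  have \<Theta>y: "\<theta> (y i) = (\<Sum>j<w. N \<theta> i j * y j)" if "\<theta> \<in> \<Theta>" "i < w" for \<theta> i
    using N[OF that(1)] that(2) by (simp add: good_def)
  note nn_rule = no_name_field[where \<Theta> = \<Theta> and F = ?F and y = y and z = z and Q = Q and P = P and N = N and w = w]
  have nn: "independent_over ?F {..<w} z"
    by (rule nn_rule(1), (rule \<Theta>, assumption), (rule \<Theta>F, assumption, assumption), rule F, rule y_ind,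
        (rule \<Theta>y, assumption, assumption), rule Q(1), rule P(1), (rule P(2), assumption, assumption),
        (rule P(3), assumption, assumption), (rule Q(3), assumption, assumption, assumption), rule z_def)
  have nn': "{f \<in> rational_values ?F w y. \<forall>\<theta>\<in>\<Theta>. \<theta> f = f} = rational_values {f \<in> ?F. \<forall>\<theta>\<in>\<Theta>. \<theta> f = f} w z"
    by (rule nn_rule(2), (rule \<Theta>, assumption), (rule \<Theta>F, assumption, assumption), rule F, rule y_ind,
        (rule \<Theta>y, assumption, assumption), rule Q(1), rule P(1), (rule P(2), assumption, assumption),
        (rule P(3), assumption, assumption), (rule Q(3), assumption, assumption, assumption), rule z_def)
  have "pair_invariants G v \<rho> w \<tau> = rational_values (invariant_field G v \<rho>) w z"
    unfolding pair_eq inv_eq nn'[symmetric] y_def[abs_def] rational_values_rvar ..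
  moreover have "independent_over (invariant_field G v \<rho>) {..<w} z"
    using nn polys_mono[of "invariant_field G v \<rho>" ?F "{..<w}" "{..<w}"]
    unfolding independent_over_def inv_eq by blast
  ultimately show "\<exists>\<Phi>\<in>ring_iso (subring_of (ratfuns (invariant_field G v \<rho>) w)) (subring_of (pair_invariants G v \<rho> w \<tau>)).
      \<forall>c\<in>invariant_field G v \<rho>. \<Phi> (ratfun_const c) = c"
    using ratfuns_iso_rational_values[OF Esub] by simp
qed

section \<open>Exchanging the summands\<close>

definition swap_index :: "nat \<Rightarrow> nat \<Rightarrow> nat \<Rightarrow> nat" where
  "swap_index v w i = (if i < v then w + i else if i < v + w then i - v else i)"

definition swap_vars :: "nat \<Rightarrow> nat \<Rightarrow> 'a::field ratfun \<Rightarrow> 'a ratfun" where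
  "swap_vars v w = fract_map (poly_eval poly_const (\<lambda>i. poly_var (swap_index v w i)))"

lemma swap_index_inverse: "swap_index w v (swap_index v w i) = i"
  by (auto simp: swap_index_def)

lemma swap_subst_inj: "inj (poly_eval poly_const (\<lambda>i. poly_var (swap_index v w i)) :: (nat, 'a::field) mpoly \<Rightarrow> _)"
  by (rule subst_inj[of "\<lambda>i. poly_var (swap_index w v i)"]) (simp add: poly_subst_simps swap_index_inverse)

lemma swap_vars_hom: "ring_hom_total (swap_vars v w)"
  unfolding swap_vars_def by (intro fract_map_hom poly_eval_hom poly_const_hom swap_subst_inj)

lemma swap_vars_const: "swap_vars v w (ratfun_const c) = ratfun_const c"
  unfolding swap_vars_def fract_map_poly_eval_const(1)[OF swap_subst_inj poly_const_hom]
  by (simp add: ratfun_const_def)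

lemma swap_vars_var: "swap_vars v w (rvar i) = rvar (swap_index v w i)"
  unfolding swap_vars_def fract_map_poly_eval_const(2)[OF swap_subst_inj poly_const_hom]
  by (simp add: ratfun_of_poly_simps)

lemma swap_vars_ratfuns: "f \<in> ratfuns UNIV (v + w) \<Longrightarrow> swap_vars v w f \<in> ratfuns UNIV (w + v)"
  by (rule hom_ratfuns_mem[OF swap_vars_hom _ ratfuns_subfield[OF subring_set_UNIV]])
    (auto simp: swap_vars_const swap_vars_var swap_index_def intro: ratfun_const_in_ratfuns rvar_in_ratfuns)

lemma swap_vars_inverse: "f \<in> ratfuns UNIV (v + w) \<Longrightarrow> swap_vars w v (swap_vars v w f) = f"
  by (rule ratfun_hom_eqI[OF hom_on_comp[OF swap_vars_hom subset_UNIV swap_vars_hom] hom_on_id])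
    (auto simp: swap_vars_const swap_vars_var swap_index_inverse)

lemma swap_vars_pair_act:
  assumes A: "A \<in> carrier (GL v)" and B: "B \<in> carrier (GL w)" and f: "f \<in> ratfuns UNIV (v + w)"
  shows "swap_vars v w (pair_act v A w B f) = pair_act w B v A (swap_vars v w f)"
proof (rule ratfun_hom_eqI[OF hom_on_comp[OF pair_act_hom[OF A B] subset_UNIV swap_vars_hom]
      hom_on_comp[OF swap_vars_hom subset_UNIV pair_act_hom[OF B A]] f])
  show "swap_vars v w (pair_act v A w B (ratfun_const c)) = pair_act w B v A (swap_vars v w (ratfun_const c))" for c
    by (simp add: pair_act_const[OF A B] pair_act_const[OF B A] swap_vars_const)
  fix i assume i: "i < v + w"
  note h = swap_vars_hom[of v w, where 'a = 'a]
  note hs = total_hom_sum[OF h] total_hom_mult[OF h]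
  show "swap_vars v w (pair_act v A w B (rvar i)) = pair_act w B v A (swap_vars v w (rvar i))"
  proof (cases "i < v")
    case True
    then show ?thesis
      by (simp add: pair_act_var1[OF A B] hs swap_vars_const swap_vars_var swap_index_def pair_act_var2[OF B A])
  next
    case False
    then obtain j where "i = v + j" "j < w" using i by (metis add_diff_inverse nat_add_left_cancel_less)
    then show ?thesis
      by (simp add: pair_act_var2[OF A B] hs swap_vars_const swap_vars_var swap_index_def pair_act_var1[OF B A])
  qed
qed

lemma swap_vars_galois_act:
  assumes s: "\<sigma> \<in> galois_group" and f: "f \<in> ratfuns UNIV (v + w)"
  shows "swap_vars v w (galois_act \<sigma> f) = galois_act \<sigma> (swap_vars v w f)"
  by (rule ratfun_hom_eqI[OF hom_on_comp[OF galois_act_hom[OF s] subset_UNIV swap_vars_hom]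
      hom_on_comp[OF swap_vars_hom subset_UNIV galois_act_hom[OF s]] f])
    (simp_all add: galois_act_const[OF s] galois_act_var[OF s] swap_vars_const swap_vars_var)

lemma swap_vars_pair_invariants:
  assumes G: "linear_algebraic_group n G" and \<rho>: "linear_action n G v \<rho>" and \<tau>: "linear_action n G w \<tau>"
  shows "bij_betw (swap_vars v w) (pair_invariants G v \<rho> w \<tau>) (pair_invariants G w \<tau> v \<rho>)"
proof (rule bij_betw_byWitness[of _ "swap_vars w v"])
  have sub: "swap_vars v w ` pair_invariants G v \<rho> w \<tau> \<subseteq> pair_invariants G w \<tau> v \<rho>"
    if \<rho>: "linear_action n G v \<rho>" and \<tau>: "linear_action n G w \<tau>" for v w \<rho> \<tau>
  proof
    fix x assume "x \<in> swap_vars v w ` pair_invariants G v \<rho> w \<tau>"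
    then obtain f where f: "x = swap_vars v w f" "f \<in> ratfuns UNIV (v + w)"
      "\<And>g. g \<in> G \<Longrightarrow> pair_act v (\<rho> g) w (\<tau> g) f = f" "\<And>\<sigma>. \<sigma> \<in> galois_group \<Longrightarrow> galois_act \<sigma> f = f"
      by (auto simp: pair_invariants_def)
    have "pair_act w (\<tau> g) v (\<rho> g) x = x" if "g \<in> G" for g
      using swap_vars_pair_act[OF action_GL[OF G \<rho> that] action_GL[OF G \<tau> that] f(2)] f(3)[OF that] f(1) by simp
    moreover have "galois_act \<sigma> x = x" if "\<sigma> \<in> galois_group" for \<sigma>
      using swap_vars_galois_act[OF that f(2)] f(4)[OF that] f(1) by simp
    ultimately show "x \<in> pair_invariants G w \<tau> v \<rho>"
      using swap_vars_ratfuns[OF f(2)] f(1) by (simp add: pair_invariants_def)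
  qed
  show "swap_vars v w ` pair_invariants G v \<rho> w \<tau> \<subseteq> pair_invariants G w \<tau> v \<rho>"
    "swap_vars w v ` pair_invariants G w \<tau> v \<rho> \<subseteq> pair_invariants G v \<rho> w \<tau>"
    by (rule sub[OF \<rho> \<tau>], rule sub[OF \<tau> \<rho>])
qed (auto simp: pair_invariants_def swap_vars_inverse)

lemma base_field_invariant:
  assumes G: "linear_algebraic_group n G" and \<rho>: "linear_action n G v \<rho>" and c: "c \<in> base_field"
  shows "ratfun_const c \<in> invariant_field G v \<rho>"
proof -
  have o: "1\<^sub>m 0 \<in> carrier (GL 0 :: 'a alg_closure mat monoid)" by (simp add: GL_iff_det)
  have "GL_act v (\<rho> g) (ratfun_const c) = ratfun_const c" if "g \<in> G" for g
    unfolding GL_act_eq_pair_act by (rule pair_act_const[OF action_GL[OF G \<rho> that] o])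
  then show ?thesis
    using galois_groupD(4)[OF _ c] by (auto simp: invariant_field_def galois_act_const intro: ratfun_const_in_ratfuns)
qed

text \<open>Both fields become the invariant field of the direct sum after adjoining the coordinates of the
  other summand.\<close>

theorem stably_isomorphic_invariant_fields:
  fixes G :: "'k::field_char_0 alg_closure mat set" and \<rho> \<tau> :: "'k alg_closure mat \<Rightarrow> 'k alg_closure mat"
  assumes G: "linear_algebraic_group n G"
    and \<rho>: "linear_action n G v \<rho>" "almost_free n G v \<rho>" and \<tau>: "linear_action n G w \<tau>" "almost_free n G w \<tau>"
  shows "\<exists>h\<in>ring_iso (subring_of (ratfuns (invariant_field G v \<rho>) w)) (subring_of (ratfuns (invariant_field G w \<tau>) v)).
    \<forall>c\<in>ratfun_const ` base_field. h (ratfun_const c) = ratfun_const c"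
proof -
  let ?E = "invariant_field G v \<rho>" and ?E' = "invariant_field G w \<tau>"
  let ?P = "pair_invariants G v \<rho> w \<tau>" and ?P' = "pair_invariants G w \<tau> v \<rho>"
  note nn = no_name_lemma[OF G \<rho> \<tau>(1)] and nn' = no_name_lemma[OF G \<tau> \<rho>(1)]
  obtain \<Phi> where \<Phi>: "hom_on (ratfuns ?E w) \<Phi>" "bij_betw \<Phi> (ratfuns ?E w) ?P" "\<And>c. c \<in> ?E \<Longrightarrow> \<Phi> (ratfun_const c) = c"
    using nn(2) unfolding Bex_def ring_iso_subring_of by blast
  obtain \<Psi> where \<Psi>: "hom_on (ratfuns ?E' v) \<Psi>" "bij_betw \<Psi> (ratfuns ?E' v) ?P'" "\<And>c. c \<in> ?E' \<Longrightarrow> \<Psi> (ratfun_const c) = c"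
    using nn'(2) unfolding Bex_def ring_iso_subring_of by blast
  note Er' = subfield_setD(1)[OF nn'(1)]
  note R' = subfield_setD(1)[OF ratfuns_subfield[OF Er', of v]]
  note S = swap_vars_pair_invariants[OF G \<rho>(1) \<tau>(1)]
  define \<Psi>i where "\<Psi>i = inv_into (ratfuns ?E' v) \<Psi>"
  define h where "h x = \<Psi>i (swap_vars v w (\<Phi> x))" for x
  have hS: "hom_on (ratfuns ?E w) (\<lambda>x. swap_vars v w (\<Phi> x))"
    by (rule hom_on_comp[OF \<Phi>(1) subset_UNIV swap_vars_hom])
  have im: "(\<lambda>x. swap_vars v w (\<Phi> x)) ` ratfuns ?E w = ?P'"
    using \<Phi>(2) S by (simp add: bij_betw_def image_image[symmetric])
  have h\<Psi>: "hom_on ?P' \<Psi>i" unfolding \<Psi>i_def by (rule hom_on_inv_into[OF R' \<Psi>(1,2)])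
  have "hom_on (ratfuns ?E w) h"
    unfolding h_def[abs_def] by (rule hom_on_comp[OF hS equalityD1[OF im] h\<Psi>])
  moreover have "bij_betw h (ratfuns ?E w) (ratfuns ?E' v)"
    using bij_betw_trans[OF bij_betw_trans[OF \<Phi>(2) S] bij_betw_inv_into[OF \<Psi>(2)]]
    by (simp add: h_def[abs_def] \<Psi>i_def comp_def)
  moreover have "h (ratfun_const c) = ratfun_const c" if c: "c \<in> ratfun_const ` base_field" for c
  proof -
    obtain d where d: "c = ratfun_const d" "d \<in> base_field" using c by auto
    have cE: "c \<in> ?E" "c \<in> ?E'" unfolding d(1) by (rule base_field_invariant[OF G \<rho>(1) d(2)], rule base_field_invariant[OF G \<tau>(1) d(2)])
    have "swap_vars v w (\<Phi> (ratfun_const c)) = \<Psi> (ratfun_const c)"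
      using \<Phi>(3)[OF cE(1)] \<Psi>(3)[OF cE(2)] by (simp add: d swap_vars_const)
    moreover have "ratfun_const c \<in> ratfuns ?E' v"
      using cE subring_setD(2)[OF Er'] by (intro ratfun_const_in_ratfuns)
    ultimately show ?thesis using \<Psi>(2) by (simp add: h_def \<Psi>i_def bij_betw_def inv_into_f_f)
  qed
  ultimately show ?thesis by (intro bexI[of _ h]) (auto simp: ring_iso_subring_of)
qed

theorem corollary3p9:
  fixes G :: "'k::field_char_0 alg_closure mat set"
    and \<rho> \<tau> :: "'k alg_closure mat \<Rightarrow> 'k alg_closure mat"
    and n v w :: nat
  defines "k \<equiv> ratfun_const ` (base_field :: 'k alg_closure set)"
  assumes "reductive_group n G"
    and "linear_action n G v \<rho>" and "almost_free n G v \<rho>"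
    and "linear_action n G w \<tau>" and "almost_free n G w \<tau>"
  shows "stably_equivalent_over k (invariant_field G v \<rho>) (invariant_field G w \<tau>) \<and>
    (pure_over k (invariant_field G v \<rho>) \<longrightarrow> stably_pure_over k (invariant_field G w \<tau>)) \<and>
    (pure_over k (invariant_field G w \<tau>) \<longrightarrow> stably_pure_over k (invariant_field G v \<rho>))"
proof -
  have G: "linear_algebraic_group n G" using assms(2) by (simp add: reductive_group_def)
  note \<rho> = assms(3,4) and \<tau> = assms(5,6)
  have k: "subring_set k"
    unfolding k_def by (rule hom_image_subring[OF subring_set_UNIV ratfun_const_hom base_field_subring subset_UNIV])
  have sub: "k \<subseteq> invariant_field G u \<phi>" if "linear_action n G u \<phi>" for u \<phi>
    using base_field_invariant[OF G that] by (auto simp: k_def)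
  obtain h where h: "h \<in> ring_iso (subring_of (ratfuns (invariant_field G v \<rho>) w)) (subring_of (ratfuns (invariant_field G w \<tau>) v))"
    "\<forall>c\<in>k. h (ratfun_const c) = ratfun_const c"
    using stably_isomorphic_invariant_fields[OF G \<rho> \<tau>] unfolding k_def by blast
  obtain h' where h': "h' \<in> ring_iso (subring_of (ratfuns (invariant_field G w \<tau>) v)) (subring_of (ratfuns (invariant_field G v \<rho>) w))"
    "\<forall>c\<in>k. h' (ratfun_const c) = ratfun_const c"
    using stably_isomorphic_invariant_fields[OF G \<tau> \<rho>] unfolding k_def by blast
  have "stably_equivalent_over k (invariant_field G v \<rho>) (invariant_field G w \<tau>)"
    unfolding stably_equivalent_over_def using h by blast
  moreover have "pure_over k (invariant_field G v \<rho>) \<longrightarrow> stably_pure_over k (invariant_field G w \<tau>)"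
    using stably_pure_over_iso[OF k sub[OF \<rho>(1)] no_name_lemma(1)[OF G \<rho> \<tau>(1)] h] by blast
  moreover have "pure_over k (invariant_field G w \<tau>) \<longrightarrow> stably_pure_over k (invariant_field G v \<rho>)"
    using stably_pure_over_iso[OF k sub[OF \<tau>(1)] no_name_lemma(1)[OF G \<tau> \<rho>(1)] h'] by blast
  ultimately show ?thesis by blast
qed

end
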